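(* Let $\lambda,\mu\in\mathbb{C}$. Then, as complex vector spaces, $$\mathrm{Ext}^1_{\mathcal{O}}(\Delta(\mu),\Delta(\lambda))\cong\begin{cases}\mathbb{C}, & \text{if } \lambda-\mu\in\{2,3,4\};\\ \mathbb{C}, & \text{if } (\lambda,\mu)=(0,-1),\ (0,-5) \text{ or } (4,-1);\\ \mathbb{C}, & \text{if } (\lambda,\mu)=\left(\frac{5\pm\sqrt{19}}{2},\frac{-7\pm\sqrt{19}}{2}\right);\\ 0, & \text{otherwise,}\end{cases}$$ where in the third line the same sign is taken in both entries.
   Context: All vector spaces and Lie algebras are over $\mathbb{C}$. Let $\mathfrak{W}=\mathrm{Der}_{\mathbb{C}}\,\mathbb{C}[x]$, the Lie algebra with basis $d_i=x^{i+1}\frac{\partial}{\partial x}$, $i\in\mathbb{Z}_{\ge -1}$, and bracket $[d_i,d_j]=(j-i)d_{i+j}$. Put $\mathfrak{h}=\mathbb{C}d_0$, $\mathfrak{W}^+=\mathrm{span}\{d_i\mid i\in\mathbb{Z}_{>0}\}$ and $\mathfrak{b}=\mathfrak{h}\oplus\mathfrak{W}^+$. A $\mathfrak{W}$-module $M$ is a weight module if $M=\bigoplus_{\lambda\in\mathbb{C}}M_\lambda$, where $M_\lambda=\{v\in M\mid d_0v=\lambda v\}$. Category $\mathcal{O}$ is the full subcategory of the category of left $U(\mathfrak{W})$-modules whose objects are the modules $M$ such that (a) $M$ is a finitely generated $U(\mathfrak{W})$-module; (b) $M$ is a weight module; (c) for each $v\in M$, the subspace $U(\mathfrak{W}^+)v$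 is finite dimensional. For $\lambda\in\mathbb{C}$ let $\mathbb{C}_\lambda=\mathbb{C}v_\lambda$ be the one-dimensional $\mathfrak{b}$-module with $\mathfrak{W}^+v_\lambda=0$, $d_0v_\lambda=\lambda v_\lambda$. The Verma module is $\Delta(\lambda)=U(\mathfrak{W})\otimes_{U(\mathfrak{b})}\mathbb{C}_\lambda$. For $M,N\in\mathcal{O}$, $\mathrm{Ext}^1_{\mathcal{O}}(M,N)$ is the space of equivalence classes of short exact sequences $0\to N\to K\to M\to 0$ with $K\in\mathcal{O}$. *)

theory Defs
  imports Complex_Main "HOL-Algebra.Algebra" "HOL-Algebra.Algebraic_Closure_Type"
    "HOL-Computational_Algebra.Polynomial"
begin

hide_const (open) Polynomial.smult Polynomial.coeff Polynomial.monom

section \<open>Left modules over arbitrary rings\<close>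

text \<open>
  The records of \<^theory>\<open>HOL-Algebra.Module\<close> are used for modules.  The locale
  \<^locale>\<open>module\<close> only covers commutative rings, so its axioms are restated for an arbitrary
  ring.  The fields \<^const>\<open>monoid.mult\<close> and \<^const>\<open>one\<close>, which modules inherit from the
  record type of rings, play no role.
\<close>

locale left_module = R?: ring R + M?: abelian_group M
  for R :: "('a, 'r) ring_scheme" (structure) and M :: "('a, 'b, 'm) module_scheme" (structure) +
  assumes smult_closed:
      "\<lbrakk>a \<in> carrier R; x \<in> carrier M\<rbrakk> \<Longrightarrow> a \<odot>\<^bsub>M\<^esub> x \<in> carrier M"
    and smult_l_distr:
      "\<lbrakk>a \<in> carrier R; b \<in> carrier R; x \<in> carrier M\<rbrakk> \<Longrightarrow>
       (a \<oplus> b) \<odot>\<^bsub>M\<^esub> x = a \<odot>\<^bsub>M\<^esub> x \<oplus>\<^bsub>M\<^esub> b \<odot>\<^bsub>M\<^esub> x"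
    and smult_r_distr:
      "\<lbrakk>a \<in> carrier R; x \<in> carrier M; y \<in> carrier M\<rbrakk> \<Longrightarrow>
       a \<odot>\<^bsub>M\<^esub> (x \<oplus>\<^bsub>M\<^esub> y) = a \<odot>\<^bsub>M\<^esub> x \<oplus>\<^bsub>M\<^esub> a \<odot>\<^bsub>M\<^esub> y"
    and smult_assoc1:
      "\<lbrakk>a \<in> carrier R; b \<in> carrier R; x \<in> carrier M\<rbrakk> \<Longrightarrow>
       (a \<otimes> b) \<odot>\<^bsub>M\<^esub> x = a \<odot>\<^bsub>M\<^esub> (b \<odot>\<^bsub>M\<^esub> x)"
    and smult_one:
      "x \<in> carrier M \<Longrightarrow> \<one> \<odot>\<^bsub>M\<^esub> x = x"

definition mod_hom ::
  "('a, 'r) ring_scheme \<Rightarrow> ('a, 'b, 'm) module_scheme \<Rightarrow> ('a, 'c, 'n) module_scheme \<Rightarrow> ('b \<Rightarrow> 'c) set"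
  where "mod_hom R M N =
    {f \<in> hom (add_monoid M) (add_monoid N).
       \<forall>a\<in>carrier R. \<forall>x\<in>carrier M. f (a \<odot>\<^bsub>M\<^esub> x) = a \<odot>\<^bsub>N\<^esub> f x}"

definition mod_isomorphic ::
  "('a, 'r) ring_scheme \<Rightarrow> ('a, 'b, 'm) module_scheme \<Rightarrow> ('a, 'c, 'n) module_scheme \<Rightarrow> bool"
  where "mod_isomorphic R M N \<longleftrightarrow> (\<exists>f\<in>mod_hom R M N. bij_betw f (carrier M) (carrier N))"

definition gen_submodule ::
  "('a, 'r) ring_scheme \<Rightarrow> ('a, 'b, 'm) module_scheme \<Rightarrow> 'b set \<Rightarrow> 'b set"
  where "gen_submodule R M S = \<Inter>{H. submodule H R M \<and> S \<subseteq> H}"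

definition fin_generated :: "('a, 'r) ring_scheme \<Rightarrow> ('a, 'b, 'm) module_scheme \<Rightarrow> bool"
  where "fin_generated R M \<longleftrightarrow>
    (\<exists>S. finite S \<and> S \<subseteq> carrier M \<and> gen_submodule R M S = carrier M)"

definition restrict_scalars :: "('a \<Rightarrow> 'b) \<Rightarrow> ('b, 'c) module \<Rightarrow> ('a, 'c) module"
  where "restrict_scalars \<phi> M =
    \<lparr>carrier = carrier M, monoid.mult = monoid.mult M, one = one M, ring.zero = \<zero>\<^bsub>M\<^esub>, add = add M,
     smult = \<lambda>a x. \<phi> a \<odot>\<^bsub>M\<^esub> x\<rparr>"

definition quot_module :: "('a, 'b, 'm) module_scheme \<Rightarrow> 'b set \<Rightarrow> ('a, 'b set) module"
  where "quot_module M H =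
    \<lparr>carrier = a_rcosets\<^bsub>M\<^esub> H, monoid.mult = undefined, one = undefined, ring.zero = H, add = set_add M,
     smult = \<lambda>a C. \<Union>x\<in>C. H +>\<^bsub>M\<^esub> (a \<odot>\<^bsub>M\<^esub> x)\<rparr>"

definition prod_module :: "('a, 'b) module \<Rightarrow> ('a, 'c) module \<Rightarrow> ('a, 'b \<times> 'c) module"
  where "prod_module M N =
    \<lparr>carrier = carrier M \<times> carrier N, monoid.mult = undefined, one = undefined,
     ring.zero = (\<zero>\<^bsub>M\<^esub>, \<zero>\<^bsub>N\<^esub>),
     add = \<lambda>(x, y) (x', y'). (x \<oplus>\<^bsub>M\<^esub> x', y \<oplus>\<^bsub>N\<^esub> y'),
     smult = \<lambda>a (x, y). (a \<odot>\<^bsub>M\<^esub> x, a \<odot>\<^bsub>N\<^esub> y)\<rparr>"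

text \<open>
  Extension of scalars: for a ring homomorphism \<open>\<phi>\<close> from \<open>R\<close> to \<open>S\<close> and a left
  \<open>R\<close>-module \<open>M\<close>, the tensor product of \<open>S\<close> and \<open>M\<close> over \<open>R\<close> is the free abelian group on
  the pairs \<open>(s, m)\<close>, modulo biadditivity and \<open>(s \<phi>(r), m) = (s, r m)\<close>; an element of \<open>S\<close>
  acts by left multiplication on the first components.
\<close>

definition free_pairs ::
  "('s, 'x) ring_scheme \<Rightarrow> ('a, 'b, 'm) module_scheme \<Rightarrow> ('s, 's \<times> 'b \<Rightarrow> int) module"
  where "free_pairs S M =
    \<lparr>carrier = {f. finite {p. f p \<noteq> 0} \<and> {p. f p \<noteq> 0} \<subseteq> carrier S \<times> carrier M},
     monoid.mult = undefined, one = undefined, ring.zero = (\<lambda>p. 0), add = (\<lambda>f g p. f p + g p),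
     smult = \<lambda>s f (t, m). \<Sum>u | f (u, m) \<noteq> 0 \<and> s \<otimes>\<^bsub>S\<^esub> u = t. f (u, m)\<rparr>"

definition pair_gen :: "'s \<times> 'b \<Rightarrow> 's \<times> 'b \<Rightarrow> int"
  where "pair_gen p = (\<lambda>q. if q = p then 1 else 0)"

definition balance_rels ::
  "('a \<Rightarrow> 's) \<Rightarrow> ('a, 'r) ring_scheme \<Rightarrow> ('s, 'x) ring_scheme \<Rightarrow> ('a, 'b, 'm) module_scheme
   \<Rightarrow> ('s \<times> 'b \<Rightarrow> int) set"
  where "balance_rels \<phi> R S M =
    {(\<lambda>q. pair_gen (s \<oplus>\<^bsub>S\<^esub> t, m) q - pair_gen (s, m) q - pair_gen (t, m) q) | s t m.
        s \<in> carrier S \<and> t \<in> carrier S \<and> m \<in> carrier M} \<union>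
    {(\<lambda>q. pair_gen (s, m \<oplus>\<^bsub>M\<^esub> n) q - pair_gen (s, m) q - pair_gen (s, n) q) | s m n.
        s \<in> carrier S \<and> m \<in> carrier M \<and> n \<in> carrier M} \<union>
    {(\<lambda>q. pair_gen (s \<otimes>\<^bsub>S\<^esub> \<phi> r, m) q - pair_gen (s, r \<odot>\<^bsub>M\<^esub> m) q) | s r m.
        s \<in> carrier S \<and> r \<in> carrier R \<and> m \<in> carrier M}"

definition extend_scalars ::
  "('a \<Rightarrow> 's) \<Rightarrow> ('a, 'r) ring_scheme \<Rightarrow> ('s, 'x) ring_scheme \<Rightarrow> ('a, 'b, 'm) module_scheme
   \<Rightarrow> ('s, ('s \<times> 'b \<Rightarrow> int) set) module"
  where "extend_scalars \<phi> R S M =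
    quot_module (free_pairs S M)
      (generate (add_monoid (free_pairs S M)) (balance_rels \<phi> R S M))"


section \<open>Lie algebras and their enveloping algebras\<close>

abbreviation complex_ring :: "complex ring" (\<open>\<C>\<close>)
  where "\<C> \<equiv> ring_of_type_algebra"

definition complex_line :: "(complex, complex) module"
  where "complex_line =
    \<lparr>carrier = UNIV, monoid.mult = (*), one = 1, ring.zero = 0, add = (+), smult = (*)\<rparr>"

definition zero_space :: "(complex, complex) module"
  where "zero_space = complex_line\<lparr>carrier := {0}\<rparr>"

record 'g lie_algebra = "(complex, 'g) module" +
  bracket :: "'g \<Rightarrow> 'g \<Rightarrow> 'g"

locale lie_algebra = module "\<C>" L for L :: "('g, 'l) lie_algebra_scheme" (structure) +
  assumes bracket_closed:
      "\<lbrakk>x \<in> carrier L; y \<in> carrier L\<rbrakk> \<Longrightarrow> bracket L x y \<in> carrier L"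
    and bracket_add_left:
      "\<lbrakk>x \<in> carrier L; y \<in> carrier L; z \<in> carrier L\<rbrakk> \<Longrightarrow>
       bracket L (x \<oplus>\<^bsub>L\<^esub> y) z = bracket L x z \<oplus>\<^bsub>L\<^esub> bracket L y z"
    and bracket_smult_left:
      "\<lbrakk>x \<in> carrier L; y \<in> carrier L\<rbrakk> \<Longrightarrow>
       bracket L (c \<odot>\<^bsub>L\<^esub> x) y = c \<odot>\<^bsub>L\<^esub> bracket L x y"
    and bracket_add_right:
      "\<lbrakk>x \<in> carrier L; y \<in> carrier L; z \<in> carrier L\<rbrakk> \<Longrightarrow>
       bracket L x (y \<oplus>\<^bsub>L\<^esub> z) = bracket L x y \<oplus>\<^bsub>L\<^esub> bracket L x z"
    and bracket_smult_right:
      "\<lbrakk>x \<in> carrier L; y \<in> carrier L\<rbrakk> \<Longrightarrow>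
       bracket L x (c \<odot>\<^bsub>L\<^esub> y) = c \<odot>\<^bsub>L\<^esub> bracket L x y"
    and bracket_self: "x \<in> carrier L \<Longrightarrow> bracket L x x = \<zero>\<^bsub>L\<^esub>"
    and jacobi:
      "\<lbrakk>x \<in> carrier L; y \<in> carrier L; z \<in> carrier L\<rbrakk> \<Longrightarrow>
       bracket L x (bracket L y z) \<oplus>\<^bsub>L\<^esub> bracket L y (bracket L z x)
         \<oplus>\<^bsub>L\<^esub> bracket L z (bracket L x y) = \<zero>\<^bsub>L\<^esub>"

text \<open>
  The free associative unital complex algebra on the underlying set of \<open>L\<close>: finitely
  supported functions on words, with the convolution product.  The enveloping algebra is its
  quotient by the relations of linearity (which turn it into the tensor algebra of \<open>L\<close>) and
  \<open>x y - y x = [x, y]\<close>.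
\<close>

definition free_algebra :: "('g, 'l) lie_algebra_scheme \<Rightarrow> ('g list \<Rightarrow> complex) ring"
  where "free_algebra L =
    \<lparr>carrier = {f. finite {w. f w \<noteq> 0} \<and> {w. f w \<noteq> 0} \<subseteq> lists (carrier L)},
     monoid.mult = (\<lambda>f g w. \<Sum>(u, v) | u @ v = w. f u * g v),
     one = (\<lambda>w. if w = [] then 1 else 0),
     ring.zero = (\<lambda>w. 0),
     add = (\<lambda>f g w. f w + g w)\<rparr>"

definition word_gen :: "'g list \<Rightarrow> 'g list \<Rightarrow> complex"
  where "word_gen u = (\<lambda>w. if w = u then 1 else 0)"

definition UEA_rels :: "('g, 'l) lie_algebra_scheme \<Rightarrow> ('g list \<Rightarrow> complex) set"
  where "UEA_rels L =
    {(\<lambda>w. word_gen [x \<oplus>\<^bsub>L\<^esub> y] w - word_gen [x] w - word_gen [y] w) | x y.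
        x \<in> carrier L \<and> y \<in> carrier L} \<union>
    {(\<lambda>w. word_gen [c \<odot>\<^bsub>L\<^esub> x] w - c * word_gen [x] w) | c x. x \<in> carrier L} \<union>
    {(\<lambda>w. word_gen [x, y] w - word_gen [y, x] w - word_gen [bracket L x y] w) | x y.
        x \<in> carrier L \<and> y \<in> carrier L}"

definition UEA_ideal :: "('g, 'l) lie_algebra_scheme \<Rightarrow> ('g list \<Rightarrow> complex) set"
  where "UEA_ideal L = Idl\<^bsub>free_algebra L\<^esub> (UEA_rels L)"

definition UEA :: "('g, 'l) lie_algebra_scheme \<Rightarrow> ('g list \<Rightarrow> complex) set ring"
  where "UEA L = free_algebra L Quot UEA_ideal L"

definition UEA_gen :: "('g, 'l) lie_algebra_scheme \<Rightarrow> 'g \<Rightarrow> ('g list \<Rightarrow> complex) set"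
  where "UEA_gen L x = UEA_ideal L +>\<^bsub>free_algebra L\<^esub> word_gen [x]"

definition UEA_scalar :: "('g, 'l) lie_algebra_scheme \<Rightarrow> complex \<Rightarrow> ('g list \<Rightarrow> complex) set"
  where "UEA_scalar L c = UEA_ideal L +>\<^bsub>free_algebra L\<^esub> (\<lambda>w. c * word_gen [] w)"

text \<open>The homomorphism \<open>U(H) \<rightarrow> U(L)\<close> induced by the inclusion of a Lie subalgebra \<open>H\<close> of \<open>L\<close>
  sends the class of \<open>f\<close> in \<open>U(H)\<close> to the class of \<open>f\<close> in \<open>U(L)\<close>.\<close>

definition UEA_incl ::
  "('g, 'l) lie_algebra_scheme \<Rightarrow> ('g list \<Rightarrow> complex) set \<Rightarrow> ('g list \<Rightarrow> complex) set"
  where "UEA_incl L C = (\<Union>f\<in>C. UEA_ideal L +>\<^bsub>free_algebra L\<^esub> f)"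

text \<open>The left \<open>U(L)\<close>-module given by a representation \<open>\<rho>\<close> of \<open>L\<close> on a complex vector space:
  a word \<open>[x1, ..., xn]\<close> acts as \<open>\<rho> x1 \<circ> ... \<circ> \<rho> xn\<close>.\<close>

definition UEA_module ::
  "(complex, 'v) module \<Rightarrow> ('g \<Rightarrow> 'v \<Rightarrow> 'v) \<Rightarrow> (('g list \<Rightarrow> complex) set, 'v) module"
  where "UEA_module V \<rho> =
    \<lparr>carrier = carrier V, monoid.mult = monoid.mult V, one = one V, ring.zero = \<zero>\<^bsub>V\<^esub>, add = add V,
     smult = \<lambda>C v. the_elem
       ((\<lambda>f. \<Oplus>\<^bsub>V\<^esub>w\<in>{w. f w \<noteq> 0}. f w \<odot>\<^bsub>V\<^esub> foldr \<rho> w v) ` C)\<rparr>"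


section \<open>The Lie algebra of polynomial vector fields\<close>

type_synonym endo = "complex poly \<Rightarrow> complex poly"

definition derivations :: "endo set"
  where "derivations =
    {D. (\<forall>p q. D (p + q) = D p + D q) \<and>
        (\<forall>c p. D (Polynomial.smult c p) = Polynomial.smult c (D p)) \<and>
        (\<forall>p q. D (p * q) = D p * q + p * D q)}"

definition witt :: "endo lie_algebra"
  where "witt =
    \<lparr>carrier = derivations, monoid.mult = undefined, one = undefined, ring.zero = (\<lambda>p. 0),
     add = (\<lambda>D E p. D p + E p), smult = (\<lambda>c D p. Polynomial.smult c (D p)),
     bracket = (\<lambda>D E p. D (E p) - E (D p))\<rparr>"

text \<open>\<open>dd i\<close> is only used for \<open>i \<ge> -1\<close>.\<close>

definition dd :: "int \<Rightarrow> endo"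
  where "dd i = (\<lambda>p. Polynomial.monom 1 (nat (i + 1)) * pderiv p)"

definition witt_pos :: "endo lie_algebra"
  where "witt_pos = witt\<lparr>carrier := gen_submodule \<C> witt {dd i | i. i > 0}\<rparr>"

definition borel :: "endo lie_algebra"
  where "borel =
    witt\<lparr>carrier := gen_submodule \<C> witt {dd 0} <+>\<^bsub>witt\<^esub> carrier witt_pos\<rparr>"

type_synonym uwitt = "(endo list \<Rightarrow> complex) set"

text \<open>A derivation \<open>D\<close> in the Borel subalgebra is a linear combination of the \<open>dd i\<close> with
  \<open>i \<ge> 0\<close>; since \<open>dd i\<close> maps \<open>x\<close> to \<open>x^(i+1)\<close>, the coefficient of \<open>dd 0\<close> in \<open>D\<close> is the
  coefficient of \<open>x\<close> in \<open>D x\<close>.  See \<open>one_dim_d0\<close> and \<open>one_dim_pos\<close> below.\<close>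

definition one_dim_rep :: "complex \<Rightarrow> endo \<Rightarrow> complex \<Rightarrow> complex"
  where "one_dim_rep lam D z = lam * poly.coeff (D [:0, 1:]) 1 * z"

definition one_dim :: "complex \<Rightarrow> (uwitt, complex) module"
  where "one_dim lam = UEA_module complex_line (one_dim_rep lam)"

type_synonym verma_elem = "(uwitt \<times> complex \<Rightarrow> int) set"

definition verma :: "complex \<Rightarrow> (uwitt, verma_elem) module"
  where "verma lam = extend_scalars (UEA_incl witt) (UEA borel) (UEA witt) (one_dim lam)"


section \<open>Category O\<close>

definition weight_space :: "(uwitt, 'm) module \<Rightarrow> complex \<Rightarrow> 'm set"
  where "weight_space M c =
    {v \<in> carrier M. UEA_gen witt (dd 0) \<odot>\<^bsub>M\<^esub> v = UEA_scalar witt c \<odot>\<^bsub>M\<^esub> v}"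

definition weight_module :: "(uwitt, 'm) module \<Rightarrow> bool"
  where "weight_module M \<longleftrightarrow>
    (\<forall>v\<in>carrier M. \<exists>!f. (\<forall>c. f c \<in> weight_space M c) \<and> finite {c. f c \<noteq> \<zero>\<^bsub>M\<^esub>} \<and>
       v = (\<Oplus>\<^bsub>M\<^esub>c\<in>{c. f c \<noteq> \<zero>\<^bsub>M\<^esub>}. f c))"

definition locally_finite :: "(uwitt, 'm) module \<Rightarrow> bool"
  where "locally_finite M \<longleftrightarrow>
    (\<forall>v\<in>carrier M. fin_generated \<C>
       ((restrict_scalars (UEA_scalar witt) M)
          \<lparr>carrier := (\<lambda>C. UEA_incl witt C \<odot>\<^bsub>M\<^esub> v) ` carrier (UEA witt_pos)\<rparr>))"

definition in_category_O :: "(uwitt, 'm) module \<Rightarrow> bool"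
  where "in_category_O M \<longleftrightarrow>
    left_module (UEA witt) M \<and> fin_generated (UEA witt) M \<and> weight_module M \<and> locally_finite M"


section \<open>Extensions in category O\<close>

text \<open>A short exact sequence \<open>0 \<rightarrow> N \<rightarrow> K \<rightarrow> M \<rightarrow> 0\<close> is a triple \<open>(K, i, p)\<close>.\<close>

type_synonym ('n, 'm, 'k) extension = "(uwitt, 'k) module \<times> ('n \<Rightarrow> 'k) \<times> ('k \<Rightarrow> 'm)"

definition is_extension ::
  "(uwitt, 'm) module \<Rightarrow> (uwitt, 'n) module \<Rightarrow> ('n, 'm, 'k) extension \<Rightarrow> bool"
  where "is_extension M N = (\<lambda>(K, i, p).
    in_category_O K \<and> i \<in> mod_hom (UEA witt) N K \<and> p \<in> mod_hom (UEA witt) K M \<and>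
    inj_on i (carrier N) \<and> i ` carrier N = a_kernel K M p \<and> p ` carrier K = carrier M)"

text \<open>The middle terms of two equivalent extensions may live on different types.\<close>

definition equiv_extension ::
  "(uwitt, 'n) module \<Rightarrow> ('n, 'm, 'k) extension \<Rightarrow> ('n, 'm, 'l) extension \<Rightarrow> bool"
  where "equiv_extension N = (\<lambda>(K, i, p) (K', i', p').
    \<exists>f\<in>mod_hom (UEA witt) K K'. bij_betw f (carrier K) (carrier K') \<and>
      (\<forall>x\<in>carrier N. f (i x) = i' x) \<and> (\<forall>y\<in>carrier K. p' (f y) = p y))"

text \<open>
  Baer sum: the pullback of the direct sum of two extensions along the diagonal of \<open>M\<close>,
  modulo the antidiagonal copy of \<open>N\<close>.
\<close>

definition baer_sum ::
  "(uwitt, 'm) module \<Rightarrow> (uwitt, 'n) module \<Rightarrow> ('n, 'm, 'k) extension \<Rightarrow> ('n, 'm, 'l) extension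
   \<Rightarrow> ('n, 'm, ('k \<times> 'l) set) extension"
  where "baer_sum M N = (\<lambda>(K, i, p) (K', i', p').
    let P = (prod_module K K')
              \<lparr>carrier := {(y, y'). y \<in> carrier K \<and> y' \<in> carrier K' \<and> p y = p' y'}\<rparr>;
        H = (\<lambda>x. (i x, \<ominus>\<^bsub>K'\<^esub> i' x)) ` carrier N
    in (quot_module P H,
        \<lambda>x. H +>\<^bsub>P\<^esub> (i x, \<zero>\<^bsub>K'\<^esub>),
        \<lambda>C. the_elem ((\<lambda>(y, y'). p y) ` C)))"

text \<open>Scalar multiple: the pushout of an extension along multiplication by \<open>c\<close> on \<open>N\<close>.\<close>

definition scale_extension ::
  "(uwitt, 'n) module \<Rightarrow> complex \<Rightarrow> ('n, 'm, 'k) extension \<Rightarrow> ('n, 'm, ('n \<times> 'k) set) extension"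
  where "scale_extension N c = (\<lambda>(K, i, p).
    let P = prod_module N K;
        H = (\<lambda>x. (UEA_scalar witt c \<odot>\<^bsub>N\<^esub> x, \<ominus>\<^bsub>K\<^esub> i x)) ` carrier N
    in (quot_module P H,
        \<lambda>x. H +>\<^bsub>P\<^esub> (x, \<zero>\<^bsub>K\<^esub>),
        \<lambda>C. the_elem ((\<lambda>(x, y). p y) ` C)))"

definition split_extension ::
  "(uwitt, 'm) module \<Rightarrow> (uwitt, 'n) module \<Rightarrow> ('n, 'm, 'n \<times> 'm) extension"
  where "split_extension M N = (prod_module N M, \<lambda>x. (x, \<zero>\<^bsub>M\<^esub>), snd)"

text \<open>
  A set of representatives is needed to form equivalence classes.  Choosing a (set-theoretic)
  section of \<open>K \<rightarrow> M\<close> gives a bijection of the carrier of \<open>K\<close> with the product of the carriers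
  of \<open>N\<close> and \<open>M\<close>, along which the module structure can be transported.  Hence every extension
  is equivalent to one whose middle term lives on the type \<open>'n \<times> 'm\<close>, and it suffices to
  consider those.
\<close>

definition extension_class ::
  "(uwitt, 'm) module \<Rightarrow> (uwitt, 'n) module \<Rightarrow> ('n, 'm, 'k) extension
   \<Rightarrow> ('n, 'm, 'n \<times> 'm) extension set"
  where "extension_class M N E = {E'. is_extension M N E' \<and> equiv_extension N E E'}"

definition Ext1_O ::
  "(uwitt, 'm) module \<Rightarrow> (uwitt, 'n) module \<Rightarrow> (complex, ('n, 'm, 'n \<times> 'm) extension set) module"
  where "Ext1_O M N =
    \<lparr>carrier = extension_class M N ` {E :: ('n, 'm, 'n \<times> 'm) extension. is_extension M N E},
     monoid.mult = undefined, one = undefined,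
     ring.zero = extension_class M N (split_extension M N),
     add = \<lambda>C D. \<Union>E\<in>C. \<Union>E'\<in>D. extension_class M N (baer_sum M N E E'),
     smult = \<lambda>c C. \<Union>E\<in>C. extension_class M N (scale_extension N c E)\<rparr>"


section \<open>Consistency of the definitions\<close>

text \<open>
  The free algebra is a ring (so the two-sided ideal and the quotient above are meaningful),
  the polynomial vector fields form a Lie algebra with the stated bracket, and the action of
  \<open>U(borel)\<close> on the one-dimensional module is well defined and is the intended one.
\<close>

lemma finite_splits: "finite {(u, v). u @ v = w}"
proof (rule finite_subset)
  show "{(u, v). u @ v = w} \<subseteq> (\<lambda>k. (take k w, drop k w)) ` {..length w}"
  proof (clarify)
    fix u v :: "'a list"
    show "(u, v) \<in> (\<lambda>k. (take k (u @ v), drop k (u @ v))) ` {..length (u @ v)}"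
      by (rule image_eqI[where x = "length u"]) auto
  qed
qed simp

lemma ring_free_algebra: "ring (free_algebra L)"
proof (rule ringI)
  have mult_carrier: "f \<otimes>\<^bsub>free_algebra L\<^esub> g \<in> carrier (free_algebra L)"
    if "f \<in> carrier (free_algebra L)" "g \<in> carrier (free_algebra L)" for f g
  proof -
    let ?h = "\<lambda>w. \<Sum>(u, v) | u @ v = w. f u * g v"
    have "{w. ?h w \<noteq> 0} \<subseteq> (\<lambda>(u, v). u @ v) ` ({u. f u \<noteq> 0} \<times> {v. g v \<noteq> 0})"
    proof
      fix w assume "w \<in> {w. ?h w \<noteq> 0}"
      then obtain u v where "u @ v = w" "f u * g v \<noteq> 0"
        by (smt (verit) mem_Collect_eq split_def sum.not_neutral_contains_not_neutral)
      then show "w \<in> (\<lambda>(u, v). u @ v) ` ({u. f u \<noteq> 0} \<times> {v. g v \<noteq> 0})" by force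
    qed
    moreover have "finite ((\<lambda>(u, v). u @ v) ` ({u. f u \<noteq> 0} \<times> {v. g v \<noteq> 0}))"
      using that by (simp add: free_algebra_def)
    moreover have "(\<lambda>(u, v). u @ v) ` ({u. f u \<noteq> 0} \<times> {v. g v \<noteq> 0}) \<subseteq> lists (carrier L)"
      using that by (fastforce simp: free_algebra_def)
    ultimately show ?thesis
      by (simp add: free_algebra_def) (meson finite_subset subset_trans)
  qed
  have one_carrier: "\<one>\<^bsub>free_algebra L\<^esub> \<in> carrier (free_algebra L)"
    by (auto simp: free_algebra_def)
  show "abelian_group (free_algebra L)"
  proof (rule abelian_groupI)
    fix f g assume fg: "f \<in> carrier (free_algebra L)" "g \<in> carrier (free_algebra L)"
    have "{w. f w + g w \<noteq> 0} \<subseteq> {w. f w \<noteq> 0} \<union> {w. g w \<noteq> 0}" by auto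
    with fg show "f \<oplus>\<^bsub>free_algebra L\<^esub> g \<in> carrier (free_algebra L)"
      by (simp add: free_algebra_def) (meson finite_UnI finite_subset le_sup_iff subset_trans)
  next
    fix f assume f: "f \<in> carrier (free_algebra L)"
    then show "\<exists>g\<in>carrier (free_algebra L). g \<oplus>\<^bsub>free_algebra L\<^esub> f = \<zero>\<^bsub>free_algebra L\<^esub>"
      by (intro bexI[of _ "\<lambda>w. - f w"]) (auto simp: free_algebra_def)
  qed (auto simp: free_algebra_def)
  show "monoid (free_algebra L)"
  proof (rule monoidI)
    fix f g h :: "'a list \<Rightarrow> complex"
    show "f \<otimes>\<^bsub>free_algebra L\<^esub> g \<otimes>\<^bsub>free_algebra L\<^esub> h = f \<otimes>\<^bsub>free_algebra L\<^esub> (g \<otimes>\<^bsub>free_algebra L\<^esub> h)"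
    proof
      fix w
      have "(\<Sum>(p, c) | p @ c = w. (\<Sum>(a, b) | a @ b = p. f a * g b) * h c) =
            (\<Sum>((p, c), (a, b)) \<in> Sigma {(p, c). p @ c = w} (\<lambda>(p, c). {(a, b). a @ b = p}). f a * g b * h c)"
        by (subst sum.Sigma[symmetric])
           (auto simp: finite_splits[unfolded split_def] split_def sum_distrib_right intro!: sum.cong)
      also have "\<dots> = (\<Sum>((a, q), (b, c)) \<in> Sigma {(a, q). a @ q = w} (\<lambda>(a, q). {(b, c). b @ c = q}). f a * g b * h c)"
        by (rule sum.reindex_bij_witness[of _ "\<lambda>((a, q), (b, c)). ((a @ b, c), (a, b))" "\<lambda>((p, c), (a, b)). ((a, b @ c), (b, c))"]) auto
      also have "\<dots> = (\<Sum>(a, q) | a @ q = w. f a * (\<Sum>(b, c) | b @ c = q. g b * h c))"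
        by (subst sum.Sigma[symmetric])
           (auto simp: finite_splits[unfolded split_def] split_def sum_distrib_left mult.assoc intro!: sum.cong)
      finally show "(f \<otimes>\<^bsub>free_algebra L\<^esub> g \<otimes>\<^bsub>free_algebra L\<^esub> h) w = (f \<otimes>\<^bsub>free_algebra L\<^esub> (g \<otimes>\<^bsub>free_algebra L\<^esub> h)) w"
        by (simp add: free_algebra_def)
    qed
  next
    fix f :: "'a list \<Rightarrow> complex"
    have "(\<Sum>(u, v) | u @ v = w. (if u = [] then 1 else 0) * f v) =
          (\<Sum>(u :: 'a list, v) \<in> {([], w)}. (if u = [] then 1 else 0) * f v)" for w
      by (rule sum.mono_neutral_right) (auto simp: finite_splits split: if_splits)
    then show "\<one>\<^bsub>free_algebra L\<^esub> \<otimes>\<^bsub>free_algebra L\<^esub> f = f" by (simp add: free_algebra_def)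
    have "(\<Sum>(u, v) | u @ v = w. f u * (if v = [] then 1 else 0)) =
          (\<Sum>(u, v :: 'a list) \<in> {(w, [])}. f u * (if v = [] then 1 else 0))" for w
      by (rule sum.mono_neutral_right) (auto simp: finite_splits split: if_splits)
    then show "f \<otimes>\<^bsub>free_algebra L\<^esub> \<one>\<^bsub>free_algebra L\<^esub> = f" by (simp add: free_algebra_def)
  qed (auto intro: mult_carrier one_carrier)
qed (auto simp: free_algebra_def fun_eq_iff distrib_left distrib_right sum.distrib split_def)

lemma lie_algebra_witt: "lie_algebra witt"
proof -
  have "module \<C> witt"
  proof (rule moduleI)
    show "cring \<C>" ..
    show "abelian_group witt"
    proof (rule abelian_groupI)
      fix D assume "D \<in> carrier witt"
      then show "\<exists>E\<in>carrier witt. E \<oplus>\<^bsub>witt\<^esub> D = \<zero>\<^bsub>witt\<^esub>"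
        by (intro bexI[of _ "\<lambda>p. - D p"]) (auto simp: witt_def derivations_def fun_eq_iff)
    qed (auto simp: witt_def derivations_def fun_eq_iff algebra_simps smult_add_right)
  qed (auto simp: witt_def derivations_def fun_eq_iff ring_of_type_algebra_def
         algebra_simps smult_add_left smult_add_right)
  moreover have "lie_algebra_axioms witt"
  proof
    fix D E F and c :: complex
    assume D: "D \<in> carrier witt" and E: "E \<in> carrier witt"
    note DE = D[unfolded witt_def derivations_def, simplified]
              E[unfolded witt_def derivations_def, simplified]
    have diff: "H (p - q) = H p - H q" if "H \<in> derivations" for H p q
    proof -
      have "H (p + Polynomial.smult (-1) q) = H p + Polynomial.smult (-1) (H q)"
        using that unfolding derivations_def by (metis (mono_tags, lifting) mem_Collect_eq)
      then show ?thesis by simp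
    qed
    show "bracket witt D E \<in> carrier witt"
      using DE by (auto simp: witt_def derivations_def algebra_simps smult_diff_right)
    show "bracket witt (c \<odot>\<^bsub>witt\<^esub> D) E = c \<odot>\<^bsub>witt\<^esub> bracket witt D E"
         "bracket witt D (c \<odot>\<^bsub>witt\<^esub> E) = c \<odot>\<^bsub>witt\<^esub> bracket witt D E"
      using DE by (auto simp: witt_def fun_eq_iff smult_diff_right)
    show "bracket witt D D = \<zero>\<^bsub>witt\<^esub>" by (simp add: witt_def)
    assume F: "F \<in> carrier witt"
    note DEF = DE F[unfolded witt_def derivations_def, simplified]
    show "bracket witt (D \<oplus>\<^bsub>witt\<^esub> E) F = bracket witt D F \<oplus>\<^bsub>witt\<^esub> bracket witt E F"
         "bracket witt D (E \<oplus>\<^bsub>witt\<^esub> F) = bracket witt D E \<oplus>\<^bsub>witt\<^esub> bracket witt D F"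
      using DEF by (auto simp: witt_def fun_eq_iff)
    show "bracket witt D (bracket witt E F) \<oplus>\<^bsub>witt\<^esub> bracket witt E (bracket witt F D)
          \<oplus>\<^bsub>witt\<^esub> bracket witt F (bracket witt D E) = \<zero>\<^bsub>witt\<^esub>"
      using D E F by (auto simp: witt_def fun_eq_iff diff)
  qed
  ultimately show ?thesis by (rule lie_algebra.intro)
qed

lemma dd_in_witt: "dd i \<in> carrier witt"
  by (auto simp: witt_def derivations_def dd_def pderiv_add pderiv_mult pderiv_smult algebra_simps)

lemma bracket_dd:
  assumes "i \<ge> -1" "j \<ge> -1"
  shows "bracket witt (dd i) (dd j) = of_int (j - i) \<odot>\<^bsub>witt\<^esub> dd (i + j)"
proof -
  obtain m n where mn: "i = int m - 1" "j = int n - 1"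
    using assms by (metis add.commute add_diff_cancel_right' diff_add_cancel uminus_add_conv_diff zle_iff_zadd)
  have "Polynomial.monom (of_nat n) (m + (n - Suc 0)) = Polynomial.monom (of_nat m) (n + (m - Suc 0)) +
      Polynomial.smult (of_nat n - of_nat m) (Polynomial.monom (1 :: complex) (nat (int m + int n - 1)))"
    by (cases m; cases n) (auto simp: poly_eq_iff nat_add_distrib)
  from arg_cong[OF this, of "\<lambda>q. pderiv p * q" for p] show ?thesis
    unfolding mn by (auto simp: witt_def dd_def fun_eq_iff pderiv_mult pderiv_monom mult_monom algebra_simps)
qed

lemma derivation_eq:
  assumes "D \<in> derivations"
  shows "D p = D [:0, 1:] * pderiv p"
proof -
  have add: "D (p + q) = D p + D q" and smult: "D (Polynomial.smult c p) = Polynomial.smult c (D p)"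
    and mult: "D (p * q) = D p * q + p * D q" for p q c
    using assms by (auto simp: derivations_def)
  have "D 1 = 0" using mult[of 1 1] by simp
  then have const: "D [:c:] = 0" for c using smult[of c 1] by simp
  show ?thesis
  proof (induction p)
    case 0
    then show ?case using const[of 0] by simp
  next
    case (pCons a p)
    have "D (pCons a p) = D ([:a:] + [:0, 1:] * p)" by simp
    also have "\<dots> = D [:0, 1:] * p + [:0, 1:] * D p" by (simp only: add const mult) simp
    finally show ?case using pCons.IH by (simp add: pderiv_pCons algebra_simps)
  qed
qed

lemma carrier_borel: "carrier borel = {D \<in> derivations. poly.coeff (D [:0, 1:]) 0 = 0}"
proof -
  interpret W: lie_algebra witt by (rule lie_algebra_witt)
  let ?K = "{D \<in> derivations. poly.coeff (D [:0, 1:]) 0 = 0}"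
  have carr: "carrier witt = derivations" by (simp add: witt_def)
  have "submodule ?K \<C> witt"
  proof (rule W.submoduleI)
    fix D assume D: "D \<in> ?K"
    have "(\<lambda>p. - D p) \<in> ?K" using D by (auto simp: derivations_def)
    moreover from this have "\<ominus>\<^bsub>witt\<^esub> D = (\<lambda>p. - D p)"
      by (intro W.minus_equality) (use D in \<open>auto simp: carr witt_def\<close>)
    ultimately show "\<ominus>\<^bsub>witt\<^esub> D \<in> ?K" by simp
  qed (auto simp: witt_def derivations_def algebra_simps smult_add_right)
  moreover have "dd i \<in> ?K" if "i \<ge> 0" for i
    using that dd_in_witt[of i] by (auto simp: carr dd_def pderiv_pCons coeff_monom)
  ultimately have "gen_submodule \<C> witt {dd 0} \<subseteq> ?K" "carrier witt_pos \<subseteq> ?K"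
    unfolding gen_submodule_def witt_pos_def by auto
  then have "carrier borel \<subseteq> ?K"
    by (fastforce simp: borel_def set_add_def' witt_def derivations_def algebra_simps smult_add_right)
  moreover have "D \<in> carrier borel" if D: "D \<in> ?K" for D
  proof -
    define q where "q = D [:0, 1:]"
    have Dq: "D p = q * pderiv p" for p using D derivation_eq unfolding q_def by blast
    have q0: "poly.coeff q 0 = 0" using D by (simp add: q_def)
    let ?D0 = "poly.coeff q 1 \<odot>\<^bsub>witt\<^esub> dd 0"
    let ?S = "\<lambda>n p. (\<Sum>k\<in>{2..<n}. Polynomial.monom (poly.coeff q k) k) * pderiv p"
    have smult_dd: "poly.coeff q n \<odot>\<^bsub>witt\<^esub> dd (int n - 1) =
        (\<lambda>p. Polynomial.monom (poly.coeff q n) n * pderiv p)" for n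
      by (simp add: witt_def dd_def mult_smult_left[symmetric] smult_monom del: mult_smult_left)
    have "?D0 \<in> gen_submodule \<C> witt {dd 0}"
      by (auto simp: gen_submodule_def ring_of_type_algebra_def submodule_def submodule_axioms_def)
    moreover have "?S n \<in> carrier witt_pos" for n
    proof -
      have "?S n \<in> H" if H: "submodule H \<C> witt" "{dd i |i. i > 0} \<subseteq> H" for H
      proof (induction n)
        case 0
        show ?case using H(1)[THEN submodule.axioms(1), THEN subgroup.one_closed] by (simp add: witt_def)
      next
        case (Suc n)
        show ?case
        proof (cases "n \<ge> 2")
          case True
          then have "dd (int n - 1) \<in> H" using H(2) by force
          then have "poly.coeff q n \<odot>\<^bsub>witt\<^esub> dd (int n - 1) \<in> H"
            using H(1) by (simp add: submodule.smult_closed ring_of_type_algebra_def)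
          with Suc have "?S n \<oplus>\<^bsub>witt\<^esub> (poly.coeff q n \<odot>\<^bsub>witt\<^esub> dd (int n - 1)) \<in> H"
            using W.submoduleE(5)[OF H(1)] by blast
          also have "?S n \<oplus>\<^bsub>witt\<^esub> (poly.coeff q n \<odot>\<^bsub>witt\<^esub> dd (int n - 1)) = ?S (Suc n)"
            using True unfolding smult_dd[of n] by (simp add: witt_def distrib_right)
          finally show ?thesis .
        next
          case False
          then have "{2..<Suc n} = {2..<n}" by auto
          with Suc show ?thesis by simp
        qed
      qed
      then show ?thesis by (auto simp: witt_pos_def gen_submodule_def)
    qed
    moreover have "D = ?D0 \<oplus>\<^bsub>witt\<^esub> ?S (degree q + 2)"
    proof -
      have "q = (\<Sum>k<degree q + 2. Polynomial.monom (poly.coeff q k) k)"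
        using poly_as_sum_of_monoms'[of q "degree q + 1"] by (simp add: lessThan_Suc_atMost)
      also have "{..<degree q + 2} = {0, 1} \<union> {2..<degree q + 2}" by auto
      also have "(\<Sum>k\<in>\<dots>. Polynomial.monom (poly.coeff q k) k) =
          Polynomial.monom (poly.coeff q 1) 1 + (\<Sum>k\<in>{2..<degree q + 2}. Polynomial.monom (poly.coeff q k) k)"
        by (subst sum.union_disjoint) (auto simp: q0)
      finally have "D p = (Polynomial.monom (poly.coeff q 1) 1 + (\<Sum>k\<in>{2..<degree q + 2}. Polynomial.monom (poly.coeff q k) k)) * pderiv p" for p
        using Dq by metis
      then show ?thesis
        using smult_dd[of 1] by (simp add: witt_def distrib_right fun_eq_iff)
    qed
    ultimately have "D \<in> gen_submodule \<C> witt {dd 0} <+>\<^bsub>witt\<^esub> carrier witt_pos"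
      unfolding set_add_def' by blast
    then show ?thesis by (simp add: borel_def)
  qed
  ultimately show ?thesis by blast
qed

definition char_sum :: "complex \<Rightarrow> (endo list \<Rightarrow> complex) \<Rightarrow> complex"
  where "char_sum lam f = (\<Sum>w | f w \<noteq> 0. f w * (\<Prod>D\<leftarrow>w. lam * poly.coeff (D [:0, 1:]) 1))"

lemma char_sum_superset:
  assumes "finite A" "{w. f w \<noteq> 0} \<subseteq> A"
  shows "char_sum lam f = (\<Sum>w\<in>A. f w * (\<Prod>D\<leftarrow>w. lam * poly.coeff (D [:0, 1:]) 1))"
  unfolding char_sum_def by (rule sum.mono_neutral_left) (use assms in auto)

lemma char_sum_add:
  assumes "finite {w. f w \<noteq> 0}" "finite {w. g w \<noteq> 0}"
  shows "char_sum lam (\<lambda>w. f w + g w) = char_sum lam f + char_sum lam g"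
proof -
  let ?A = "{w. f w \<noteq> 0} \<union> {w. g w \<noteq> 0}"
  have "char_sum lam (\<lambda>w. f w + g w) = (\<Sum>w\<in>?A. (f w + g w) * (\<Prod>D\<leftarrow>w. lam * poly.coeff (D [:0, 1:]) 1))"
    using assms by (intro char_sum_superset) auto
  also have "\<dots> = char_sum lam f + char_sum lam g"
    using assms by (subst (1 2) char_sum_superset[where A = ?A]) (auto simp: distrib_right sum.distrib)
  finally show ?thesis .
qed

lemma char_sum_word: "char_sum lam (\<lambda>w. c * word_gen u w) = c * (\<Prod>D\<leftarrow>u. lam * poly.coeff (D [:0, 1:]) 1)"
  by (subst char_sum_superset[where A = "{u}"]) (auto simp: word_gen_def)

lemma char_sum_uminus: "char_sum lam (\<lambda>w. - f w) = - char_sum lam f"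
  by (simp add: char_sum_def sum_negf)

lemma char_sum_mult:
  assumes "finite {w. f w \<noteq> 0}" "finite {w. g w \<noteq> 0}"
  shows "char_sum lam (\<lambda>w. \<Sum>(u, v) | u @ v = w. f u * g v) = char_sum lam f * char_sum lam g"
proof -
  let ?A = "{u. f u \<noteq> 0}" and ?B = "{v. g v \<noteq> 0}"
  let ?W = "(\<lambda>(u, v). u @ v) ` (?A \<times> ?B)"
  let ?c = "\<lambda>w. \<Prod>D\<leftarrow>w. lam * poly.coeff (D [:0, 1:]) 1"
  have fin: "finite ?W" using assms by simp
  have "char_sum lam (\<lambda>w. \<Sum>(u, v) | u @ v = w. f u * g v) = (\<Sum>w\<in>?W. (\<Sum>(u, v) | u @ v = w. f u * g v) * ?c w)"
  proof (rule char_sum_superset[OF fin], clarify)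
    fix w assume "(\<Sum>(u, v) | u @ v = w. f u * g v) \<noteq> 0"
    then obtain u v where "u @ v = w" "f u * g v \<noteq> 0"
      by (smt (verit) mem_Collect_eq split_def sum.not_neutral_contains_not_neutral)
    then show "w \<in> ?W" by force
  qed
  also have "\<dots> = (\<Sum>w\<in>?W. \<Sum>(u, v) | u @ v = w. f u * ?c u * (g v * ?c v))"
  proof (rule sum.cong[OF refl])
    fix w
    show "(\<Sum>(u, v) | u @ v = w. f u * g v) * ?c w = (\<Sum>(u, v) | u @ v = w. f u * ?c u * (g v * ?c v))"
      unfolding sum_distrib_right by (rule sum.cong[OF refl]) (clarsimp simp del: mult_cancel_left mult_cancel_right)
  qed
  also have "\<dots> = (\<Sum>(w, (u, v))\<in>Sigma ?W (\<lambda>w. {(u, v). u @ v = w}). f u * ?c u * (g v * ?c v))"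
    using fin finite_splits by (subst sum.Sigma) auto
  also have "\<dots> = (\<Sum>(w, (u, v))\<in>(\<lambda>(u, v). (u @ v, (u, v))) ` (?A \<times> ?B). f u * ?c u * (g v * ?c v))"
  proof (rule sum.mono_neutral_right)
    have "f u * ?c u * (g v * ?c v) = 0"
      if "(u @ v, (u, v)) \<notin> (\<lambda>(u, v). (u @ v, (u, v))) ` (?A \<times> ?B)" for u v
    proof -
      have "(u, v) \<notin> ?A \<times> ?B" using that by (auto simp: image_iff)
      then show ?thesis by auto
    qed
    then show "\<forall>x\<in>Sigma ?W (\<lambda>w. {(u, v). u @ v = w}) - (\<lambda>(u, v). (u @ v, (u, v))) ` (?A \<times> ?B).
        (case x of (w, u, v) \<Rightarrow> f u * ?c u * (g v * ?c v)) = 0" by auto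
  qed (use fin finite_splits in \<open>auto intro!: finite_SigmaI\<close>)
  also have "\<dots> = (\<Sum>(u, v)\<in>?A \<times> ?B. f u * ?c u * (g v * ?c v))"
    by (subst sum.reindex) (auto simp: inj_on_def split_def)
  also have "\<dots> = char_sum lam f * char_sum lam g"
    by (simp add: char_sum_def sum_product sum.cartesian_product)
  finally show ?thesis .
qed

lemma UEA_ideal_borel_char_sum:
  assumes "f \<in> UEA_ideal borel"
  shows "f \<in> carrier (free_algebra borel) \<and> char_sum lam f = 0"
proof -
  interpret F: ring "free_algebra borel" by (rule ring_free_algebra)
  interpret W: lie_algebra witt by (rule lie_algebra_witt)
  let ?J = "{f \<in> carrier (free_algebra borel). char_sum lam f = 0}"
  have fin: "finite {w. f w \<noteq> 0}" if "f \<in> carrier (free_algebra borel)" for f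
    using that by (simp add: free_algebra_def)
  have inv: "\<ominus>\<^bsub>free_algebra borel\<^esub> f = (\<lambda>w. - f w)" if "f \<in> carrier (free_algebra borel)" for f
    by (rule F.minus_equality) (use that in \<open>auto simp: free_algebra_def\<close>)
  have "ideal ?J (free_algebra borel)"
  proof (rule idealI)
    show "ring (free_algebra borel)" ..
    show "subgroup ?J (add_monoid (free_algebra borel))"
    proof (rule F.add.subgroupI)
      show "?J \<noteq> {}" using F.zero_closed by (auto simp: free_algebra_def char_sum_def)
    next
      fix f assume f: "f \<in> ?J"
      then have "\<ominus>\<^bsub>free_algebra borel\<^esub> f \<in> carrier (free_algebra borel)" by auto
      then show "\<ominus>\<^bsub>free_algebra borel\<^esub> f \<in> ?J" using f by (simp add: inv char_sum_uminus)
    next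
      fix f g assume f: "f \<in> ?J" and g: "g \<in> ?J"
      then have "f \<oplus>\<^bsub>free_algebra borel\<^esub> g \<in> carrier (free_algebra borel)" by auto
      moreover have "char_sum lam (f \<oplus>\<^bsub>free_algebra borel\<^esub> g) = char_sum lam f + char_sum lam g"
        using f g char_sum_add[OF fin fin] by (simp add: free_algebra_def)
      ultimately show "f \<oplus>\<^bsub>free_algebra borel\<^esub> g \<in> ?J" using f g by simp
    qed auto
  next
    fix f g assume f: "f \<in> ?J" and g: "g \<in> carrier (free_algebra borel)"
    have *: "char_sum lam (f \<otimes>\<^bsub>free_algebra borel\<^esub> g) = char_sum lam f * char_sum lam g"
      if "f \<in> carrier (free_algebra borel)" "g \<in> carrier (free_algebra borel)" for f g
      using that char_sum_mult[OF fin fin] by (simp add: free_algebra_def)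
    show "g \<otimes>\<^bsub>free_algebra borel\<^esub> f \<in> ?J" "f \<otimes>\<^bsub>free_algebra borel\<^esub> g \<in> ?J"
      using f g by (simp_all add: *)
  qed
  moreover have "UEA_rels borel \<subseteq> ?J"
  proof -
    have zero1: "poly.coeff (D [:0, 1:]) 0 = 0" if "D \<in> carrier borel" for D
      using that by (simp add: carrier_borel)
    have diff3: "char_sum lam (\<lambda>w. f w - g w - h w) = char_sum lam f - char_sum lam g - char_sum lam h"
      if "finite {w. f w \<noteq> 0}" "finite {w. g w \<noteq> 0}" "finite {w. h w \<noteq> 0}" for f g h
    proof -
      have "finite {w. f w + - g w \<noteq> 0}"
        by (rule finite_subset[of _ "{w. f w \<noteq> 0} \<union> {w. g w \<noteq> 0}"]) (use that in auto)
      then show ?thesis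
        using that char_sum_add[of "\<lambda>w. f w + - g w" "\<lambda>w. - h w" lam] char_sum_add[of f "\<lambda>w. - g w" lam]
        by (simp add: char_sum_uminus)
    qed
    have wfin: "finite {w. word_gen u w \<noteq> 0}" for u :: "endo list"
      by (simp add: word_gen_def)
    have word: "char_sum lam (word_gen u) = (\<Prod>D\<leftarrow>u. lam * poly.coeff (D [:0, 1:]) 1)" for u
      using char_sum_word[of lam 1 u] by simp
    have three: "(\<lambda>w. word_gen a w - word_gen b w - word_gen c w) \<in> carrier (free_algebra borel)"
      if "{a, b, c} \<subseteq> lists (carrier borel)" for a b c
    proof -
      have "{w. word_gen a w - word_gen b w - word_gen c w \<noteq> 0} \<subseteq> {a, b, c}"
        by (auto simp: word_gen_def)
      then show ?thesis using that
        unfolding free_algebra_def by (auto intro: finite_subset)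
    qed
    have "(\<lambda>w. word_gen [D \<oplus>\<^bsub>borel\<^esub> E] w - word_gen [D] w - word_gen [E] w) \<in> ?J"
      if "D \<in> carrier borel" "E \<in> carrier borel" for D E
    proof -
      have "D \<oplus>\<^bsub>borel\<^esub> E \<in> carrier borel"
        using that unfolding carrier_borel
        by (auto simp: borel_def witt_def derivations_def algebra_simps smult_add_right)
      then show ?thesis using that
        by (auto simp: three diff3 wfin word) (simp add: borel_def witt_def algebra_simps)
    qed
    moreover have "(\<lambda>w. word_gen [c \<odot>\<^bsub>borel\<^esub> D] w - c * word_gen [D] w) \<in> ?J"
      if "D \<in> carrier borel" for c D
    proof -
      have "c \<odot>\<^bsub>borel\<^esub> D \<in> carrier borel"
        using that unfolding carrier_borel
        by (auto simp: borel_def witt_def derivations_def algebra_simps smult_add_right)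
      moreover have "{w. word_gen [c \<odot>\<^bsub>borel\<^esub> D] w - c * word_gen [D] w \<noteq> 0} \<subseteq> {[c \<odot>\<^bsub>borel\<^esub> D], [D]}"
        by (auto simp: word_gen_def)
      ultimately have "(\<lambda>w. word_gen [c \<odot>\<^bsub>borel\<^esub> D] w - c * word_gen [D] w) \<in> carrier (free_algebra borel)"
        using that unfolding free_algebra_def by (auto intro: finite_subset)
      moreover have "finite {w. c * word_gen [D] w \<noteq> 0}"
        by (rule finite_subset[OF _ wfin[of "[D]"]]) auto
      then have "char_sum lam (\<lambda>w. word_gen [c \<odot>\<^bsub>borel\<^esub> D] w - c * word_gen [D] w - 0) = 0"
        by (subst diff3) (simp_all add: wfin word char_sum_word, simp add: borel_def witt_def char_sum_def)
      ultimately show ?thesis by simp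
    qed
    moreover have "(\<lambda>w. word_gen [D, E] w - word_gen [E, D] w - word_gen [bracket borel D E] w) \<in> ?J"
      if D: "D \<in> carrier borel" and E: "E \<in> carrier borel" for D E
    proof -
      have "bracket borel D E \<in> derivations"
        using W.bracket_closed[of D E] D E by (auto simp: borel_def witt_def carrier_borel[unfolded borel_def witt_def, simplified])
      moreover have "bracket borel D E [:0, 1:] = D [:0, 1:] * pderiv (E [:0, 1:]) - E [:0, 1:] * pderiv (D [:0, 1:])"
        using D E unfolding carrier_borel by (simp add: borel_def witt_def) (metis derivation_eq)
      then have "poly.coeff (bracket borel D E [:0, 1:]) 0 = 0" "poly.coeff (bracket borel D E [:0, 1:]) 1 = 0"
        using zero1[OF D] zero1[OF E] by (simp_all add: coeff_mult coeff_pderiv)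
      ultimately show ?thesis
        using D E by (auto simp: three diff3 wfin word carrier_borel)
    qed
    ultimately show ?thesis unfolding UEA_rels_def by blast
  qed
  ultimately have "UEA_ideal borel \<subseteq> ?J"
    unfolding UEA_ideal_def by (rule F.genideal_minimal)
  then show ?thesis using assms by blast
qed

lemma one_dim_gen:
  assumes "D \<in> carrier borel"
  shows "UEA_gen borel D \<odot>\<^bsub>one_dim lam\<^esub> z = one_dim_rep lam D z"
proof -
  interpret F: ring "free_algebra borel" by (rule ring_free_algebra)
  have fs: "(\<Oplus>\<^bsub>complex_line\<^esub>w\<in>A. f w) = sum f A" if "finite A" for A and f :: "endo list \<Rightarrow> complex"
  proof -
    have "\<exists>y. y + x = 0" for x :: complex by (rule exI[of _ "- x"]) simp
    then interpret L: abelian_group complex_line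
      by (intro abelian_groupI) (auto simp: complex_line_def)
    have carr: "carrier complex_line = UNIV" and zero: "\<zero>\<^bsub>complex_line\<^esub> = 0"
      and add: "x \<oplus>\<^bsub>complex_line\<^esub> y = x + y" for x y
      by (simp_all add: complex_line_def)
    show ?thesis
      using that by (induction A) (simp_all add: carr zero add L.finsum_insert)
  qed
  have rep: "foldr (one_dim_rep lam) w z = (\<Prod>D\<leftarrow>w. lam * poly.coeff (D [:0, 1:]) 1) * z" for w
    by (induction w) (auto simp: one_dim_rep_def)
  have wfin: "finite {w. word_gen u w \<noteq> 0}" for u :: "endo list"
    by (simp add: word_gen_def)
  have "(\<Oplus>\<^bsub>complex_line\<^esub>w\<in>{w. f w \<noteq> 0}. f w \<odot>\<^bsub>complex_line\<^esub> foldr (one_dim_rep lam) w z) = one_dim_rep lam D z"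
    if f: "f \<in> UEA_gen borel D" for f
  proof -
    from f obtain h where h: "h \<in> UEA_ideal borel" "f = (\<lambda>w. h w + word_gen [D] w)"
      by (auto simp: UEA_gen_def a_r_coset_def' free_algebra_def)
    note hc = UEA_ideal_borel_char_sum[OF h(1), of lam]
    have hfin: "finite {w. h w \<noteq> 0}" using hc by (auto simp: free_algebra_def)
    have "finite {w. f w \<noteq> 0}"
      by (rule finite_subset[OF _ finite_UnI[OF hfin wfin[of "[D]"]]]) (auto simp: h(2))
    moreover have "char_sum lam f = lam * poly.coeff (D [:0, 1:]) 1"
      using hc char_sum_add[OF hfin wfin] char_sum_word[of lam 1 "[D]"] by (simp add: h(2))
    ultimately show ?thesis
      by (subst fs) (auto simp: char_sum_def rep complex_line_def one_dim_rep_def sum_distrib_right mult.assoc[symmetric] simp flip: sum_distrib_right)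
  qed
  moreover have "UEA_ideal borel \<noteq> {}"
    using F.genideal_self'[of "\<zero>\<^bsub>free_algebra borel\<^esub>"] unfolding UEA_ideal_def genideal_def
    by (auto dest!: ideal.axioms(1)[THEN additive_subgroup.zero_closed])
  then have "UEA_gen borel D \<noteq> {}" by (auto simp: UEA_gen_def a_r_coset_def')
  ultimately have "(\<lambda>f. \<Oplus>\<^bsub>complex_line\<^esub>w\<in>{w. f w \<noteq> 0}. f w \<odot>\<^bsub>complex_line\<^esub> foldr (one_dim_rep lam) w z) ` UEA_gen borel D
      = {one_dim_rep lam D z}" by (auto intro!: image_eqI)
  then show ?thesis by (simp add: one_dim_def UEA_module_def)
qed

lemma one_dim_d0: "UEA_gen borel (dd 0) \<odot>\<^bsub>one_dim lam\<^esub> z = lam * z"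
proof -
  have "dd 0 \<in> carrier borel"
    using dd_in_witt[of 0] by (auto simp: carrier_borel dd_def pderiv_pCons witt_def)
  then show ?thesis by (simp add: one_dim_gen) (simp add: one_dim_rep_def dd_def pderiv_pCons)
qed

lemma one_dim_pos:
  assumes "i > 0"
  shows "UEA_gen borel (dd i) \<odot>\<^bsub>one_dim lam\<^esub> z = 0"
proof -
  have "dd i \<in> carrier borel"
    using dd_in_witt[of i] assms by (auto simp: carrier_borel dd_def pderiv_pCons witt_def)
  then show ?thesis using assms by (simp add: one_dim_gen) (simp add: one_dim_rep_def dd_def pderiv_pCons)
qed

end

theory Submission
  imports Defs "HOL-Library.Product_Plus"
begin

text \<open>
  Write \<open>d_i\<close> for \<open>x^(i+1) d/dx\<close>.  An extension \<open>K\<close> of \<open>\<Delta>(\<mu>)\<close> by \<open>\<Delta>(\<lambda>)\<close> in category O is a weight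
  module, so the highest weight vector of \<open>\<Delta>(\<mu>)\<close> lifts to a vector \<open>v\<close> of weight \<open>\<mu>\<close> in \<open>K\<close>.
  Since \<open>\<Delta>(\<mu>)\<close> is free over \<open>\<complex>[d_{-1}]\<close>, the module \<open>K\<close> is the direct sum of \<open>\<Delta>(\<lambda>)\<close> and the space of
  the \<open>p(d_{-1}) v\<close>, and as \<open>d_{-1}\<close>, \<open>d_1\<close>, \<open>d_2\<close> generate the Lie algebra, its structure is
  determined by the two vectors \<open>d_1 v\<close>, \<open>d_2 v\<close> of \<open>\<Delta>(\<lambda>)\<close> (\<open>equiv_from_lifts\<close>).  All weight spaces of
  \<open>\<Delta>(\<lambda>)\<close> are at most one-dimensional: with \<open>n = \<lambda> - \<mu>\<close>, the two vectors are zero unless \<open>n\<close> is a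
  positive integer, and then they are \<open>a d_{-1}^(n-1) v_\<lambda>\<close> and \<open>b d_{-1}^(n-2) v_\<lambda>\<close> with complex
  numbers \<open>a\<close>, \<open>b\<close>.  Another choice of \<open>v\<close> changes \<open>(a, b)\<close> by a multiple of the pair \<open>(\<alpha>, \<beta>)\<close> that
  describes \<open>d_1\<close> and \<open>d_2\<close> on \<open>d_{-1}^n v_\<lambda>\<close>.  This pair is zero only for \<open>n = 1\<close>, \<open>\<lambda> = 0\<close>.  Baer sums
  and scalar multiples of extensions add and scale \<open>(a, b)\<close>, so Ext is the space of realizable pairs
  modulo \<open>(\<alpha>, \<beta>)\<close>.

  Which pairs are realizable?  The algebra \<open>W^+\<close> is generated by \<open>d_1\<close>, \<open>d_2\<close> with one relation in degree
  5 and one in degree 7.  Applied to \<open>v\<close>, each becomes a multiple of the single functional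
  \<open>chi\<close> that vanishes on \<open>(\<alpha>, \<beta>)\<close>; up to factors that are nonzero in the relevant range of \<open>n\<close>, the
  multipliers are the quadratic polynomials \<open>kappa5\<close> and \<open>kappa7\<close> (\<open>lift_relation\<close>).  For
  \<open>n \<le> 4\<close> neither relation has a target.  For \<open>n = 5\<close> and \<open>n = 6\<close> only the first one has, and it is void
  exactly at the zeros of \<open>kappa5\<close>: \<open>\<lambda> = 0, 4\<close> for \<open>n = 5\<close> and \<open>\<lambda> = (5 \<plusminus> \<surd>19) / 2\<close> for \<open>n = 6\<close>.  For
  \<open>n \<ge> 7\<close> both have, and \<open>3 kappa5 + 2 kappa7 = n (n - 1)\<close> shows that they are never void
  together.

  For the converse the extensions are written down.  The Fourier transform turns \<open>\<Delta>(\<lambda>)\<close> into \<open>\<complex>[t]\<close>,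
  where \<open>d_{-1}\<close> is multiplication by \<open>t\<close> and \<open>f d/dx\<close> acts as \<open>t f(-d/dt) + \<lambda> f'(-d/dt)\<close>
  (\<open>verma_model_verma\<close>).  A sequence \<open>x\<close> of numbers, prescribing \<open>d_i v = x_i t^(n-i)\<close>, defines an
  off-diagonal operator on \<open>\<complex>[t] \<oplus> \<complex>[t]\<close>, and the bracket relations for it need to be tested on the vector
  \<open>1\<close> only (\<open>cocycle_defect_zero\<close>), which leaves at most six scalar equations if \<open>n \<le> 6\<close>.
\<close>

section \<open>Polynomial vector fields\<close>

text \<open>
  Every derivation of \<open>\<complex>[x]\<close> is of this form, with \<open>q\<close> the image of \<open>x\<close>, and \<open>[f d/dx, g d/dx]\<close> has
  coefficient \<open>f g' - g f'\<close>.  Hence all computations with vector fields below are computations with polynomials.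
\<close>

definition vf :: "complex poly \<Rightarrow> endo"
  where "vf q = (\<lambda>p. q * pderiv p)"

lemma vf_X [simp]: "vf q [:0, 1:] = q"
  by (simp add: vf_def pderiv_pCons)

lemma derivations_eq_vf: "derivations = range vf"
proof
  show "derivations \<subseteq> range vf"
  proof
    fix D assume "D \<in> derivations"
    then have "D = vf (D [:0, 1:])" unfolding vf_def by (intro ext derivation_eq)
    then show "D \<in> range vf" by blast
  qed
  show "range vf \<subseteq> derivations"
    by (auto simp: derivations_def vf_def pderiv_add pderiv_smult pderiv_mult algebra_simps)
qed

lemma dd_vf: "dd i = vf (Polynomial.monom 1 (nat (i + 1)))"
  by (simp add: dd_def vf_def)

text \<open>
  The Lie algebra of vector fields, its Borel subalgebra and \<open>W^+\<close> differ only in the coefficients that they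
  admit, so that one family covers the three enveloping algebras.
\<close>

definition vfields :: "complex poly set \<Rightarrow> endo lie_algebra"
  where "vfields A = witt\<lparr>carrier := vf ` A\<rparr>"

definition field_algebra :: "complex poly set \<Rightarrow> bool"
  where "field_algebra A \<longleftrightarrow>
    (\<forall>f\<in>A. \<forall>g\<in>A. f + g \<in> A \<and> f * pderiv g - g * pderiv f \<in> A) \<and>
    (\<forall>c. \<forall>f\<in>A. Polynomial.smult c f \<in> A)"

lemma carrier_fields [simp]: "carrier (vfields A) = vf ` A"
  by (simp add: vfields_def witt_def)

lemma add_fields [simp]: "vf f \<oplus>\<^bsub>vfields A\<^esub> vf g = vf (f + g)"
  by (auto simp: vfields_def witt_def vf_def algebra_simps)

lemma smult_fields [simp]: "c \<odot>\<^bsub>vfields A\<^esub> vf f = vf (Polynomial.smult c f)"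
  by (auto simp: vfields_def witt_def vf_def algebra_simps)

lemma bracket_fields [simp]:
  "bracket (vfields A) (vf f) (vf g) = vf (f * pderiv g - g * pderiv f)"
  by (auto simp: vfields_def witt_def vf_def pderiv_mult algebra_simps)

lemma field_algebra_UNIV [simp]: "field_algebra UNIV"
  and field_algebra_borel [simp]: "field_algebra {f. poly.coeff f 0 = 0}"
  and field_algebra_pos [simp]: "field_algebra {f. poly.coeff f 0 = 0 \<and> poly.coeff f 1 = 0}"
  by (auto simp: field_algebra_def coeff_mult coeff_pderiv)

lemma witt_eq_fields: "witt = vfields UNIV"
  by (simp add: vfields_def witt_def derivations_eq_vf)

lemma borel_eq_fields: "borel = vfields {f. poly.coeff f 0 = 0}"
proof -
  have "carrier borel = vf ` {f. poly.coeff f 0 = 0}"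
    unfolding carrier_borel derivations_eq_vf by auto
  then show ?thesis by (simp add: borel_def vfields_def)
qed

text \<open>
  A polynomial with a double zero at the origin is \<open>x^2\<close> times a cofactor; the induction over the
  cofactor has to allow all powers \<open>x^k\<close>, \<open>k \<ge> 2\<close>, in place of \<open>x^2\<close>.
\<close>

lemma witt_pos_eq_fields:
  "witt_pos = vfields {f. poly.coeff f 0 = 0 \<and> poly.coeff f 1 = 0}" (is "_ = vfields ?A")
proof -
  interpret W: lie_algebra witt by (rule lie_algebra_witt)
  have "vf f \<in> H"
    if H: "submodule H \<C> witt" "{dd i | i. i > 0} \<subseteq> H" and f: "f \<in> ?A" for H f
  proof -
    have zero: "vf 0 \<in> H"
      using H(1)[THEN submodule.axioms(1), THEN subgroup.one_closed] by (simp add: witt_def vf_def)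
    have add: "vf (f + g) \<in> H" if "vf f \<in> H" "vf g \<in> H" for f g
      using W.submoduleE(5)[OF H(1) that] by (simp add: witt_eq_fields)
    have "vf (Polynomial.monom 1 k) \<in> H" if "k \<ge> 2" for k
      using that H(2) by (auto simp: dd_vf subset_iff intro!: exI[of _ "int k - 1"])
    then have mon: "vf (Polynomial.monom c k) \<in> H" if "k \<ge> 2" for k c
      using submodule.smult_closed[OF H(1), of c "vf (Polynomial.monom 1 k)"] that
      by (simp add: witt_eq_fields smult_monom ring_of_type_algebra_def)
    have shift: "vf (Polynomial.monom 1 k * g) \<in> H" if "k \<ge> 2" for k g
      using that
    proof (induction g arbitrary: k)
      case 0
      then show ?case using zero by simp
    next
      case (pCons a g)
      have "Polynomial.monom 1 k * pCons a g =
          Polynomial.monom a k + Polynomial.monom 1 (Suc k) * g"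
        by (simp add: monom_Suc monom_altdef mult.commute)
      then show ?case using add[OF mon[of k a] pCons.IH[of "Suc k"]] pCons.prems by simp
    qed
    obtain a b g where "f = pCons a (pCons b g)" by (metis pCons_cases)
    with f have "f = Polynomial.monom 1 2 * g"
      by (simp add: monom_altdef power2_eq_square)
    with shift[of 2 g] show ?thesis by simp
  qed
  moreover have "submodule (vf ` ?A) \<C> witt"
  proof (rule W.submoduleI)
    fix D assume "D \<in> vf ` ?A"
    then obtain f where f: "f \<in> ?A" "D = vf f" by auto
    have "\<ominus>\<^bsub>witt\<^esub> vf f = vf (- f)"
      by (intro W.minus_equality) (auto simp: witt_eq_fields, simp add: vfields_def witt_def vf_def)
    with f show "\<ominus>\<^bsub>witt\<^esub> D \<in> vf ` ?A" by auto
  qed (auto simp: witt_eq_fields, simp add: vfields_def witt_def vf_def image_iff fun_eq_iff exI[of _ 0])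
  moreover have "{dd i | i. i > 0} \<subseteq> vf ` ?A"
    by (auto simp: dd_vf coeff_monom)
  ultimately have "gen_submodule \<C> witt {dd i | i. i > 0} = vf ` ?A"
    unfolding gen_submodule_def by (intro antisym) auto
  then show ?thesis by (simp add: witt_pos_def vfields_def)
qed

section \<open>Free algebras and enveloping algebras\<close>

lemma free_carrier_iff:
  "f \<in> carrier (free_algebra L) \<longleftrightarrow> finite {w. f w \<noteq> 0} \<and> {w. f w \<noteq> 0} \<subseteq> lists (carrier L)"
  by (simp add: free_algebra_def)

lemma free_add: "f \<oplus>\<^bsub>free_algebra L\<^esub> g = (\<lambda>w. f w + g w)"
  and free_zero: "\<zero>\<^bsub>free_algebra L\<^esub> = (\<lambda>w. 0)"
  and free_one: "\<one>\<^bsub>free_algebra L\<^esub> = word_gen []"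
  by (simp_all add: free_algebra_def word_gen_def)

lemma word_gen_closed: "w \<in> lists (carrier L) \<Longrightarrow> (\<lambda>x. c * word_gen w x) \<in> carrier (free_algebra L)"
  by (auto simp: free_carrier_iff word_gen_def)

lemma word_gen_closed': "w \<in> lists (carrier L) \<Longrightarrow> word_gen w \<in> carrier (free_algebra L)"
  using word_gen_closed[of w L 1] by simp

lemma free_minus:
  assumes "f \<in> carrier (free_algebra L)"
  shows "\<ominus>\<^bsub>free_algebra L\<^esub> f = (\<lambda>w. - f w)"
proof -
  interpret F: ring "free_algebra L" by (rule ring_free_algebra)
  show ?thesis
    by (rule F.minus_equality) (use assms in \<open>auto simp: free_algebra_def\<close>)
qed

lemma free_word_mult:
  "(\<lambda>x. c * word_gen u x) \<otimes>\<^bsub>free_algebra L\<^esub> (\<lambda>x. d * word_gen v x)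
     = (\<lambda>x. c * d * word_gen (u @ v) x)"
proof
  fix w
  have "(\<Sum>(a, b) | a @ b = w. c * word_gen u a * (d * word_gen v b))
      = (\<Sum>(a, b) \<in> (if u @ v = w then {(u, v)} else {}). c * word_gen u a * (d * word_gen v b))"
    by (rule sum.mono_neutral_right) (auto simp: finite_splits word_gen_def split: if_splits)
  also have "\<dots> = c * d * word_gen (u @ v) w" by (auto simp: word_gen_def)
  finally show "((\<lambda>x. c * word_gen u x) \<otimes>\<^bsub>free_algebra L\<^esub> (\<lambda>x. d * word_gen v x)) w = c * d * word_gen (u @ v) w"
    by (simp add: free_algebra_def)
qed

text \<open>
  Linear statements about the free algebra are proved by adding one word at a time.
\<close>

lemma free_induct [consumes 1, case_names zero add]:
  assumes f: "f \<in> carrier (free_algebra L)"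
    and zero: "P (\<lambda>w. 0)"
    and add: "\<And>c w f. w \<in> lists (carrier L) \<Longrightarrow> f \<in> carrier (free_algebra L) \<Longrightarrow> P f \<Longrightarrow>
                P (\<lambda>x. c * word_gen w x + f x)"
  shows "P f"
proof -
  have "\<forall>f. {w. f w \<noteq> 0} \<subseteq> S \<longrightarrow> P f" if "finite S" "S \<subseteq> lists (carrier L)" for S
    using that
  proof (induction S)
    case empty
    have "f = (\<lambda>w. 0)" if "{w. f w \<noteq> 0} \<subseteq> {}" for f :: "'a list \<Rightarrow> complex" using that by auto
    then show ?case using zero by metis
  next
    case (insert w S)
    show ?case
    proof (intro allI impI)
      fix f :: "'a list \<Rightarrow> complex" assume f: "{w. f w \<noteq> 0} \<subseteq> insert w S"
      let ?g = "f(w := 0)"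
      have g: "{w. ?g w \<noteq> 0} \<subseteq> S" using f by auto
      then have "P ?g" using insert.IH insert.prems by blast
      moreover have "?g \<in> carrier (free_algebra L)"
        using g insert finite_subset[OF g] unfolding free_carrier_iff by blast
      ultimately have "P (\<lambda>x. f w * word_gen w x + ?g x)"
        using insert.prems by (intro add) blast+
      moreover have "(\<lambda>x. f w * word_gen w x + ?g x) = f" by (auto simp: word_gen_def)
      ultimately show "P f" by simp
    qed
  qed
  then show ?thesis using f unfolding free_carrier_iff by blast
qed

abbreviation (input) "FA A \<equiv> free_algebra (vfields A)"

lemma free_carrier_mono:
  assumes "A \<subseteq> B"
  shows "carrier (FA A) \<subseteq> carrier (FA B)"
proof -
  have "lists (vf ` A) \<subseteq> lists (vf ` B)" using assms by (intro lists_mono image_mono)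
  then show ?thesis by (simp add: subset_iff free_carrier_iff)
qed

lemma free_three:
  assumes "a \<in> lists (carrier L)" "b \<in> lists (carrier L)" "c \<in> lists (carrier L)"
  shows "(\<lambda>w. word_gen a w - word_gen b w - word_gen c w) \<in> carrier (free_algebra L)"
proof -
  have "{w. word_gen a w - word_gen b w - word_gen c w \<noteq> 0} \<subseteq> {a, b, c}"
    by (auto simp: word_gen_def)
  then show ?thesis using assms
    unfolding free_algebra_def by (auto intro: finite_subset)
qed

lemma free_two:
  assumes "a \<in> lists (carrier L)" "b \<in> lists (carrier L)"
  shows "(\<lambda>w. word_gen a w - c * word_gen b w) \<in> carrier (free_algebra L)"
proof -
  have "{w. word_gen a w - c * word_gen b w \<noteq> 0} \<subseteq> {a, b}"
    by (auto simp: word_gen_def)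
  then show ?thesis using assms
    unfolding free_algebra_def by (auto intro: finite_subset)
qed

lemma UEA_rels_closed:
  assumes "field_algebra A"
  shows "UEA_rels (vfields A) \<subseteq> carrier (FA A)"
  using assms unfolding UEA_rels_def field_algebra_def
  by (auto intro!: free_three free_two)

lemma UEA_ideal_ideal:
  assumes "field_algebra A"
  shows "ideal (UEA_ideal (vfields A)) (FA A)"
  unfolding UEA_ideal_def
  by (rule ring.genideal_ideal[OF ring_free_algebra UEA_rels_closed[OF assms]])

lemma UEA_rels_mono:
  assumes "A \<subseteq> B"
  shows "UEA_rels (vfields A) \<subseteq> UEA_rels (vfields B)"
proof -
  have sub: "carrier (vfields A) \<subseteq> carrier (vfields B)" using assms by auto
  have ops: "add (vfields A) = add (vfields B)" "smult (vfields A) = smult (vfields B)"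
    "bracket (vfields A) = bracket (vfields B)"
    by (simp_all add: vfields_def witt_def)
  show ?thesis unfolding UEA_rels_def ops using sub by (intro Un_mono) blast+
qed

text \<open>
  The trace of the larger ideal on the smaller free algebra is an ideal that contains the smaller set
  of relations.  This makes the map between enveloping algebras computable on representatives (see
  \<open>UEA_incl_ucl\<close>).
\<close>

lemma UEA_ideal_mono:
  assumes A: "field_algebra A" and B: "field_algebra B" and sub: "A \<subseteq> B"
  shows "UEA_ideal (vfields A) \<subseteq> UEA_ideal (vfields B)"
proof -
  interpret FA: ring "FA A" by (rule ring_free_algebra)
  interpret FB: ring "FA B" by (rule ring_free_algebra)
  interpret I: ideal "UEA_ideal (vfields B)" "FA B" by (rule UEA_ideal_ideal[OF B])
  have carr: "carrier (FA A) \<subseteq> carrier (FA B)"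
    using sub by (rule free_carrier_mono)
  let ?J = "UEA_ideal (vfields B) \<inter> carrier (FA A)"
  have ops: "x \<oplus>\<^bsub>FA B\<^esub> y = x \<oplus>\<^bsub>FA A\<^esub> y" "x \<otimes>\<^bsub>FA B\<^esub> y = x \<otimes>\<^bsub>FA A\<^esub> y" for x y
    by (simp_all add: free_algebra_def)
  have "ideal ?J (FA A)"
  proof (rule idealI)
    show "ring (FA A)" ..
    show "subgroup ?J (add_monoid (FA A))"
    proof (rule FA.add.subgroupI)
      have "\<zero>\<^bsub>FA B\<^esub> \<in> UEA_ideal (vfields B)" by (rule I.zero_closed)
      then show "?J \<noteq> {}" using FA.zero_closed by (auto simp: free_zero)
    next
      fix x assume x: "x \<in> ?J"
      then have "\<ominus>\<^bsub>FA B\<^esub> x \<in> UEA_ideal (vfields B)" by auto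
      moreover have "\<ominus>\<^bsub>FA A\<^esub> x = \<ominus>\<^bsub>FA B\<^esub> x" using x carr by (auto simp: free_minus)
      ultimately show "\<ominus>\<^bsub>FA A\<^esub> x \<in> ?J" using x FA.a_inv_closed[of x] by simp
    next
      fix x y assume xy: "x \<in> ?J" "y \<in> ?J"
      then have "x \<oplus>\<^bsub>FA B\<^esub> y \<in> UEA_ideal (vfields B)" by auto
      with xy show "x \<oplus>\<^bsub>FA A\<^esub> y \<in> ?J" using FA.a_closed[of x y] by (simp add: ops)
    qed auto
  next
    fix x y assume x: "x \<in> ?J" and y: "y \<in> carrier (FA A)"
    show "y \<otimes>\<^bsub>FA A\<^esub> x \<in> ?J" "x \<otimes>\<^bsub>FA A\<^esub> y \<in> ?J"
      using I.I_l_closed[of x y] I.I_r_closed[of x y] FA.m_closed[of x y] FA.m_closed[of y x] x y carr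
      by (auto simp: ops)
  qed
  moreover have "UEA_rels (vfields B) \<subseteq> UEA_ideal (vfields B)"
    unfolding UEA_ideal_def by (rule FB.genideal_self[OF UEA_rels_closed[OF B]])
  then have "UEA_rels (vfields A) \<subseteq> ?J"
    using UEA_rels_mono[OF sub] UEA_rels_closed[OF A] by blast
  ultimately have "UEA_ideal (vfields A) \<subseteq> ?J"
    unfolding UEA_ideal_def[of "vfields A"] by (rule FA.genideal_minimal)
  then show ?thesis by blast
qed

text \<open>
  The class of an element of the free algebra in the enveloping algebra.
\<close>

definition ucl :: "complex poly set \<Rightarrow> (endo list \<Rightarrow> complex) \<Rightarrow> uwitt"
  where "ucl A f = UEA_ideal (vfields A) +>\<^bsub>FA A\<^esub> f"

lemma ring_UEA: "field_algebra A \<Longrightarrow> ring (UEA (vfields A))"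
  unfolding UEA_def by (rule ideal.quotient_is_ring[OF UEA_ideal_ideal])

lemma ucl_ring_hom: "field_algebra A \<Longrightarrow> ucl A \<in> ring_hom (FA A) (UEA (vfields A))"
  unfolding UEA_def ucl_def[abs_def] by (rule ideal.rcos_ring_hom[OF UEA_ideal_ideal])

lemma UEA_carrier: "carrier (UEA (vfields A)) = ucl A ` carrier (FA A)"
  by (auto simp: UEA_def FactRing_def A_RCOSETS_def' ucl_def)

lemma UEA_incl_ucl:
  assumes A: "field_algebra A" and B: "field_algebra B" and sub: "A \<subseteq> B"
    and f: "f \<in> carrier (FA A)"
  shows "UEA_incl (vfields B) (ucl A f) = ucl B f"
proof -
  interpret IA: ideal "UEA_ideal (vfields A)" "FA A" by (rule UEA_ideal_ideal[OF A])
  interpret IB: ideal "UEA_ideal (vfields B)" "FA B" by (rule UEA_ideal_ideal[OF B])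
  have carr: "carrier (FA A) \<subseteq> carrier (FA B)"
    using sub by (rule free_carrier_mono)
  have "ucl B g = ucl B f" if "g \<in> ucl A f" for g
  proof -
    from that obtain h where h: "h \<in> UEA_ideal (vfields A)" "g = h \<oplus>\<^bsub>FA B\<^esub> f"
      by (auto simp: ucl_def a_r_coset_def' free_algebra_def)
    then have "g \<in> ucl B f"
      using UEA_ideal_mono[OF A B sub] by (auto simp: ucl_def a_r_coset_def')
    with f carr show ?thesis unfolding ucl_def
      by (intro IB.a_repr_independence'[symmetric]) auto
  qed
  moreover have "f \<in> ucl A f" using f unfolding ucl_def by (rule IA.a_rcos_self)
  ultimately show ?thesis unfolding UEA_incl_def ucl_def[symmetric] by blast
qed

lemma ucl_closed: "f \<in> carrier (FA A) \<Longrightarrow> ucl A f \<in> carrier (UEA (vfields A))"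
  unfolding UEA_carrier by blast

lemma
  assumes "field_algebra A" "f \<in> carrier (FA A)" "g \<in> carrier (FA A)"
  shows ucl_add: "ucl A (\<lambda>w. f w + g w) = ucl A f \<oplus>\<^bsub>UEA (vfields A)\<^esub> ucl A g"
    and ucl_mult: "ucl A (f \<otimes>\<^bsub>FA A\<^esub> g) = ucl A f \<otimes>\<^bsub>UEA (vfields A)\<^esub> ucl A g"
  using ring_hom_add[OF ucl_ring_hom[OF assms(1)] assms(2,3)]
    ring_hom_mult[OF ucl_ring_hom[OF assms(1)] assms(2,3)]
  by (simp_all add: free_add)

lemma ucl_one: "field_algebra A \<Longrightarrow> ucl A (word_gen []) = \<one>\<^bsub>UEA (vfields A)\<^esub>"
  using ring_hom_one[OF ucl_ring_hom] by (simp add: free_one)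

lemma ucl_zero: "field_algebra A \<Longrightarrow> ucl A (\<lambda>w. 0) = \<zero>\<^bsub>UEA (vfields A)\<^esub>"
  using ring_hom_zero[OF ucl_ring_hom ring_free_algebra ring_UEA] by (simp add: free_zero)

lemma ucl_rel:
  assumes A: "field_algebra A" and f: "f \<in> carrier (FA A)" and g: "g \<in> carrier (FA A)"
    and r: "(\<lambda>w. f w - g w) \<in> UEA_rels (vfields A)"
  shows "ucl A f = ucl A g"
proof -
  interpret F: ring "FA A" by (rule ring_free_algebra)
  interpret I: ideal "UEA_ideal (vfields A)" "FA A" by (rule UEA_ideal_ideal[OF A])
  have "(\<lambda>w. f w - g w) \<in> UEA_ideal (vfields A)"
    unfolding UEA_ideal_def using F.genideal_self[OF UEA_rels_closed[OF A]] r by blast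
  moreover have "f = (\<lambda>w. f w - g w) \<oplus>\<^bsub>FA A\<^esub> g" by (simp add: free_add)
  ultimately have "f \<in> UEA_ideal (vfields A) +>\<^bsub>FA A\<^esub> g"
    unfolding a_r_coset_def' by blast
  then show ?thesis unfolding ucl_def using g by (intro I.a_repr_independence'[symmetric])
qed

definition uscal :: "complex poly set \<Rightarrow> complex \<Rightarrow> uwitt"
  where "uscal A c = ucl A (\<lambda>w. c * word_gen [] w)"

definition ugen :: "complex poly set \<Rightarrow> complex poly \<Rightarrow> uwitt"
  where "ugen A f = ucl A (word_gen [vf f])"

lemma UEA_scalar_vfields: "UEA_scalar (vfields A) = uscal A"
  by (simp add: fun_eq_iff UEA_scalar_def uscal_def ucl_def)

lemma UEA_gen_vfields: "UEA_gen (vfields A) (vf f) = ugen A f"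
  by (simp add: UEA_gen_def ugen_def ucl_def)

context
  fixes A assumes A: "field_algebra A"
begin

interpretation F: ring "FA A" by (rule ring_free_algebra)
interpretation U: ring "UEA (vfields A)" by (rule ring_UEA[OF A])

lemma uscal_closed: "uscal A c \<in> carrier (UEA (vfields A))"
  unfolding uscal_def by (intro ucl_closed word_gen_closed) simp

lemma ugen_closed: "f \<in> A \<Longrightarrow> ugen A f \<in> carrier (UEA (vfields A))"
  unfolding ugen_def by (intro ucl_closed word_gen_closed') simp

lemma uscal_add: "uscal A (c + d) = uscal A c \<oplus>\<^bsub>UEA (vfields A)\<^esub> uscal A d"
  unfolding uscal_def distrib_right by (intro ucl_add[OF A] word_gen_closed) simp_all

lemma uscal_mult: "uscal A (c * d) = uscal A c \<otimes>\<^bsub>UEA (vfields A)\<^esub> uscal A d"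
  unfolding uscal_def
  by (subst ucl_mult[OF A, symmetric]) (simp_all add: word_gen_closed free_word_mult)

lemma uscal_one: "uscal A 1 = \<one>\<^bsub>UEA (vfields A)\<^esub>"
  by (simp add: uscal_def ucl_one[OF A])

lemma uscal_zero: "uscal A 0 = \<zero>\<^bsub>UEA (vfields A)\<^esub>"
  by (simp add: uscal_def ucl_zero[OF A])

lemma ucl_word_Cons:
  assumes "f \<in> A" "w \<in> lists (vf ` A)"
  shows "ucl A (word_gen (vf f # w)) = ugen A f \<otimes>\<^bsub>UEA (vfields A)\<^esub> ucl A (word_gen w)"
  unfolding ugen_def
  using assms free_word_mult[where L = "vfields A" and c = 1 and d = 1 and u = "[vf f]" and v = w]
  by (subst ucl_mult[OF A, symmetric]) (auto intro!: word_gen_closed')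

lemma ucl_scaled_word:
  assumes "w \<in> lists (vf ` A)"
  shows "ucl A (\<lambda>x. c * word_gen w x) = uscal A c \<otimes>\<^bsub>UEA (vfields A)\<^esub> ucl A (word_gen w)"
  unfolding uscal_def
  using assms free_word_mult[where L = "vfields A" and c = c and d = 1 and u = "[]" and v = w]
  by (subst ucl_mult[OF A, symmetric]) (auto intro!: word_gen_closed word_gen_closed')

lemma ugen_add:
  assumes "f \<in> A" "g \<in> A"
  shows "ugen A (f + g) = ugen A f \<oplus>\<^bsub>UEA (vfields A)\<^esub> ugen A g"
proof -
  have fg: "f + g \<in> A" using A assms unfolding field_algebra_def by blast
  have "(\<lambda>w. word_gen [vf f \<oplus>\<^bsub>vfields A\<^esub> vf g] w - word_gen [vf f] w - word_gen [vf g] w)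
      \<in> UEA_rels (vfields A)"
    unfolding UEA_rels_def using assms by (auto simp del: add_fields)
  moreover have "(\<lambda>w. word_gen [vf f] w + word_gen [vf g] w) \<in> carrier (FA A)"
    using F.a_closed[of "word_gen [vf f]" "word_gen [vf g]"] assms
    by (auto simp: free_add word_gen_closed')
  ultimately have "ugen A (f + g) = ucl A (\<lambda>w. word_gen [vf f] w + word_gen [vf g] w)"
    unfolding ugen_def using fg by (intro ucl_rel[OF A]) (auto simp: word_gen_closed' diff_diff_add)
  also have "\<dots> = ugen A f \<oplus>\<^bsub>UEA (vfields A)\<^esub> ugen A g"
    unfolding ugen_def using assms by (intro ucl_add[OF A]) (auto simp: word_gen_closed')
  finally show ?thesis .
qed

lemma ugen_smult:
  assumes "f \<in> A"
  shows "ugen A (Polynomial.smult c f) = uscal A c \<otimes>\<^bsub>UEA (vfields A)\<^esub> ugen A f"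
proof -
  have cf: "Polynomial.smult c f \<in> A" using A assms unfolding field_algebra_def by blast
  have "(\<lambda>w. word_gen [c \<odot>\<^bsub>vfields A\<^esub> vf f] w - c * word_gen [vf f] w) \<in> UEA_rels (vfields A)"
    unfolding UEA_rels_def using assms by (auto simp del: smult_fields)
  then have "ugen A (Polynomial.smult c f) = ucl A (\<lambda>w. c * word_gen [vf f] w)"
    unfolding ugen_def using assms cf
    by (intro ucl_rel[OF A]) (auto simp: word_gen_closed' word_gen_closed)
  also have "\<dots> = uscal A c \<otimes>\<^bsub>UEA (vfields A)\<^esub> ugen A f"
    unfolding ugen_def using assms by (intro ucl_scaled_word) auto
  finally show ?thesis .
qed

lemma ugen_bracket:
  assumes "f \<in> A" "g \<in> A"
  shows "ugen A f \<otimes>\<^bsub>UEA (vfields A)\<^esub> ugen A g = ugen A g \<otimes>\<^bsub>UEA (vfields A)\<^esub> ugen A f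
     \<oplus>\<^bsub>UEA (vfields A)\<^esub> ugen A (f * pderiv g - g * pderiv f)"
proof -
  let ?h = "f * pderiv g - g * pderiv f"
  have fg: "?h \<in> A" using A assms unfolding field_algebra_def by blast
  have "(\<lambda>w. word_gen [vf f, vf g] w - word_gen [vf g, vf f] w
      - word_gen [bracket (vfields A) (vf f) (vf g)] w) \<in> UEA_rels (vfields A)"
    unfolding UEA_rels_def using assms by (auto simp del: bracket_fields)
  moreover have "(\<lambda>w. word_gen [vf g, vf f] w + word_gen [vf ?h] w) \<in> carrier (FA A)"
    using F.a_closed[of "word_gen [vf g, vf f]" "word_gen [vf ?h]"] assms fg
    by (auto simp: free_add word_gen_closed')
  ultimately have "ucl A (word_gen [vf f, vf g]) = ucl A (\<lambda>w. word_gen [vf g, vf f] w + word_gen [vf ?h] w)"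
    using assms by (intro ucl_rel[OF A]) (auto simp: word_gen_closed' diff_diff_add)
  also have "\<dots> = ucl A (word_gen [vf g, vf f]) \<oplus>\<^bsub>UEA (vfields A)\<^esub> ugen A ?h"
    unfolding ugen_def using assms fg by (intro ucl_add[OF A]) (auto simp: word_gen_closed')
  finally show ?thesis
    using assms by (simp add: ucl_word_Cons flip: ugen_def)
qed

lemma uscal_central:
  assumes "u \<in> carrier (UEA (vfields A))"
  shows "uscal A c \<otimes>\<^bsub>UEA (vfields A)\<^esub> u = u \<otimes>\<^bsub>UEA (vfields A)\<^esub> uscal A c"
proof -
  obtain f where f: "f \<in> carrier (FA A)" "u = ucl A f" using assms unfolding UEA_carrier by blast
  let ?c = "\<lambda>w. c * word_gen [] w"
  have c: "?c \<in> carrier (FA A)" by (simp add: word_gen_closed)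
  have "?c \<otimes>\<^bsub>FA A\<^esub> f = f \<otimes>\<^bsub>FA A\<^esub> ?c"
    using f(1)
  proof (induction rule: free_induct)
    case zero
    show ?case using F.l_null[OF c] F.r_null[OF c] by (simp add: free_zero)
  next
    case (add d w f)
    let ?d = "\<lambda>x. d * word_gen w x"
    have d: "?d \<in> carrier (FA A)" using add by (intro word_gen_closed)
    have "?c \<otimes>\<^bsub>FA A\<^esub> (?d \<oplus>\<^bsub>FA A\<^esub> f) = (?d \<oplus>\<^bsub>FA A\<^esub> f) \<otimes>\<^bsub>FA A\<^esub> ?c"
      using add by (simp add: F.l_distr F.r_distr c d free_word_mult mult.commute)
    then show ?case by (simp add: free_add)
  qed
  then show ?thesis
    using ucl_mult[OF A c f(1)] ucl_mult[OF A f(1) c] by (simp add: f(2) uscal_def)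
qed

end

abbreviation (input) "\<U> \<equiv> UEA witt"

lemma carrier_witt: "carrier witt = range vf"
  by (simp add: witt_eq_fields)

lemmas ring_U = ring_UEA[OF field_algebra_UNIV, folded witt_eq_fields]
  and U_ucl_closed = ucl_closed[where A = UNIV, folded witt_eq_fields]
  and U_carrier = UEA_carrier[where A = UNIV, folded witt_eq_fields]
  and U_ucl_add = ucl_add[OF field_algebra_UNIV, folded witt_eq_fields]
  and U_ucl_mult = ucl_mult[OF field_algebra_UNIV, folded witt_eq_fields]
  and U_scal_closed = uscal_closed[OF field_algebra_UNIV, folded witt_eq_fields]
  and U_gen_closed = ugen_closed[OF field_algebra_UNIV UNIV_I, folded witt_eq_fields]
  and U_scal_add = uscal_add[OF field_algebra_UNIV, folded witt_eq_fields]
  and U_scal_mult = uscal_mult[OF field_algebra_UNIV, folded witt_eq_fields]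
  and U_scal_one = uscal_one[OF field_algebra_UNIV, folded witt_eq_fields]
  and U_scal_zero = uscal_zero[OF field_algebra_UNIV, folded witt_eq_fields]
  and U_word_Cons = ucl_word_Cons[OF field_algebra_UNIV UNIV_I, folded witt_eq_fields]
  and U_scaled_word = ucl_scaled_word[OF field_algebra_UNIV, folded witt_eq_fields]
  and U_gen_add = ugen_add[OF field_algebra_UNIV UNIV_I UNIV_I, folded witt_eq_fields]
  and U_gen_smult = ugen_smult[OF field_algebra_UNIV UNIV_I, folded witt_eq_fields]
  and U_gen_bracket = ugen_bracket[OF field_algebra_UNIV UNIV_I UNIV_I, folded witt_eq_fields]
  and U_scal_central = uscal_central[OF field_algebra_UNIV, folded witt_eq_fields]
  and U_scalar = UEA_scalar_vfields[where A = UNIV, folded witt_eq_fields]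
  and U_gen = UEA_gen_vfields[where A = UNIV, folded witt_eq_fields]

text \<open>
  The enveloping algebra is generated by the scalars and \<open>d_{-1}\<close>, \<open>d_1\<close>, \<open>d_2\<close>, whose coefficients are
  \<open>1\<close>, \<open>x^2\<close>, \<open>x^3\<close>: the field \<open>d_0\<close> comes from \<open>[d_{-1}, d_1] = 2 d_0\<close>, and \<open>[d_1, d_k] = (k - 1) d_{k+1}\<close> produces
  the rest from \<open>k = 2\<close> on.
\<close>

lemma UEA_witt_induct [consumes 1, case_names scalar m1 p1 p2 add mult]:
  assumes u: "u \<in> carrier \<U>"
    and sc: "\<And>c. P (uscal UNIV c)"
    and g: "P (ugen UNIV 1)" "P (ugen UNIV (Polynomial.monom 1 2))" "P (ugen UNIV (Polynomial.monom 1 3))"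
    and add: "\<And>u v. u \<in> carrier \<U> \<Longrightarrow> v \<in> carrier \<U> \<Longrightarrow> P u \<Longrightarrow> P v \<Longrightarrow> P (u \<oplus>\<^bsub>\<U>\<^esub> v)"
    and mult: "\<And>u v. u \<in> carrier \<U> \<Longrightarrow> v \<in> carrier \<U> \<Longrightarrow> P u \<Longrightarrow> P v \<Longrightarrow> P (u \<otimes>\<^bsub>\<U>\<^esub> v)"
  shows "P u"
proof -
  note [simp] = U_scal_closed U_gen_closed
  interpret U: ring \<U> by (rule ring_U)
  note smult = U_gen_smult
  have scale: "P (ugen UNIV (Polynomial.smult c f))" if "P (ugen UNIV f)" for c f
    using that mult[of "uscal UNIV c" "ugen UNIV f"] by (simp add: smult sc)
  have plus: "P (ugen UNIV (f + g))" if "P (ugen UNIV f)" "P (ugen UNIV g)" for f g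
    using that add[of "ugen UNIV f" "ugen UNIV g"]
    by (simp add: U_gen_add)
  have brk: "P (ugen UNIV (f * pderiv g - g * pderiv f))" if "P (ugen UNIV f)" "P (ugen UNIV g)" for f g
  proof -
    let ?h = "f * pderiv g - g * pderiv f"
    let ?n = "uscal UNIV (-1) \<otimes>\<^bsub>\<U>\<^esub> (ugen UNIV g \<otimes>\<^bsub>\<U>\<^esub> ugen UNIV f)"
    let ?x = "ugen UNIV g \<otimes>\<^bsub>\<U>\<^esub> ugen UNIV f"
    \<comment> \<open>The closure assumptions offer sums and products only, so \<open>f g - g f\<close> is formed with the scalar \<open>-1\<close>.\<close>
    have "?n \<oplus>\<^bsub>\<U>\<^esub> ?x = (uscal UNIV (-1) \<oplus>\<^bsub>\<U>\<^esub> uscal UNIV 1) \<otimes>\<^bsub>\<U>\<^esub> ?x"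
      by (simp add: U.l_distr U_scal_one)
    also have "\<dots> = \<zero>\<^bsub>\<U>\<^esub>"
      by (simp add: U_scal_zero
          flip: U_scal_add)
    finally have "?n \<oplus>\<^bsub>\<U>\<^esub> (?x \<oplus>\<^bsub>\<U>\<^esub> ugen UNIV ?h) = ugen UNIV ?h"
      by (simp flip: U.a_assoc)
    then have "ugen UNIV ?h = ?n \<oplus>\<^bsub>\<U>\<^esub> ugen UNIV f \<otimes>\<^bsub>\<U>\<^esub> ugen UNIV g"
      by (subst U_gen_bracket[of f g]) auto
    moreover have "P (?n \<oplus>\<^bsub>\<U>\<^esub> ugen UNIV f \<otimes>\<^bsub>\<U>\<^esub> ugen UNIV g)"
      using that by (intro add mult sc) auto
    ultimately show ?thesis by simp
  qed
  have mon: "P (ugen UNIV (Polynomial.monom 1 k))" for k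
  proof (induction k rule: less_induct)
    case (less k)
    consider "k = 0" | "k = 1" | "k = 2" | "k = 3" | "k \<ge> 4" by linarith
    then show ?case
    proof cases
      case 2
      have "Polynomial.monom 1 1 = Polynomial.smult (1/2)
          (1 * pderiv (Polynomial.monom 1 2) - Polynomial.monom 1 2 * pderiv (1 :: complex poly))"
        by (simp add: pderiv_monom smult_monom)
      then show ?thesis using scale[OF brk[OF g(1,2)], of "1/2"] 2 by metis
    next
      case 5
      then obtain m where m: "k = m + 4" by (metis add.commute le_Suc_ex)
      have "Polynomial.monom 1 2 * pderiv (Polynomial.monom 1 (k - 1)) -
           Polynomial.monom 1 (k - 1) * pderiv (Polynomial.monom 1 2 :: complex poly) =
         Polynomial.monom (of_nat (m + 3)) k - Polynomial.monom 2 k"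
        by (simp add: pderiv_monom mult_monom m numeral_eq_Suc)
      also have "\<dots> = Polynomial.monom (of_nat (m + 1)) k"
        by (simp add: diff_monom)
      finally have "Polynomial.monom 1 k = Polynomial.smult (1 / of_nat (m + 1))
          (Polynomial.monom 1 2 * pderiv (Polynomial.monom 1 (k - 1)) -
           Polynomial.monom 1 (k - 1) * pderiv (Polynomial.monom 1 2 :: complex poly))"
        using of_nat_neq_0[of m, where 'a = complex] by (simp add: smult_monom)
      moreover have "P (ugen UNIV (Polynomial.monom 1 (k - 1)))" using 5 by (intro less.IH) simp
      ultimately show ?thesis using scale[OF brk[OF g(2)]] by metis
    qed (use g in \<open>simp_all\<close>)
  qed
  have "P (ugen UNIV (Polynomial.monom 1 k * f))" for f k
  proof (induction f arbitrary: k)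
    case 0
    show ?case using scale[OF g(1), of 0] by simp
  next
    case (pCons a f)
    have "Polynomial.monom 1 k * pCons a f =
        Polynomial.smult a (Polynomial.monom 1 k) + Polynomial.monom 1 (Suc k) * f"
      by (simp add: monom_Suc monom_altdef mult.commute)
    then show ?case using plus[OF scale[OF mon] pCons.IH] by simp
  qed
  from this[of 0] have gen: "P (ugen UNIV f)" for f by simp
  have word: "P (ucl UNIV (word_gen w))" if "w \<in> lists (range vf)" for w
    using that
  proof (induction w)
    case Nil
    show ?case using sc[of 1] by (simp add: uscal_def)
  next
    case (Cons D w)
    then obtain f where "D = vf f" by auto
    with Cons show ?case
      by (simp add: U_word_Cons mult gen U_ucl_closed word_gen_closed' carrier_witt)
  qed
  obtain f where f: "f \<in> carrier (free_algebra witt)" "u = ucl UNIV f"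
    using u unfolding U_carrier by blast
  from f(1) have "P (ucl UNIV f)"
  proof (induction rule: free_induct)
    case zero
    show ?case using sc[of 0] by (simp add: uscal_def)
  next
    case (add c w f)
    have 1: "ucl UNIV (\<lambda>x. c * word_gen w x) \<in> carrier \<U>" "ucl UNIV f \<in> carrier \<U>"
      using add by (auto intro!: U_ucl_closed word_gen_closed)
    have "P (ucl UNIV (\<lambda>x. c * word_gen w x))"
      using add mult[OF _ _ sc word]
      by (simp add: U_scaled_word carrier_witt U_ucl_closed word_gen_closed')
    with add show ?case
      using assms(6)[OF 1] by (simp add: U_ucl_add word_gen_closed)
  qed
  with f(2) show ?thesis by simp
qed

section \<open>Quotient modules\<close>

text \<open>
  In the free abelian group on pairs \<open>(s, m)\<close> the identity \<open>(a + b) x = a x + b x\<close> holds only modulo the relations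
  of the tensor product.  The locale therefore asks for additivity in the ring element up to \<open>H\<close>, which is
  all that the quotient needs.
\<close>

locale quotient_setup = R: ring R + abelian_subgroup H M
  for R :: "('a, 'r) ring_scheme" and H and M :: "('a, 'b, 'm) module_scheme" (structure) +
  assumes act_closed: "\<lbrakk>a \<in> carrier R; x \<in> carrier M\<rbrakk> \<Longrightarrow> a \<odot> x \<in> carrier M"
    and act_add: "\<lbrakk>a \<in> carrier R; x \<in> carrier M; y \<in> carrier M\<rbrakk> \<Longrightarrow>
      a \<odot> (x \<oplus> y) = a \<odot> x \<oplus> a \<odot> y"
    and act_mult: "\<lbrakk>a \<in> carrier R; b \<in> carrier R; x \<in> carrier M\<rbrakk> \<Longrightarrow>
      (a \<otimes>\<^bsub>R\<^esub> b) \<odot> x = a \<odot> (b \<odot> x)"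
    and act_one: "x \<in> carrier M \<Longrightarrow> \<one>\<^bsub>R\<^esub> \<odot> x = x"
    and act_sub: "\<lbrakk>a \<in> carrier R; x \<in> H\<rbrakk> \<Longrightarrow> a \<odot> x \<in> H"
    and act_add_left: "\<lbrakk>a \<in> carrier R; b \<in> carrier R; x \<in> carrier M\<rbrakk> \<Longrightarrow>
      (a \<oplus>\<^bsub>R\<^esub> b) \<odot> x \<in> H +> (a \<odot> x \<oplus> b \<odot> x)"
begin

lemma quot_carrier: "carrier (quot_module M H) = (\<lambda>x. H +> x) ` carrier M"
  by (auto simp: quot_module_def A_RCOSETS_def')

lemma quot_zero: "\<zero>\<^bsub>quot_module M H\<^esub> = H +> \<zero>"
  by (simp add: quot_module_def a_rcos_const)

lemma quot_add:
  "\<lbrakk>x \<in> carrier M; y \<in> carrier M\<rbrakk> \<Longrightarrow> (H +> x) \<oplus>\<^bsub>quot_module M H\<^esub> (H +> y) = H +> (x \<oplus> y)"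
  by (simp add: quot_module_def a_rcos_sum)

lemma coset_eqI: "\<lbrakk>y \<in> H +> x; x \<in> carrier M\<rbrakk> \<Longrightarrow> H +> y = H +> x"
  using a_repr_independence' by blast

lemma quot_smult:
  assumes a: "a \<in> carrier R" and x: "x \<in> carrier M"
  shows "a \<odot>\<^bsub>quot_module M H\<^esub> (H +> x) = H +> (a \<odot> x)"
proof -
  have "H +> (a \<odot> y) = H +> (a \<odot> x)" if "y \<in> H +> x" for y
  proof -
    from that obtain h where h: "h \<in> H" "y = h \<oplus> x" by (auto simp: a_r_coset_def')
    then have "a \<odot> y = a \<odot> h \<oplus> a \<odot> x" using a x act_add[of a h x] by simp
    then have "a \<odot> y \<in> H +> (a \<odot> x)" using act_sub[OF a h(1)] by (auto simp: a_r_coset_def')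
    then show ?thesis using act_closed[OF a x] by (rule coset_eqI)
  qed
  then have "(\<Union>y\<in>H +> x. H +> (a \<odot> y)) = (\<Union>y\<in>H +> x. H +> (a \<odot> x))" by simp
  also have "\<dots> = H +> (a \<odot> x)" using a_rcos_self[OF x] by blast
  finally show ?thesis by (simp add: quot_module_def)
qed

lemma quot_left_module: "left_module R (quot_module M H)"
proof -
  have "abelian_group (quot_module M H)"
  proof (rule abelian_groupI)
    fix C assume "C \<in> carrier (quot_module M H)"
    then obtain x where x: "x \<in> carrier M" "C = H +> x" unfolding quot_carrier by blast
    show "\<exists>Y\<in>carrier (quot_module M H). Y \<oplus>\<^bsub>quot_module M H\<^esub> C = \<zero>\<^bsub>quot_module M H\<^esub>"
      using x by (intro bexI[of _ "H +> (\<ominus> x)"]) (auto simp: quot_carrier quot_add quot_zero l_neg)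
  qed (auto simp: quot_carrier quot_add quot_zero a_ac)
  moreover have "H +> ((a \<oplus>\<^bsub>R\<^esub> b) \<odot> x) = H +> (a \<odot> x \<oplus> b \<odot> x)"
    if "a \<in> carrier R" "b \<in> carrier R" "x \<in> carrier M" for a b x
    using that by (intro coset_eqI act_add_left) (simp_all add: act_closed)
  ultimately show ?thesis
    by (intro left_module.intro left_module_axioms.intro R.ring_axioms)
       (auto simp: quot_carrier quot_add quot_smult act_closed act_add act_mult act_one)
qed

end

section \<open>Modules over the enveloping algebra\<close>

text \<open>
  The complex scalars and the vector fields act on a module over the enveloping algebra through their
  images; \<open>msc\<close> and \<open>mvf\<close> are these two actions.
\<close>

definition msc :: "(uwitt, 'k) module \<Rightarrow> complex \<Rightarrow> 'k \<Rightarrow> 'k"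
  where "msc M c x = UEA_scalar witt c \<odot>\<^bsub>M\<^esub> x"

definition mvf :: "(uwitt, 'k) module \<Rightarrow> complex poly \<Rightarrow> 'k \<Rightarrow> 'k"
  where "mvf M f x = UEA_gen witt (vf f) \<odot>\<^bsub>M\<^esub> x"

lemma msc_alt: "msc M c x = uscal UNIV c \<odot>\<^bsub>M\<^esub> x"
  by (simp add: msc_def U_scalar)

lemma mvf_alt: "mvf M f x = ugen UNIV f \<odot>\<^bsub>M\<^esub> x"
  by (simp add: mvf_def U_gen)

locale umod = left_module "UEA witt" M for M :: "(uwitt, 'k) module" (structure)
begin

lemma act_zero: "u \<in> carrier \<U> \<Longrightarrow> u \<odot> \<zero> = \<zero>"
  using smult_r_distr[of u \<zero> \<zero>] smult_closed[of u \<zero>]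
  by (metis M.r_zero M.zero_closed M.add.l_cancel_one')

lemma msc_closed [simp]: "x \<in> carrier M \<Longrightarrow> msc M c x \<in> carrier M"
  and mvf_closed [simp]: "x \<in> carrier M \<Longrightarrow> mvf M f x \<in> carrier M"
  by (simp_all add: msc_alt mvf_alt smult_closed U_scal_closed U_gen_closed)

lemma msc_add: "\<lbrakk>x \<in> carrier M; y \<in> carrier M\<rbrakk> \<Longrightarrow> msc M c (x \<oplus> y) = msc M c x \<oplus> msc M c y"
  and mvf_add: "\<lbrakk>x \<in> carrier M; y \<in> carrier M\<rbrakk> \<Longrightarrow> mvf M f (x \<oplus> y) = mvf M f x \<oplus> mvf M f y"
  by (simp_all add: msc_alt mvf_alt smult_r_distr U_scal_closed U_gen_closed)

lemma msc_zero [simp]: "msc M c \<zero> = \<zero>"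
  and mvf_zero [simp]: "mvf M f \<zero> = \<zero>"
  by (simp_all add: msc_alt mvf_alt act_zero U_scal_closed U_gen_closed)

lemma msc_one [simp]: "x \<in> carrier M \<Longrightarrow> msc M 1 x = x"
  by (simp add: msc_alt U_scal_one smult_one)

lemma msc_plus: "x \<in> carrier M \<Longrightarrow> msc M (c + d) x = msc M c x \<oplus> msc M d x"
  by (simp add: msc_alt U_scal_add U_scal_closed smult_l_distr)

lemma msc_msc: "x \<in> carrier M \<Longrightarrow> msc M c (msc M d x) = msc M (c * d) x"
  by (simp add: msc_alt U_scal_mult U_scal_closed smult_assoc1)

lemma msc_0 [simp]: "x \<in> carrier M \<Longrightarrow> msc M 0 x = \<zero>"
  using msc_plus[of x 0 0] msc_closed[of x 0]
  by (metis M.add.l_cancel_one' add_0 M.zero_closed)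

lemma msc_minus: "x \<in> carrier M \<Longrightarrow> msc M (-1) x = \<ominus> x"
  using msc_plus[of x "-1" 1] by (intro M.minus_equality[symmetric]) auto

lemma neg_zero [simp]: "\<ominus> \<zero> = \<zero>"
  using msc_minus[of \<zero>] by simp

lemma act_msc: "\<lbrakk>u \<in> carrier \<U>; x \<in> carrier M\<rbrakk> \<Longrightarrow> u \<odot> msc M c x = msc M c (u \<odot> x)"
  by (simp add: msc_alt U_scal_central U_scal_closed flip: smult_assoc1)

lemma mvf_msc: "x \<in> carrier M \<Longrightarrow> mvf M f (msc M c x) = msc M c (mvf M f x)"
  by (simp add: mvf_alt act_msc U_gen_closed)

lemma mvf_plus: "x \<in> carrier M \<Longrightarrow> mvf M (f + g) x = mvf M f x \<oplus> mvf M g x"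
  by (simp add: mvf_alt U_gen_add U_gen_closed smult_l_distr)

lemma mvf_smult: "x \<in> carrier M \<Longrightarrow> mvf M (Polynomial.smult c f) x = msc M c (mvf M f x)"
  by (simp add: mvf_alt msc_alt U_gen_smult U_gen_closed U_scal_closed smult_assoc1)

lemma mvf_comm:
  "x \<in> carrier M \<Longrightarrow>
   mvf M f (mvf M g x) = mvf M g (mvf M f x) \<oplus> mvf M (f * pderiv g - g * pderiv f) x"
proof -
  interpret U: ring \<U> by (rule ring_U)
  assume x: "x \<in> carrier M"
  have "mvf M f (mvf M g x) = (ugen UNIV f \<otimes>\<^bsub>\<U>\<^esub> ugen UNIV g) \<odot> x"
    using x by (simp add: mvf_alt smult_assoc1 U_gen_closed)
  also have "\<dots> = (ugen UNIV g \<otimes>\<^bsub>\<U>\<^esub> ugen UNIV f \<oplus>\<^bsub>\<U>\<^esub> ugen UNIV (f * pderiv g - g * pderiv f)) \<odot> x"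
    by (subst U_gen_bracket) (rule refl)
  finally show ?thesis using x
    by (simp add: mvf_alt smult_assoc1 smult_l_distr U_gen_closed)
qed

text \<open>
  The vector \<open>p(d_{-1}) v\<close>, evaluated by the Horner scheme.
\<close>

definition ev :: "complex poly \<Rightarrow> 'k \<Rightarrow> 'k"
  where "ev p v = fold_coeffs (\<lambda>a y. msc M a v \<oplus> mvf M 1 y) p \<zero>"

lemma ev_0 [simp]: "ev 0 v = \<zero>"
  by (simp add: ev_def)

lemma ev_pCons: "v \<in> carrier M \<Longrightarrow> ev (pCons a p) v = msc M a v \<oplus> mvf M 1 (ev p v)"
  by (cases "pCons a p = 0") (auto simp: ev_def fold_coeffs_pCons_eq pCons_eq_0_iff)

lemma ev_closed [simp]: "v \<in> carrier M \<Longrightarrow> ev p v \<in> carrier M"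
  by (induction p) (auto simp: ev_pCons)

lemma ev_add: "v \<in> carrier M \<Longrightarrow> ev (p + q) v = ev p v \<oplus> ev q v"
proof (induction p q rule: poly_induct2)
  case (pCons a p b q)
  then show ?case by (simp add: ev_pCons msc_plus mvf_add M.a_ac)
qed simp

lemma ev_smult: "v \<in> carrier M \<Longrightarrow> ev (Polynomial.smult c p) v = msc M c (ev p v)"
  by (induction p) (auto simp: ev_pCons msc_add mvf_msc msc_msc)

lemma ev_shift: "v \<in> carrier M \<Longrightarrow> ev (pCons 0 p) v = mvf M 1 (ev p v)"
  by (simp add: ev_pCons)

end

locale umod_hom = M: umod M + N: umod N
  for M :: "(uwitt, 'a) module" and N :: "(uwitt, 'b) module" and f +
  assumes hom: "f \<in> mod_hom \<U> M N"
begin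

lemma closed [simp]: "x \<in> carrier M \<Longrightarrow> f x \<in> carrier N"
  and add: "\<lbrakk>x \<in> carrier M; y \<in> carrier M\<rbrakk> \<Longrightarrow> f (x \<oplus>\<^bsub>M\<^esub> y) = f x \<oplus>\<^bsub>N\<^esub> f y"
  and act: "\<lbrakk>u \<in> carrier \<U>; x \<in> carrier M\<rbrakk> \<Longrightarrow> f (u \<odot>\<^bsub>M\<^esub> x) = u \<odot>\<^bsub>N\<^esub> f x"
  using hom by (auto simp: mod_hom_def hom_def)

lemma msc: "x \<in> carrier M \<Longrightarrow> f (msc M c x) = msc N c (f x)"
  and mvf: "x \<in> carrier M \<Longrightarrow> f (mvf M g x) = mvf N g (f x)"
  by (simp_all add: msc_alt mvf_alt act U_scal_closed U_gen_closed)

lemma zero [simp]: "f \<zero>\<^bsub>M\<^esub> = \<zero>\<^bsub>N\<^esub>"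
  using msc[of "\<zero>\<^bsub>M\<^esub>" 0] by simp

lemma neg: "x \<in> carrier M \<Longrightarrow> f (\<ominus>\<^bsub>M\<^esub> x) = \<ominus>\<^bsub>N\<^esub> f x"
  by (metis M.msc_minus N.msc_minus closed msc)

lemma ev: "v \<in> carrier M \<Longrightarrow> f (M.ev p v) = N.ev p (f v)"
  by (induction p) (auto simp: M.ev_pCons N.ev_pCons add msc mvf)

end

text \<open>
  Because of the three generators, a linear map is a homomorphism as soon as it commutes with them.
\<close>

lemma mod_hom_criterion:
  assumes M: "umod M" and N: "umod N"
    and closed: "\<And>x. x \<in> carrier M \<Longrightarrow> f x \<in> carrier N"
    and add: "\<And>x y. \<lbrakk>x \<in> carrier M; y \<in> carrier M\<rbrakk> \<Longrightarrow> f (x \<oplus>\<^bsub>M\<^esub> y) = f x \<oplus>\<^bsub>N\<^esub> f y"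
    and msc: "\<And>c x. x \<in> carrier M \<Longrightarrow> f (msc M c x) = msc N c (f x)"
    and mvf: "\<And>g x. \<lbrakk>g \<in> {1, Polynomial.monom 1 2, Polynomial.monom 1 3}; x \<in> carrier M\<rbrakk> \<Longrightarrow>
      f (mvf M g x) = mvf N g (f x)"
  shows "f \<in> mod_hom \<U> M N"
proof -
  interpret M: umod M by fact
  interpret N: umod N by fact
  have "\<forall>x\<in>carrier M. f (u \<odot>\<^bsub>M\<^esub> x) = u \<odot>\<^bsub>N\<^esub> f x" if "u \<in> carrier \<U>" for u
    using that
  proof (induction rule: UEA_witt_induct)
    case (add u v)
    then show ?case using closed
      by (simp add: M.smult_l_distr N.smult_l_distr assms(4) M.smult_closed)
  next
    case (mult u v)
    then show ?case using closed
      by (simp add: M.smult_assoc1 N.smult_assoc1 M.smult_closed)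
  qed (use msc mvf in \<open>simp_all add: msc_alt mvf_alt\<close>)
  then show ?thesis using closed add by (auto simp: mod_hom_def hom_def)
qed

section \<open>From representations to modules\<close>

text \<open>
  A field is given by its coefficient, so that the bracket relation becomes an identity between polynomials.
\<close>

locale witt_rep = vector_space scale
  for scale :: "complex \<Rightarrow> 'v :: ab_group_add \<Rightarrow> 'v" +
  fixes rho :: "complex poly \<Rightarrow> 'v \<Rightarrow> 'v"
  assumes rho_add: "rho f (v + w) = rho f v + rho f w"
    and rho_scale: "rho f (scale c v) = scale c (rho f v)"
    and rho_plus: "rho (f + g) v = rho f v + rho g v"
    and rho_smult: "rho (Polynomial.smult c f) v = scale c (rho f v)"
    and rho_bracket: "rho f (rho g v) - rho g (rho f v) = rho (f * pderiv g - g * pderiv f) v"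
begin

definition wact :: "endo list \<Rightarrow> 'v \<Rightarrow> 'v"
  where "wact w v = foldr (\<lambda>D. rho (D [:0, 1:])) w v"

definition act :: "(endo list \<Rightarrow> complex) \<Rightarrow> 'v \<Rightarrow> 'v"
  where "act f v = (\<Sum>w | f w \<noteq> 0. scale (f w) (wact w v))"

definition uact :: "uwitt \<Rightarrow> 'v \<Rightarrow> 'v"
  where "uact u v = act (SOME f. f \<in> u) v"

lemma rho_zero: "rho f 0 = 0"
  using rho_scale[of f 0 0] by simp

lemma wact_linear: "wact w (u + v) = wact w u + wact w v" "wact w (scale c v) = scale c (wact w v)"
  by (induction w) (simp_all add: wact_def rho_add rho_scale)

lemma wact_append: "wact (u @ w) v = wact u (wact w v)"
  by (simp add: wact_def)

lemma act_superset:
  assumes "finite A" "{w. f w \<noteq> 0} \<subseteq> A"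
  shows "act f v = (\<Sum>w\<in>A. scale (f w) (wact w v))"
  unfolding act_def by (rule sum.mono_neutral_left) (use assms in auto)

lemma act_plus:
  assumes "f \<in> carrier (free_algebra L)" "g \<in> carrier (free_algebra L)"
  shows "act (\<lambda>w. f w + g w) v = act f v + act g v"
proof -
  let ?A = "{w. f w \<noteq> 0} \<union> {w. g w \<noteq> 0}"
  have fin: "finite ?A" using assms by (simp add: free_carrier_iff)
  have "act (\<lambda>w. f w + g w) v = (\<Sum>w\<in>?A. scale (f w + g w) (wact w v))"
    using fin by (intro act_superset) auto
  also have "\<dots> = act f v + act g v"
    using fin by (subst (1 2) act_superset[where A = ?A]) (auto simp: scale_left_distrib sum.distrib)
  finally show ?thesis .
qed

lemma act_zero_left: "act (\<lambda>w. 0) v = 0"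
  by (simp add: act_def)

lemma act_word: "act (\<lambda>x. c * word_gen w x) v = scale c (wact w v)"
  by (subst act_superset[where A = "{w}"]) (auto simp: word_gen_def)

lemma act_word': "act (word_gen w) v = wact w v"
  using act_word[of 1 w] by simp

lemma act_linear: "act f (u + v) = act f u + act f v" "act f (scale c v) = scale c (act f v)"
  by (simp_all add: act_def wact_linear scale_right_distrib sum.distrib scale_sum_right mult.commute)

lemma act_zero: "act f 0 = 0"
  using act_linear(2)[of f 0 0] by simp

lemma act_mult:
  assumes f: "f \<in> carrier (free_algebra L)" and g: "g \<in> carrier (free_algebra L)"
  shows "act (f \<otimes>\<^bsub>free_algebra L\<^esub> g) v = act f (act g v)"
proof -
  interpret F: ring "free_algebra L" by (rule ring_free_algebra)
  have word: "act ((\<lambda>x. c * word_gen u x) \<otimes>\<^bsub>free_algebra L\<^esub> g) v = scale c (wact u (act g v))"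
    if u: "u \<in> lists (carrier L)" for c u
    using g
  proof (induction rule: free_induct)
    case zero
    show ?case using F.r_null[OF word_gen_closed[OF u]]
      by (simp add: free_zero act_zero_left wact_linear(2)[of u 0 0, simplified])
  next
    case (add d w g)
    let ?c = "\<lambda>x. c * word_gen u x" and ?d = "\<lambda>x. d * word_gen w x"
    have carr: "?c \<in> carrier (free_algebra L)" "?d \<in> carrier (free_algebra L)"
      using u add by (simp_all add: word_gen_closed)
    have "act (?c \<otimes>\<^bsub>free_algebra L\<^esub> (?d \<oplus>\<^bsub>free_algebra L\<^esub> g)) v
        = act ((?c \<otimes>\<^bsub>free_algebra L\<^esub> ?d) \<oplus>\<^bsub>free_algebra L\<^esub> (?c \<otimes>\<^bsub>free_algebra L\<^esub> g)) v"
      using carr add by (simp add: F.r_distr)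
    also have "\<dots> = act (?c \<otimes>\<^bsub>free_algebra L\<^esub> ?d) v + act (?c \<otimes>\<^bsub>free_algebra L\<^esub> g) v"
      using carr add by (simp add: free_add act_plus[of _ L])
    finally show ?case using carr add
      by (simp add: free_add free_word_mult act_plus[of _ L] act_word add.IH wact_append wact_linear
          scale_right_distrib)
  qed
  from f show ?thesis
  proof (induction rule: free_induct)
    case zero
    show ?case using F.l_null[OF g] by (simp add: free_zero act_zero_left)
  next
    case (add d w f)
    let ?d = "\<lambda>x. d * word_gen w x"
    have carr: "?d \<in> carrier (free_algebra L)"
      using add by (simp add: word_gen_closed)
    have "act ((?d \<oplus>\<^bsub>free_algebra L\<^esub> f) \<otimes>\<^bsub>free_algebra L\<^esub> g) v
        = act ((?d \<otimes>\<^bsub>free_algebra L\<^esub> g) \<oplus>\<^bsub>free_algebra L\<^esub> (f \<otimes>\<^bsub>free_algebra L\<^esub> g)) v"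
      using carr add g by (simp add: F.l_distr)
    also have "\<dots> = act (?d \<otimes>\<^bsub>free_algebra L\<^esub> g) v + act (f \<otimes>\<^bsub>free_algebra L\<^esub> g) v"
      using F.m_closed[OF carr g] F.m_closed[OF add(2) g] by (simp add: free_add act_plus[of _ L])
    finally show ?case using carr add
      by (simp add: free_add word act_plus[of _ L] act_word)
  qed
qed

text \<open>
  The elements of the free algebra that act by zero form an ideal, and it contains the defining
  relations.
\<close>

lemma act_ideal:
  assumes "f \<in> UEA_ideal witt"
  shows "act f v = 0"
proof -
  let ?F = "free_algebra witt"
  interpret F: ring ?F by (rule ring_free_algebra)
  let ?J = "{f \<in> carrier ?F. \<forall>v. act f v = 0}"
  have "ideal ?J ?F"
  proof (rule idealI)
    show "ring ?F" ..
    show "subgroup ?J (add_monoid ?F)"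
    proof (rule F.add.subgroupI)
      show "?J \<noteq> {}" using F.zero_closed by (auto simp: free_zero act_zero_left)
    next
      fix f assume f: "f \<in> ?J"
      then have "\<ominus>\<^bsub>?F\<^esub> f \<in> carrier ?F" "f \<in> carrier ?F" by auto
      moreover from this have "act (\<lambda>w. f w + (\<ominus>\<^bsub>?F\<^esub> f) w) v = act f v + act (\<ominus>\<^bsub>?F\<^esub> f) v" for v
        by (intro act_plus)
      moreover have "(\<lambda>w. f w + (\<ominus>\<^bsub>?F\<^esub> f) w) = (\<lambda>w. 0)"
        using f by (simp add: free_minus)
      ultimately show "\<ominus>\<^bsub>?F\<^esub> f \<in> ?J" using f by (simp add: act_zero_left)
    next
      fix f g assume "f \<in> ?J" "g \<in> ?J"
      then show "f \<oplus>\<^bsub>?F\<^esub> g \<in> ?J"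
        using F.a_closed[of f g] by (simp add: free_add act_plus[of _ witt])
    qed auto
  next
    fix f g assume "f \<in> ?J" "g \<in> carrier ?F"
    then show "g \<otimes>\<^bsub>?F\<^esub> f \<in> ?J" "f \<otimes>\<^bsub>?F\<^esub> g \<in> ?J" by (auto simp: act_mult act_zero)
  qed
  moreover have "UEA_rels witt \<subseteq> ?J"
  proof -
    have three: "act (\<lambda>w. word_gen a w - word_gen b w - word_gen c w) v = wact a v - wact b v - wact c v"
      if "{a, b, c} \<subseteq> lists (carrier witt)" for a b c v
    proof -
      have carr: "(\<lambda>x. d * word_gen w x) \<in> carrier ?F" if "w \<in> {a, b, c}" for d w
        using that \<open>{a, b, c} \<subseteq> lists (carrier witt)\<close> by (intro word_gen_closed) blast
      have "act (\<lambda>w. 1 * word_gen a w + (- 1 * word_gen b w + - 1 * word_gen c w)) v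
          = scale 1 (wact a v) + (scale (- 1) (wact b v) + scale (- 1) (wact c v))"
        using carr[of a 1] carr[of b "-1"] carr[of c "-1"]
          F.a_closed[OF carr[of b "-1"] carr[of c "-1"]]
        by (simp only: act_plus[of _ witt] act_word free_add insertI1 insertI2)
      then show ?thesis by (simp add: algebra_simps)
    qed
    have two: "act (\<lambda>w. word_gen a w - d * word_gen b w) v = wact a v - scale d (wact b v)"
      if "{a, b} \<subseteq> lists (carrier witt)" for a b d v
    proof -
      have carr: "(\<lambda>x. d * word_gen w x) \<in> carrier ?F" if "w \<in> {a, b}" for d w
        using that \<open>{a, b} \<subseteq> lists (carrier witt)\<close> by (intro word_gen_closed) blast
      have "act (\<lambda>w. 1 * word_gen a w + - d * word_gen b w) v
          = scale 1 (wact a v) + scale (- d) (wact b v)"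
        using carr[of a 1] carr[of b "-d"] by (simp only: act_plus[of _ witt] act_word insertI1 insertI2)
      then show ?thesis by simp
    qed
    have gen: "wact [vf f] v = rho f v" "wact [vf f, vf g] v = rho f (rho g v)" for f g v
      by (simp_all add: wact_def)
    note ops = add_fields[where A = UNIV, folded witt_eq_fields]
      smult_fields[where A = UNIV, folded witt_eq_fields]
      bracket_fields[where A = UNIV, folded witt_eq_fields]
    have "act r v = 0" if "r \<in> UEA_rels witt" for r v
      using that unfolding UEA_rels_def
      by (auto simp: three two carrier_witt ops gen rho_plus rho_smult rho_bracket[symmetric])
    moreover have "UEA_rels witt \<subseteq> carrier ?F"
      unfolding witt_eq_fields by (rule UEA_rels_closed) simp
    ultimately show ?thesis by blast
  qed
  ultimately have "UEA_ideal witt \<subseteq> ?J"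
    unfolding UEA_ideal_def by (rule F.genideal_minimal)
  then show ?thesis using assms by blast
qed

lemma uact_ucl:
  assumes f: "f \<in> carrier (free_algebra witt)"
  shows "uact (ucl UNIV f) v = act f v"
proof -
  interpret I: ideal "UEA_ideal witt" "free_algebra witt"
    unfolding witt_eq_fields by (rule UEA_ideal_ideal) simp
  have ucl: "ucl UNIV f = UEA_ideal witt +>\<^bsub>free_algebra witt\<^esub> f"
    by (simp add: ucl_def witt_eq_fields)
  have "act g v = act f v" if "g \<in> ucl UNIV f" for g
  proof -
    from that obtain h where h: "h \<in> UEA_ideal witt" "g = (\<lambda>w. h w + f w)"
      by (auto simp: ucl a_r_coset_def' free_add)
    then show ?thesis using act_plus[of h witt f v] f by (simp add: act_ideal)
  qed
  moreover have "f \<in> ucl UNIV f" unfolding ucl using f by (rule I.a_rcos_self)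
  ultimately show ?thesis unfolding uact_def by (metis someI)
qed

lemma uact_scal: "uact (uscal UNIV c) v = scale c v"
  unfolding uscal_def by (subst uact_ucl) (simp_all add: word_gen_closed act_word wact_def)

lemma uact_gen: "uact (ugen UNIV f) v = rho f v"
  unfolding ugen_def by (subst uact_ucl) (simp_all add: word_gen_closed' act_word' wact_def carrier_witt)

lemma uact_linear: "u \<in> carrier \<U> \<Longrightarrow> uact u (v + w) = uact u v + uact u w"
  "u \<in> carrier \<U> \<Longrightarrow> uact u (scale c v) = scale c (uact u v)"
  unfolding U_carrier by (auto simp: uact_ucl act_linear)

lemma uact_plus:
  "\<lbrakk>u \<in> carrier \<U>; u' \<in> carrier \<U>\<rbrakk> \<Longrightarrow> uact (u \<oplus>\<^bsub>\<U>\<^esub> u') v = uact u v + uact u' v"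
proof -
  interpret F: ring "free_algebra witt" by (rule ring_free_algebra)
  show "\<lbrakk>u \<in> carrier \<U>; u' \<in> carrier \<U>\<rbrakk> \<Longrightarrow> uact (u \<oplus>\<^bsub>\<U>\<^esub> u') v = uact u v + uact u' v"
    unfolding U_carrier using F.a_closed
    by (auto simp: uact_ucl act_plus[of _ witt] free_add simp flip: U_ucl_add)
qed

lemma uact_mult:
  "\<lbrakk>u \<in> carrier \<U>; u' \<in> carrier \<U>\<rbrakk> \<Longrightarrow> uact (u \<otimes>\<^bsub>\<U>\<^esub> u') v = uact u (uact u' v)"
proof -
  interpret F: ring "free_algebra witt" by (rule ring_free_algebra)
  show "\<lbrakk>u \<in> carrier \<U>; u' \<in> carrier \<U>\<rbrakk> \<Longrightarrow> uact (u \<otimes>\<^bsub>\<U>\<^esub> u') v = uact u (uact u' v)"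
    unfolding U_carrier by (auto simp: uact_ucl act_mult simp flip: U_ucl_mult)
qed

text \<open>
  The module over the enveloping algebra, carried over to another type by an injection: the middle
  term of an extension has to live on the product of two given types.
\<close>

definition rep_module :: "('v \<Rightarrow> 'k) \<Rightarrow> (uwitt, 'k) module"
  where "rep_module enc =
    \<lparr>carrier = range enc, monoid.mult = undefined, one = undefined, ring.zero = enc 0,
     add = \<lambda>x y. enc (the_inv enc x + the_inv enc y), smult = \<lambda>u x. enc (uact u (the_inv enc x))\<rparr>"

context
  fixes enc :: "'v \<Rightarrow> 'k" assumes enc: "inj enc"
begin

lemma rep_carrier: "carrier (rep_module enc) = range enc"
  and rep_zero: "\<zero>\<^bsub>rep_module enc\<^esub> = enc 0"
  and rep_add: "enc v \<oplus>\<^bsub>rep_module enc\<^esub> enc w = enc (v + w)"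
  and rep_smult: "u \<odot>\<^bsub>rep_module enc\<^esub> enc v = enc (uact u v)"
  by (simp_all add: rep_module_def the_inv_f_f[OF enc])

lemma umod_rep: "umod (rep_module enc)"
proof -
  have "abelian_group (rep_module enc)"
  proof (rule abelian_groupI)
    fix x assume "x \<in> carrier (rep_module enc)"
    then obtain v where "x = enc v" unfolding rep_carrier by blast
    then show "\<exists>y\<in>carrier (rep_module enc). y \<oplus>\<^bsub>rep_module enc\<^esub> x = \<zero>\<^bsub>rep_module enc\<^esub>"
      by (intro bexI[of _ "enc (- v)"]) (simp_all add: rep_carrier rep_zero rep_add)
  qed (auto simp: rep_carrier rep_zero rep_add algebra_simps)
  then show ?thesis
    using uact_scal[of 1]
    by (intro umod.intro left_module.intro left_module_axioms.intro ring_U)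
       (auto simp: rep_carrier rep_add rep_smult uact_linear uact_plus uact_mult U_scal_one)
qed

lemma rep_msc: "msc (rep_module enc) c (enc v) = enc (scale c v)"
  and rep_mvf: "mvf (rep_module enc) f (enc v) = enc (rho f v)"
  by (simp_all add: msc_alt mvf_alt rep_smult uact_scal uact_gen)

end

end

section \<open>The density model of a Verma module\<close>

text \<open>
  Multiplication by the variable of \<open>\<complex>[t]\<close>, kept apart from \<open>pCons\<close> so that linear combinations are
  not merged into single coefficients.
\<close>

definition mulX :: "complex poly \<Rightarrow> complex poly"
  where "mulX p = pCons 0 p"

lemma mulX_linear: "mulX (p + q) = mulX p + mulX q" "mulX (p - q) = mulX p - mulX q"
  "mulX (Polynomial.smult c p) = Polynomial.smult c (mulX p)" "mulX 0 = 0" "mulX (- p) = - mulX p"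
  by (simp_all add: mulX_def)

text \<open>
  The differential operator \<open>f(-d/dt)\<close>: under the Fourier transform \<open>x\<close> becomes \<open>-d/dt\<close> and
  \<open>d/dx\<close> becomes multiplication by \<open>t\<close>.
\<close>

definition xop :: "complex poly \<Rightarrow> complex poly \<Rightarrow> complex poly"
  where "xop f p = fold_coeffs (\<lambda>a q. Polynomial.smult a p - pderiv q) f 0"

lemma xop_0_left [simp]: "xop 0 p = 0"
  by (simp add: xop_def)

lemma xop_pCons: "xop (pCons a f) p = Polynomial.smult a p - pderiv (xop f p)"
  by (cases "pCons a f = 0") (auto simp: xop_def fold_coeffs_pCons_eq)

lemma xop_const [simp]: "xop [:c:] p = Polynomial.smult c p" "xop 1 p = p"
  using xop_pCons[of c 0 p] xop_pCons[of 1 0 p] by (simp_all add: one_pCons)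

lemma xop_plus: "xop (f + g) p = xop f p + xop g p"
  by (induction f g rule: poly_induct2)
     (simp_all add: xop_pCons pderiv_add Polynomial.smult_add_left)

lemma xop_smult: "xop (Polynomial.smult c f) p = Polynomial.smult c (xop f p)"
  by (induction f) (simp_all add: xop_pCons pderiv_smult Polynomial.smult_diff_right)

lemma xop_diff: "xop (f - g) p = xop f p - xop g p"
  using xop_plus[of f "- g" p] xop_smult[of "-1" g p] by simp

lemma xop_add_right: "xop f (p + q) = xop f p + xop f q"
  by (induction f) (simp_all add: xop_pCons pderiv_add Polynomial.smult_add_right)

lemma xop_smult_right: "xop f (Polynomial.smult c p) = Polynomial.smult c (xop f p)"
  by (induction f) (simp_all add: xop_pCons pderiv_smult Polynomial.smult_diff_right mult.commute)

lemma xop_0_right [simp]: "xop f 0 = 0"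
  using xop_smult_right[of f 0 0] by simp

lemma xop_mult: "xop (f * g) p = xop f (xop g p)"
  by (induction f) (simp_all add: xop_pCons xop_plus xop_smult mult_pCons_left)

lemma xop_mulX: "xop f (mulX p) = mulX (xop f p) - xop (pderiv f) p"
proof (induction f)
  case (pCons a f)
  have "pderiv (mulX q) = q + mulX (pderiv q)" for q by (simp add: mulX_def pderiv_pCons)
  with pCons.IH show ?case
    by (simp add: xop_pCons mulX_linear pderiv_diff pderiv_pCons xop_plus)
qed (simp add: mulX_linear)

lemma xop_one: "xop f 1 = [:poly.coeff f 0:]"
proof (induction f)
  case (pCons a f)
  then show ?case by (simp add: xop_pCons pderiv_pCons)
qed simp

lemma smult_linear_simps:
  fixes p q :: "complex poly"
  shows
  "Polynomial.smult c (p + q) = Polynomial.smult c p + Polynomial.smult c q"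
  "Polynomial.smult c (p - q) = Polynomial.smult c p - Polynomial.smult c q"
  by (simp_all add: Polynomial.smult_add_right Polynomial.smult_diff_right)

text \<open>
  The action of \<open>f d/dx\<close> on the Verma module \<open>\<Delta>(lam)\<close>, where \<open>t^k\<close> stands for \<open>d_{-1}^k\<close> applied to
  the highest weight vector.  It is the Fourier transform of the Lie derivative on densities.
\<close>

definition dens :: "complex \<Rightarrow> complex poly \<Rightarrow> complex poly \<Rightarrow> complex poly"
  where "dens lam f p = mulX (xop f p) + Polynomial.smult lam (xop (pderiv f) p)"

lemma vector_space_poly: "vector_space (Polynomial.smult :: complex \<Rightarrow> complex poly \<Rightarrow> complex poly)"
  by unfold_locales (simp_all add: Polynomial.smult_add_left Polynomial.smult_add_right)

lemma dens_linear:
  "dens lam f (p + q) = dens lam f p + dens lam f q"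
  "dens lam f (Polynomial.smult c p) = Polynomial.smult c (dens lam f p)"
  "dens lam (f + g) p = dens lam f p + dens lam g p"
  "dens lam (Polynomial.smult c f) p = Polynomial.smult c (dens lam f p)"
  by (simp_all add: dens_def xop_add_right xop_smult_right xop_plus xop_smult pderiv_add pderiv_smult
      mulX_linear Polynomial.smult_add_right mult.commute)

lemma dens_bracket:
  "dens lam f (dens lam g p) - dens lam g (dens lam f p) = dens lam (f * pderiv g - g * pderiv f) p"
  by (simp add: dens_def xop_add_right xop_smult_right xop_mulX xop_diff xop_plus pderiv_mult pderiv_diff
      mulX_linear smult_linear_simps mult.commute flip: xop_mult)

interpretation dens: witt_rep Polynomial.smult "dens lam" for lam
  by (intro witt_rep.intro vector_space_poly witt_rep_axioms.intro dens_linear dens_bracket)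

lemma dens_one [simp]: "dens lam 1 p = mulX p"
  by (simp add: dens_def)

lemma dens_unit: "dens lam f 1 = [:lam * poly.coeff f 1, poly.coeff f 0:]"
  by (simp add: dens_def xop_one mulX_def coeff_pderiv)

lemma dens_mulX: "dens lam f (mulX p) = mulX (dens lam f p) - dens lam (pderiv f) p"
  using dens_bracket[of lam f 1 p] by (simp add: algebra_simps)
     (metis add_diff_cancel_left' dens.rho_plus dens.rho_zero diff_0 add.inverse_inverse add.right_inverse diff_diff_eq2 dens_one)

definition falling :: "nat \<Rightarrow> nat \<Rightarrow> complex"
  where "falling k i = (\<Prod>j<i. of_nat k - of_nat j)"

lemma falling_zero: "k < i \<Longrightarrow> falling k i = 0"
  by (auto simp: falling_def)

lemma xop_monom: "xop (Polynomial.monom 1 i) (Polynomial.monom 1 k) =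
    Polynomial.monom ((-1) ^ i * falling k i) (k - i)"
proof (induction i)
  case 0
  show ?case by (simp add: falling_def monom_0)
next
  case (Suc i)
  have "xop (Polynomial.monom 1 (Suc i)) p = - pderiv (xop (Polynomial.monom 1 i) p)" for p
    by (simp add: monom_Suc xop_pCons)
  then show ?case
  proof (cases "k < i")
    case True
    then show ?thesis using Suc \<open>\<And>p. xop (Polynomial.monom 1 (Suc i)) p = _\<close> by (simp add: falling_zero)
  next
    case False
    then show ?thesis using Suc \<open>\<And>p. xop (Polynomial.monom 1 (Suc i)) p = _\<close>
      by (simp add: pderiv_monom falling_def of_nat_diff mult.commute flip: minus_monom)
  qed
qed

text \<open>
  The coefficient of \<open>t^(k-i)\<close> in \<open>d_i t^k\<close>.
\<close>

definition dc :: "complex \<Rightarrow> nat \<Rightarrow> nat \<Rightarrow> complex"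
  where "dc lam i k = (-1) ^ Suc i * falling k i * (of_nat k - of_nat i - lam * of_nat (Suc i))"

lemma dens_monom:
  assumes "k \<ge> i"
  shows "dens lam (Polynomial.monom 1 (Suc i)) (Polynomial.monom c k) =
    Polynomial.monom (c * dc lam i k) (k - i)"
proof -
  have "mulX (xop (Polynomial.monom 1 (Suc i)) (Polynomial.monom 1 k)) =
      Polynomial.monom ((-1) ^ Suc i * falling k (Suc i)) (k - i)"
  proof (cases "k = i")
    case True
    then show ?thesis by (simp add: xop_monom falling_zero mulX_linear)
  next
    case False
    with assms have "Suc (k - Suc i) = k - i" by simp
    then show ?thesis by (simp add: xop_monom mulX_def flip: monom_Suc)
  qed
  moreover have "falling k (Suc i) = falling k i * (of_nat k - of_nat i)"
    by (simp add: falling_def)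
  moreover have "xop (pderiv (Polynomial.monom 1 (Suc i))) (Polynomial.monom 1 k) =
      Polynomial.smult (of_nat (Suc i)) (Polynomial.monom ((-1) ^ i * falling k i) (k - i))"
    using xop_smult[of "of_nat (Suc i)" "Polynomial.monom 1 i"]
    by (simp add: pderiv_monom xop_monom smult_monom)
  ultimately have "dens lam (Polynomial.monom 1 (Suc i)) (Polynomial.monom 1 k) =
      Polynomial.monom (dc lam i k) (k - i)"
    by (simp add: dens_def smult_monom add_monom dc_def algebra_simps)
  then show ?thesis
    using dens_linear(2)[of lam "Polynomial.monom 1 (Suc i)" c "Polynomial.monom 1 k"]
    by (simp add: smult_monom)
qed

lemma dens_monom_zero:
  assumes "k < i"
  shows "dens lam (Polynomial.monom 1 (Suc i)) (Polynomial.monom c k) = 0"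
proof -
  have "xop (Polynomial.monom 1 (Suc i)) (Polynomial.monom 1 k) = 0"
    using assms by (simp add: xop_monom falling_zero)
  moreover have "xop (pderiv (Polynomial.monom 1 (Suc i))) (Polynomial.monom 1 k) = 0"
    using assms xop_smult[of "of_nat (Suc i)" "Polynomial.monom 1 i"]
    by (simp add: pderiv_monom xop_monom smult_monom falling_zero)
  ultimately have "dens lam (Polynomial.monom 1 (Suc i)) (Polynomial.monom 1 k) = 0"
    by (simp add: dens_def mulX_linear)
  then show ?thesis
    using dens_linear(2)[of lam "Polynomial.monom 1 (Suc i)" c "Polynomial.monom 1 k"]
    by (simp add: smult_monom)
qed

section \<open>The Verma module as a tensor product\<close>

text \<open>
  The only facts about Verma modules that the classification uses.
\<close>

locale verma_model = umod N for N :: "(uwitt, 'k) module" (structure) +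
  fixes lam :: complex and eps :: "complex poly \<Rightarrow> 'k"
  assumes eps_inj: "inj eps"
    and eps_range: "range eps = carrier N"
    and eps_add: "eps (p + q) = eps p \<oplus> eps q"
    and eps_msc: "msc N c (eps p) = eps (Polynomial.smult c p)"
    and eps_mvf: "mvf N f (eps p) = eps (dens lam f p)"

text \<open>
  A highest weight vector generates an image of the density model: moving \<open>f d/dx\<close> past \<open>d_{-1}\<close> costs
  the field with coefficient \<open>-f'\<close>, on both sides.
\<close>

lemma (in umod) ev_mvf:
  assumes v: "v \<in> carrier M"
    and hw: "\<And>f. mvf M (pCons 0 f) v = msc M (lam * poly.coeff f 0) v"
  shows "mvf M f (ev p v) = ev (dens lam f p) v"
proof (induction p arbitrary: f)
  case 0
  then show ?case by (simp add: dens.rho_zero)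
next
  case (pCons a p)
  have base: "mvf M f v = ev (dens lam f 1) v" for f
  proof (cases f)
    case (pCons c g)
    have f: "f = Polynomial.smult c 1 + pCons 0 g" by (simp add: pCons)
    have "mvf M f v = msc M c (mvf M 1 v) \<oplus> mvf M (pCons 0 g) v"
      by (subst f, subst mvf_plus) (simp_all only: v mvf_smult)
    then show ?thesis
      unfolding dens_unit by (simp add: v hw ev_pCons mvf_msc M.a_comm pCons)
  qed
  have "pCons a p = Polynomial.smult a 1 + mulX p" by (simp add: mulX_def)
  moreover have "dens lam (- pderiv f) p = - dens lam (pderiv f) p"
    using dens.rho_smult[of lam "-1" "pderiv f" p] by simp
  ultimately have "dens lam f (pCons a p) = Polynomial.smult a (dens lam f 1) + mulX (dens lam f p) + dens lam (- pderiv f) p"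
    by (simp only: dens_linear dens_mulX) simp
  then have "ev (dens lam f (pCons a p)) v =
      msc M a (mvf M f v) \<oplus> (mvf M 1 (mvf M f (ev p v)) \<oplus> mvf M (- pderiv f) (ev p v))"
    using v by (simp only: ev_add ev_smult base[of f] pCons.IH mulX_def ev_shift M.a_assoc
        ev_closed mvf_closed msc_closed)
  also have "mvf M 1 (mvf M f (ev p v)) \<oplus> mvf M (- pderiv f) (ev p v) = mvf M f (mvf M 1 (ev p v))"
    using v mvf_comm[of "ev p v" f 1] by simp
  also have "msc M a (mvf M f v) \<oplus> mvf M f (mvf M 1 (ev p v)) = mvf M f (msc M a v \<oplus> mvf M 1 (ev p v))"
    using v by (simp only: mvf_add mvf_msc msc_closed mvf_closed ev_closed)
  also have "msc M a v \<oplus> mvf M 1 (ev p v) = ev (pCons a p) v"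
    using v by (simp only: ev_pCons)
  finally show ?case by simp
qed

abbreviation (input) "FP lam \<equiv> free_pairs \<U> (one_dim lam)"

lemma carrier_one_dim: "carrier (one_dim lam) = UNIV"
  and add_one_dim: "x \<oplus>\<^bsub>one_dim lam\<^esub> y = x + y"
  by (simp_all add: one_dim_def UEA_module_def complex_line_def)

lemma FP_carrier: "f \<in> carrier (FP lam) \<longleftrightarrow> finite {p. f p \<noteq> 0} \<and> (\<forall>p. f p \<noteq> 0 \<longrightarrow> fst p \<in> carrier \<U>)"
  by (auto simp: free_pairs_def carrier_one_dim)

lemma FP_add: "f \<oplus>\<^bsub>FP lam\<^esub> g = (\<lambda>p. f p + g p)"
  and FP_zero: "\<zero>\<^bsub>FP lam\<^esub> = (\<lambda>p. 0)"
  by (simp_all add: free_pairs_def)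

lemma pair_closed: "u \<in> carrier \<U> \<Longrightarrow> (\<lambda>q. k * pair_gen (u, z) q) \<in> carrier (FP lam)"
  by (auto simp: FP_carrier pair_gen_def)

lemma pair_closed': "u \<in> carrier \<U> \<Longrightarrow> pair_gen (u, z) \<in> carrier (FP lam)"
  using pair_closed[of u 1] by simp

lemma abelian_group_FP: "abelian_group (FP lam)"
proof (rule abelian_groupI)
  fix f g assume fg: "f \<in> carrier (FP lam)" "g \<in> carrier (FP lam)"
  have "{p. f p + g p \<noteq> 0} \<subseteq> {p. f p \<noteq> 0} \<union> {p. g p \<noteq> 0}" by auto
  then have "finite {p. f p + g p \<noteq> 0}"
    by (rule finite_subset) (use fg in \<open>simp add: FP_carrier\<close>)
  moreover have "fst p \<in> carrier \<U>" if "f p + g p \<noteq> 0" for p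
  proof -
    have "f p \<noteq> 0 \<or> g p \<noteq> 0" using that by auto
    then show ?thesis using fg unfolding FP_carrier by blast
  qed
  ultimately show "f \<oplus>\<^bsub>FP lam\<^esub> g \<in> carrier (FP lam)" unfolding FP_carrier FP_add by blast
next
  fix f assume "f \<in> carrier (FP lam)"
  then show "\<exists>g\<in>carrier (FP lam). g \<oplus>\<^bsub>FP lam\<^esub> f = \<zero>\<^bsub>FP lam\<^esub>"
    by (intro bexI[of _ "\<lambda>p. - f p"]) (auto simp: FP_add FP_zero FP_carrier)
qed (auto simp: FP_add FP_zero, auto simp: FP_carrier)

lemma FP_minus: "f \<in> carrier (FP lam) \<Longrightarrow> \<ominus>\<^bsub>FP lam\<^esub> f = (\<lambda>p. - f p)"
proof -
  interpret abelian_group "FP lam" by (rule abelian_group_FP)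
  assume f: "f \<in> carrier (FP lam)"
  then show ?thesis by (intro minus_equality) (auto simp: FP_add FP_zero, auto simp: FP_carrier)
qed

lemma FP_induct [consumes 1, case_names zero add sub]:
  assumes f: "f \<in> carrier (FP lam)"
    and zero: "P (\<lambda>p. 0)"
    and add: "\<And>u z f. u \<in> carrier \<U> \<Longrightarrow> f \<in> carrier (FP lam) \<Longrightarrow> P f \<Longrightarrow>
                P (\<lambda>q. f q + pair_gen (u, z) q)"
    and sub: "\<And>u z f. u \<in> carrier \<U> \<Longrightarrow> f \<in> carrier (FP lam) \<Longrightarrow> P f \<Longrightarrow>
                P (\<lambda>q. f q - pair_gen (u, z) q)"
  shows "P f"
proof -
  interpret A: abelian_group "FP lam" by (rule abelian_group_FP)
  have multiple: "P (\<lambda>q. f q + k * pair_gen (u, z) q)"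
    if u: "u \<in> carrier \<U>" and f: "f \<in> carrier (FP lam)" and Pf: "P f" for u z f and k :: int
  proof (induction k rule: int_induct[of _ 0])
    case base
    show ?case using Pf by simp
  next
    case (step1 i)
    have "(\<lambda>q. f q + i * pair_gen (u, z) q) \<in> carrier (FP lam)"
      using A.a_closed[OF f pair_closed[OF u, of i z]] by (simp add: FP_add)
    from add[OF u this step1(2), of z] show ?case by (simp add: algebra_simps)
  next
    case (step2 i)
    have "(\<lambda>q. f q + i * pair_gen (u, z) q) \<in> carrier (FP lam)"
      using A.a_closed[OF f pair_closed[OF u, of i z]] by (simp add: FP_add)
    from sub[OF u this step2(2), of z] show ?case by (simp add: algebra_simps)
  qed
  have "\<forall>f. {p. f p \<noteq> 0} \<subseteq> S \<longrightarrow> P f" if "finite S" "\<forall>p\<in>S. fst p \<in> carrier \<U>" for S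
    using that
  proof (induction S)
    case empty
    have "f = (\<lambda>w. 0)" if "{w. f w \<noteq> 0} \<subseteq> {}" for f :: "uwitt \<times> complex \<Rightarrow> int" using that by auto
    then show ?case using zero by metis
  next
    case (insert p S)
    show ?case
    proof (intro allI impI)
      fix f :: "uwitt \<times> complex \<Rightarrow> int" assume f: "{w. f w \<noteq> 0} \<subseteq> insert p S"
      let ?g = "f(p := 0)"
      have g: "{w. ?g w \<noteq> 0} \<subseteq> S" using f by auto
      then have "P ?g" using insert.IH insert.prems by blast
      moreover have "?g \<in> carrier (FP lam)"
        using g insert finite_subset[OF g] unfolding FP_carrier by blast
      ultimately have "P (\<lambda>q. ?g q + f p * pair_gen (fst p, snd p) q)"
        using insert.prems by (intro multiple) blast+
      moreover have "(\<lambda>q. ?g q + f p * pair_gen (fst p, snd p) q) = f"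
        by (auto simp: pair_gen_def)
      ultimately show "P f" by simp
    qed
  qed
  then show ?thesis using f unfolding FP_carrier by blast
qed

lemma FP_smult_superset:
  assumes "finite A" "{p. f p \<noteq> 0} \<subseteq> A \<times> UNIV"
  shows "(s \<odot>\<^bsub>FP lam\<^esub> f) (t, z) = (\<Sum>u\<in>A. if s \<otimes>\<^bsub>\<U>\<^esub> u = t then f (u, z) else 0)"
proof -
  have "(s \<odot>\<^bsub>FP lam\<^esub> f) (t, z) = (\<Sum>u | f (u, z) \<noteq> 0 \<and> s \<otimes>\<^bsub>\<U>\<^esub> u = t. f (u, z))"
    by (simp add: free_pairs_def)
  also have "\<dots> = (\<Sum>u | f (u, z) \<noteq> 0 \<and> s \<otimes>\<^bsub>\<U>\<^esub> u = t. if s \<otimes>\<^bsub>\<U>\<^esub> u = t then f (u, z) else 0)"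
    by (intro sum.cong) auto
  also have "\<dots> = (\<Sum>u\<in>A. if s \<otimes>\<^bsub>\<U>\<^esub> u = t then f (u, z) else 0)"
    by (rule sum.mono_neutral_left) (use assms in auto)
  finally show ?thesis .
qed

lemma FP_smult_add:
  assumes "f \<in> carrier (FP lam)" "g \<in> carrier (FP lam)"
  shows "s \<odot>\<^bsub>FP lam\<^esub> (\<lambda>p. f p + g p) = (\<lambda>p. (s \<odot>\<^bsub>FP lam\<^esub> f) p + (s \<odot>\<^bsub>FP lam\<^esub> g) p)"
proof
  fix p :: "uwitt \<times> complex"
  obtain t z where p: "p = (t, z)" by (cases p)
  let ?A = "fst ` {p. f p \<noteq> 0} \<union> fst ` {p. g p \<noteq> 0}"
  have fin: "finite ?A" using assms by (simp add: FP_carrier)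
  have proj: "S \<subseteq> fst ` S \<times> UNIV" for S :: "(uwitt \<times> complex) set" by force
  have sub: "{p. f p \<noteq> 0} \<subseteq> ?A \<times> UNIV" "{p. g p \<noteq> 0} \<subseteq> ?A \<times> UNIV"
    using proj[of "{p. f p \<noteq> 0}"] proj[of "{p. g p \<noteq> 0}"] by blast+
  moreover have "{p. f p + g p \<noteq> 0} \<subseteq> {p. f p \<noteq> 0} \<union> {p. g p \<noteq> 0}" by auto
  ultimately have sub3: "{p. f p + g p \<noteq> 0} \<subseteq> ?A \<times> UNIV" by blast
  show "(s \<odot>\<^bsub>FP lam\<^esub> (\<lambda>p. f p + g p)) p = (s \<odot>\<^bsub>FP lam\<^esub> f) p + (s \<odot>\<^bsub>FP lam\<^esub> g) p"
    unfolding p FP_smult_superset[OF fin sub(1)] FP_smult_superset[OF fin sub(2)]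
      FP_smult_superset[OF fin sub3] sum.distrib[symmetric]
    by (rule sum.cong) auto
qed

lemma FP_smult_pair: "s \<odot>\<^bsub>FP lam\<^esub> (\<lambda>q. k * pair_gen (u, z) q) = (\<lambda>q. k * pair_gen (s \<otimes>\<^bsub>\<U>\<^esub> u, z) q)"
proof
  fix p :: "uwitt \<times> complex"
  obtain t y where p: "p = (t, y)" by (cases p)
  have "{p. k * pair_gen (u, z) p \<noteq> 0} \<subseteq> {u} \<times> UNIV" by (auto simp: pair_gen_def)
  from FP_smult_superset[OF _ this, of lam s t y]
  show "(s \<odot>\<^bsub>FP lam\<^esub> (\<lambda>q. k * pair_gen (u, z) q)) p = k * pair_gen (s \<otimes>\<^bsub>\<U>\<^esub> u, z) p"
    unfolding p by (auto simp: pair_gen_def)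
qed

lemma FP_smult_pair': "s \<odot>\<^bsub>FP lam\<^esub> pair_gen (u, z) = pair_gen (s \<otimes>\<^bsub>\<U>\<^esub> u, z)"
  using FP_smult_pair[of lam s 1 u z] by simp

lemma FP_smult_zero: "s \<odot>\<^bsub>FP lam\<^esub> (\<lambda>p. 0) = (\<lambda>p. 0)"
  using FP_smult_pair[of lam s 0] by simp

lemma FP_smult_diff_pair:
  assumes "f \<in> carrier (FP lam)" "u \<in> carrier \<U>"
  shows "s \<odot>\<^bsub>FP lam\<^esub> (\<lambda>q. f q - pair_gen (u, z) q) =
    (\<lambda>q. (s \<odot>\<^bsub>FP lam\<^esub> f) q - pair_gen (s \<otimes>\<^bsub>\<U>\<^esub> u, z) q)"
  using FP_smult_add[OF assms(1) pair_closed[OF assms(2), of "-1" z], of s] FP_smult_pair[of lam s "-1" u z]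
  by simp

lemma FP_diff_pair_closed:
  "\<lbrakk>f \<in> carrier (FP lam); u \<in> carrier \<U>\<rbrakk> \<Longrightarrow> (\<lambda>q. f q - pair_gen (u, z) q) \<in> carrier (FP lam)"
  "\<lbrakk>f \<in> carrier (FP lam); u \<in> carrier \<U>\<rbrakk> \<Longrightarrow> (\<lambda>q. f q + pair_gen (u, z) q) \<in> carrier (FP lam)"
proof -
  interpret A: abelian_group "FP lam" by (rule abelian_group_FP)
  assume *: "f \<in> carrier (FP lam)" "u \<in> carrier \<U>"
  show "(\<lambda>q. f q - pair_gen (u, z) q) \<in> carrier (FP lam)"
    using A.a_closed[OF *(1) pair_closed[OF *(2), of "-1" z]] by (simp add: FP_add)
  show "(\<lambda>q. f q + pair_gen (u, z) q) \<in> carrier (FP lam)"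
    using A.a_closed[OF *(1) pair_closed[OF *(2), of "1" z]] by (simp add: FP_add)
qed

lemma FP_smult_closed:
  assumes s: "s \<in> carrier \<U>" and f: "f \<in> carrier (FP lam)"
  shows "s \<odot>\<^bsub>FP lam\<^esub> f \<in> carrier (FP lam)"
proof -
  interpret U: ring \<U> by (rule ring_U)
  from f show ?thesis
  proof (induction rule: FP_induct)
    case zero
    show ?case by (simp add: FP_smult_zero FP_carrier)
  qed (use s in \<open>simp_all add: FP_smult_diff_pair FP_smult_add FP_smult_pair' FP_diff_pair_closed pair_closed'\<close>)
qed

abbreviation "borel_fields \<equiv> {f :: complex poly. poly.coeff f 0 = 0}"

text \<open>
  The relations of the tensor product that defines the Verma module, and the subgroup that they
  generate.
\<close>

definition VR :: "complex \<Rightarrow> (uwitt \<times> complex \<Rightarrow> int) set"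
  where "VR lam = balance_rels (UEA_incl witt) (UEA borel) \<U> (one_dim lam)"

definition VH :: "complex \<Rightarrow> (uwitt \<times> complex \<Rightarrow> int) set"
  where "VH lam = generate (add_monoid (FP lam)) (VR lam)"

lemma VR_cases:
  assumes "r \<in> VR lam"
  obtains (add_left) s t z where "s \<in> carrier \<U>" "t \<in> carrier \<U>"
      "r = (\<lambda>q. pair_gen (s \<oplus>\<^bsub>\<U>\<^esub> t, z) q - pair_gen (s, z) q - pair_gen (t, z) q)"
    | (add_right) s x y where "s \<in> carrier \<U>"
      "r = (\<lambda>q. pair_gen (s, x + y) q - pair_gen (s, x) q - pair_gen (s, y) q)"
    | (balance) s u z where "s \<in> carrier \<U>" "u \<in> carrier (UEA borel)"
      "r = (\<lambda>q. pair_gen (s \<otimes>\<^bsub>\<U>\<^esub> UEA_incl witt u, z) q - pair_gen (s, u \<odot>\<^bsub>one_dim lam\<^esub> z) q)"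
  using assms unfolding VR_def balance_rels_def by (auto simp: carrier_one_dim add_one_dim)

lemma VR_add_left: "\<lbrakk>s \<in> carrier \<U>; t \<in> carrier \<U>\<rbrakk> \<Longrightarrow>
    (\<lambda>q. pair_gen (s \<oplus>\<^bsub>\<U>\<^esub> t, z) q - pair_gen (s, z) q - pair_gen (t, z) q) \<in> VR lam"
  unfolding VR_def balance_rels_def
  by (rule UnI1, rule UnI1, rule CollectI, intro exI conjI, rule refl) (simp_all add: carrier_one_dim)

lemma VR_add_right: "s \<in> carrier \<U> \<Longrightarrow>
    (\<lambda>q. pair_gen (s, x + y) q - pair_gen (s, x) q - pair_gen (s, y) q) \<in> VR lam"
  unfolding VR_def balance_rels_def add_one_dim[of lam x y, symmetric]
  by (rule UnI1, rule UnI2, rule CollectI, intro exI conjI, rule refl) (simp_all add: carrier_one_dim)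

lemma VR_balance: "\<lbrakk>s \<in> carrier \<U>; u \<in> carrier (UEA borel)\<rbrakk> \<Longrightarrow>
    (\<lambda>q. pair_gen (s \<otimes>\<^bsub>\<U>\<^esub> UEA_incl witt u, z) q - pair_gen (s, u \<odot>\<^bsub>one_dim lam\<^esub> z) q) \<in> VR lam"
  unfolding VR_def balance_rels_def
  by (rule UnI2, rule CollectI, intro exI conjI, rule refl) (simp_all add: carrier_one_dim)

lemmas VR_intros = VR_add_left VR_add_right VR_balance

lemma UEA_incl_closed: "u \<in> carrier (UEA borel) \<Longrightarrow> UEA_incl witt u \<in> carrier \<U>"
proof -
  assume "u \<in> carrier (UEA borel)"
  then obtain f where f: "f \<in> carrier (FA borel_fields)" "u = ucl borel_fields f"
    unfolding borel_eq_fields UEA_carrier by blast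
  then have "f \<in> carrier (free_algebra witt)"
    using free_carrier_mono[of borel_fields UNIV] by (auto simp: witt_eq_fields)
  moreover have "UEA_incl witt u = ucl UNIV f"
    using UEA_incl_ucl[of borel_fields UNIV f] f by (simp add: witt_eq_fields)
  ultimately show ?thesis by (simp add: U_ucl_closed)
qed

lemma VR_closed: "VR lam \<subseteq> carrier (FP lam)"
proof
  interpret U: ring \<U> by (rule ring_U)
  fix r assume "r \<in> VR lam"
  then show "r \<in> carrier (FP lam)"
    by (cases rule: VR_cases) (auto intro!: FP_diff_pair_closed pair_closed' UEA_incl_closed)
qed

lemma VR_smult:
  assumes s: "s \<in> carrier \<U>" and r: "r \<in> VR lam"
  shows "s \<odot>\<^bsub>FP lam\<^esub> r \<in> VR lam"
proof -
  interpret U: ring \<U> by (rule ring_U)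
  note [simp] = FP_smult_diff_pair FP_diff_pair_closed pair_closed' FP_smult_pair' UEA_incl_closed
  from r show ?thesis
  proof (cases rule: VR_cases)
    case (add_left a b z)
    then show ?thesis using s VR_intros(1)[of "s \<otimes>\<^bsub>\<U>\<^esub> a" "s \<otimes>\<^bsub>\<U>\<^esub> b"] by (simp add: U.r_distr)
  next
    case (add_right a x y)
    then show ?thesis using s VR_intros(2)[of "s \<otimes>\<^bsub>\<U>\<^esub> a"] by simp
  next
    case (balance a u z)
    then show ?thesis using s VR_intros(3)[of "s \<otimes>\<^bsub>\<U>\<^esub> a" u] by (simp add: U.m_assoc)
  qed
qed

lemma VH_subgroup: "abelian_subgroup (VH lam) (FP lam)"
proof -
  interpret A: abelian_group "FP lam" by (rule abelian_group_FP)
  have "subgroup (VH lam) (add_monoid (FP lam))"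
    unfolding VH_def by (rule A.add.generate_is_subgroup) (simp add: VR_closed)
  then show ?thesis
    by (intro abelian_subgroupI3 additive_subgroup.intro abelian_group_FP)
qed

text \<open>
  Left multiplication maps each of the three kinds of relations to relations of the same kind, so it
  preserves the subgroup.  Additivity in the ring element holds modulo the first kind, pair by pair.
\<close>

lemma quotient_setup_verma: "quotient_setup \<U> (VH lam) (FP lam)"
proof -
  interpret U: ring \<U> by (rule ring_U)
  interpret S: abelian_subgroup "VH lam" "FP lam" by (rule VH_subgroup)
  show "quotient_setup \<U> (VH lam) (FP lam)"
  proof (intro quotient_setup.intro quotient_setup_axioms.intro)
    show "ring \<U>" ..
    show "abelian_subgroup (VH lam) (FP lam)" ..
    show "s \<odot>\<^bsub>FP lam\<^esub> x \<in> carrier (FP lam)" if "s \<in> carrier \<U>" "x \<in> carrier (FP lam)" for s x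
      using that by (rule FP_smult_closed)
    show "s \<odot>\<^bsub>FP lam\<^esub> (x \<oplus>\<^bsub>FP lam\<^esub> y) = s \<odot>\<^bsub>FP lam\<^esub> x \<oplus>\<^bsub>FP lam\<^esub> s \<odot>\<^bsub>FP lam\<^esub> y"
      if "s \<in> carrier \<U>" "x \<in> carrier (FP lam)" "y \<in> carrier (FP lam)" for s x y
      using that by (simp add: FP_add FP_smult_add)
    show "(a \<otimes>\<^bsub>\<U>\<^esub> b) \<odot>\<^bsub>FP lam\<^esub> x = a \<odot>\<^bsub>FP lam\<^esub> (b \<odot>\<^bsub>FP lam\<^esub> x)"
      if ab: "a \<in> carrier \<U>" "b \<in> carrier \<U>" and "x \<in> carrier (FP lam)" for a b x
      using that(3)
      by (induction rule: FP_induct)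
         (use ab in \<open>simp_all add: FP_smult_zero FP_smult_add FP_smult_diff_pair FP_smult_pair' pair_closed'
           FP_smult_closed U.m_assoc\<close>)
    show "\<one>\<^bsub>\<U>\<^esub> \<odot>\<^bsub>FP lam\<^esub> x = x" if "x \<in> carrier (FP lam)" for x
      using that
      by (induction rule: FP_induct)
         (simp_all add: FP_smult_zero FP_smult_add FP_smult_diff_pair FP_smult_pair' pair_closed')
    show "a \<odot>\<^bsub>FP lam\<^esub> x \<in> VH lam" if a: "a \<in> carrier \<U>" and "x \<in> VH lam" for a x
      using that(2) unfolding VH_def
    proof (induction rule: generate.induct)
      case one
      show ?case using generate.one[of "add_monoid (FP lam)"] by (simp add: FP_zero FP_smult_zero)
    next
      case (incl h)
      show ?case using VR_smult[OF a incl] by (rule generate.incl)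
    next
      case (inv h)
      then have h: "h \<in> carrier (FP lam)" using VR_closed by blast
      have "(\<lambda>p. h p + (\<ominus>\<^bsub>FP lam\<^esub> h) p) = (\<lambda>p. 0)" using h by (simp add: FP_minus)
      then have "(\<lambda>p. (a \<odot>\<^bsub>FP lam\<^esub> h) p + (a \<odot>\<^bsub>FP lam\<^esub> (\<ominus>\<^bsub>FP lam\<^esub> h)) p) = (\<lambda>p. 0)"
        using FP_smult_add[OF h S.a_inv_closed[OF h], of a] by (simp add: FP_smult_zero)
      then have "a \<odot>\<^bsub>FP lam\<^esub> (\<ominus>\<^bsub>FP lam\<^esub> h) = (\<lambda>p. - (a \<odot>\<^bsub>FP lam\<^esub> h) p)"
        by (simp add: fun_eq_iff add_eq_0_iff)
      also have "\<dots> = \<ominus>\<^bsub>FP lam\<^esub> (a \<odot>\<^bsub>FP lam\<^esub> h)" using FP_smult_closed[OF a h] by (simp add: FP_minus)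
      finally show ?case using generate.inv[OF VR_smult[OF a inv], of "add_monoid (FP lam)"]
        by (simp add: a_inv_def)
    next
      case (eng x y)
      then have "x \<in> carrier (FP lam)" "y \<in> carrier (FP lam)"
        using S.a_subset unfolding VH_def by blast+
      then have "a \<odot>\<^bsub>FP lam\<^esub> (x \<oplus>\<^bsub>FP lam\<^esub> y) = a \<odot>\<^bsub>FP lam\<^esub> x \<oplus>\<^bsub>FP lam\<^esub> a \<odot>\<^bsub>FP lam\<^esub> y"
        by (simp add: FP_add FP_smult_add)
      then show ?case using generate.eng[OF eng.IH] by simp
    qed
    show "(a \<oplus>\<^bsub>\<U>\<^esub> b) \<odot>\<^bsub>FP lam\<^esub> x \<in> VH lam +>\<^bsub>FP lam\<^esub> (a \<odot>\<^bsub>FP lam\<^esub> x \<oplus>\<^bsub>FP lam\<^esub> b \<odot>\<^bsub>FP lam\<^esub> x)"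
      if ab: "a \<in> carrier \<U>" "b \<in> carrier \<U>" and "x \<in> carrier (FP lam)" for a b x
    proof -
      have VH: "(\<lambda>p. h p + h' p) \<in> VH lam" "(\<lambda>p. h p - h' p) \<in> VH lam" if "h \<in> VH lam" "h' \<in> VH lam" for h h'
      proof -
        note closed = additive_subgroup.a_closed[OF abelian_subgroup.axioms(1)[OF VH_subgroup]]
          and inv = additive_subgroup.a_inv_closed[OF abelian_subgroup.axioms(1)[OF VH_subgroup]]
        have "h' \<in> carrier (FP lam)" using that S.a_subset by blast
        then show "(\<lambda>p. h p + h' p) \<in> VH lam" "(\<lambda>p. h p - h' p) \<in> VH lam"
          using closed[OF that] closed[OF that(1) inv[OF that(2)]] by (simp_all add: FP_add FP_minus)
      qed
      have incl: "(\<lambda>q. pair_gen (a \<otimes>\<^bsub>\<U>\<^esub> u \<oplus>\<^bsub>\<U>\<^esub> b \<otimes>\<^bsub>\<U>\<^esub> u, z) q - pair_gen (a \<otimes>\<^bsub>\<U>\<^esub> u, z) q - pair_gen (b \<otimes>\<^bsub>\<U>\<^esub> u, z) q) \<in> VH lam"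
        if "u \<in> carrier \<U>" for u z
        unfolding VH_def using that ab by (intro generate.incl VR_intros) auto
      have "(\<lambda>p. ((a \<oplus>\<^bsub>\<U>\<^esub> b) \<odot>\<^bsub>FP lam\<^esub> x) p - (a \<odot>\<^bsub>FP lam\<^esub> x) p - (b \<odot>\<^bsub>FP lam\<^esub> x) p) \<in> VH lam"
        using that(3)
      proof (induction rule: FP_induct)
        case zero
        show ?case
          using additive_subgroup.zero_closed[OF abelian_subgroup.axioms(1)[OF VH_subgroup], of lam]
          by (simp add: FP_smult_zero FP_zero)
      next
        case (add u z f)
        from VH(1)[OF add(3) incl[OF add(1), of z]] show ?case
          using add(1,2) ab
          by (simp add: FP_smult_add FP_smult_pair' pair_closed' U.l_distr algebra_simps)
      next
        case (sub u z f)
        from VH(2)[OF sub(3) incl[OF sub(1), of z]] show ?case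
          using sub(1,2) ab
          by (simp add: FP_smult_diff_pair FP_smult_pair' pair_closed' U.l_distr algebra_simps)
      qed
      then show ?thesis
        unfolding a_r_coset_def' FP_add by (rule UN_I) simp
    qed
  qed
qed

lemma verma_eq: "verma lam = quot_module (FP lam) (VH lam)"
  by (simp add: verma_def extend_scalars_def VH_def VR_def)

lemma char_sum_eq_sum: "char_sum lam f * z = (\<Sum>w | f w \<noteq> 0. f w * foldr (one_dim_rep lam) w z)"
proof -
  have "foldr (one_dim_rep lam) w z = (\<Prod>D\<leftarrow>w. lam * poly.coeff (D [:0, 1:]) 1) * z" for w
    by (induction w) (auto simp: one_dim_rep_def)
  then show ?thesis by (simp add: char_sum_def sum_distrib_right mult.assoc)
qed

lemma finsum_complex_line: "finite A \<Longrightarrow> (\<Oplus>\<^bsub>complex_line\<^esub>w\<in>A. f w) = sum f A"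
proof -
  have "\<exists>y. y + x = 0" for x :: complex by (rule exI[of _ "- x"]) simp
  then interpret L: abelian_group complex_line
    by (intro abelian_groupI) (auto simp: complex_line_def)
  have carr: "carrier complex_line = UNIV" and zero: "\<zero>\<^bsub>complex_line\<^esub> = 0"
    and add: "x \<oplus>\<^bsub>complex_line\<^esub> y = x + y" for x y
    by (simp_all add: complex_line_def)
  show "finite A \<Longrightarrow> ?thesis"
    by (induction A rule: finite_induct) (simp_all add: carr zero add L.finsum_insert)
qed

lemma one_dim_act:
  assumes f: "f \<in> carrier (FA borel_fields)"
  shows "ucl borel_fields f \<odot>\<^bsub>one_dim lam\<^esub> z = char_sum lam f * z"
proof -
  interpret I: ideal "UEA_ideal borel" "free_algebra borel"
    unfolding borel_eq_fields by (rule UEA_ideal_ideal) simp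
  have ucl: "ucl borel_fields f = UEA_ideal borel +>\<^bsub>free_algebra borel\<^esub> f"
    by (simp add: ucl_def borel_eq_fields)
  have "(\<Oplus>\<^bsub>complex_line\<^esub>w\<in>{w. g w \<noteq> 0}. g w \<odot>\<^bsub>complex_line\<^esub> foldr (one_dim_rep lam) w z)
      = char_sum lam f * z" if g: "g \<in> ucl borel_fields f" for g
  proof -
    from g obtain h where h: "h \<in> UEA_ideal borel" "g = (\<lambda>w. h w + f w)"
      by (auto simp: ucl a_r_coset_def' free_add)
    note hc = UEA_ideal_borel_char_sum[OF h(1), of lam]
    have fin: "finite {w. h w \<noteq> 0}" "finite {w. f w \<noteq> 0}"
      using hc f by (simp_all add: free_carrier_iff)
    have "finite {w. g w \<noteq> 0}"
      by (rule finite_subset[OF _ finite_UnI[OF fin]]) (auto simp: h(2))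
    moreover have "char_sum lam g = char_sum lam f"
      using hc char_sum_add[OF fin] by (simp add: h(2))
    ultimately show ?thesis
      using char_sum_eq_sum[of lam g z] by (subst finsum_complex_line) (simp_all add: complex_line_def)
  qed
  moreover have "f \<in> ucl borel_fields f"
    unfolding ucl using f by (intro I.a_rcos_self) (simp add: borel_eq_fields)
  ultimately have "(\<lambda>g. \<Oplus>\<^bsub>complex_line\<^esub>w\<in>{w. g w \<noteq> 0}. g w \<odot>\<^bsub>complex_line\<^esub> foldr (one_dim_rep lam) w z)
      ` ucl borel_fields f = {char_sum lam f * z}"
    by (auto intro!: image_eqI)
  then show ?thesis by (simp add: one_dim_def UEA_module_def)
qed

lemma dens_act_borel:
  assumes f: "f \<in> carrier (FA borel_fields)"
  shows "dens.act lam f [:z:] = [:char_sum lam f * z:]"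
proof -
  have dens_const: "dens lam g [:y:] = [:lam * poly.coeff g 1 * y:]" if "poly.coeff g 0 = 0" for g y
    using dens_linear(2)[of lam g y 1] that by (simp add: dens_unit mult.commute)
  have word: "dens.wact lam w [:z:] = [:foldr (one_dim_rep lam) w z:]" if "w \<in> lists (vf ` borel_fields)" for w
    using that
  proof (induction w)
    case (Cons D w)
    then obtain g where g: "D = vf g" "poly.coeff g 0 = 0" by auto
    then show ?case using Cons by (simp add: dens.wact_def dens_const one_dim_rep_def)
  qed (simp add: dens.wact_def)
  have "dens.act lam f [:z:] = (\<Sum>w | f w \<noteq> 0. [:f w * foldr (one_dim_rep lam) w z:])"
    unfolding dens.act_def using f by (intro sum.cong) (auto simp: free_carrier_iff word subset_iff simp del: in_lists_conv_set)
  also have "\<dots> = [:\<Sum>w | f w \<noteq> 0. f w * foldr (one_dim_rep lam) w z:]"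
    by (rule poly_eqI) (simp add: coeff_sum coeff_pCons split: nat.split)
  finally show ?thesis by (simp add: char_sum_eq_sum)
qed

text \<open>
  The constants in the density model form the one-dimensional module of the Borel subalgebra.
  This is what the balancing relations of the tensor product require of \<open>phi\<close> below.
\<close>

lemma borel_acts_on_one_dim:
  assumes "u \<in> carrier (UEA borel)"
  shows "dens.uact lam (UEA_incl witt u) [:z:] = [:u \<odot>\<^bsub>one_dim lam\<^esub> z:]"
proof -
  obtain f where f: "f \<in> carrier (FA borel_fields)" "u = ucl borel_fields f"
    using assms unfolding borel_eq_fields UEA_carrier by blast
  have "f \<in> carrier (free_algebra witt)"
    using free_carrier_mono[of borel_fields UNIV] f(1) by (auto simp: witt_eq_fields)
  moreover have "UEA_incl witt u = ucl UNIV f"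
    using UEA_incl_ucl[of borel_fields UNIV f] f by (simp add: witt_eq_fields)
  ultimately show ?thesis
    using f by (simp add: dens.uact_ucl dens_act_borel one_dim_act)
qed

text \<open>
  The map \<open>s \<otimes> z \<mapsto> s z\<close> from the tensor product to \<open>\<complex>[t]\<close>.  It is what shows that the vectors
  \<open>d_{-1}^k v\<close> of the Verma module are linearly independent.
\<close>

definition phi :: "complex \<Rightarrow> (uwitt \<times> complex \<Rightarrow> int) \<Rightarrow> complex poly"
  where "phi lam f = (\<Sum>p | f p \<noteq> 0. Polynomial.smult (of_int (f p)) (dens.uact lam (fst p) [:snd p:]))"

lemma phi_superset:
  assumes "finite A" "{p. f p \<noteq> 0} \<subseteq> A"
  shows "phi lam f = (\<Sum>p\<in>A. Polynomial.smult (of_int (f p)) (dens.uact lam (fst p) [:snd p:]))"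
  unfolding phi_def by (rule sum.mono_neutral_left) (use assms in auto)

lemma phi_add:
  assumes "f \<in> carrier (FP lam')" "g \<in> carrier (FP lam')"
  shows "phi lam (\<lambda>p. f p + g p) = phi lam f + phi lam g"
proof -
  let ?A = "{w. f w \<noteq> 0} \<union> {w. g w \<noteq> 0}"
  have fin: "finite ?A" using assms by (simp add: FP_carrier)
  have "phi lam (\<lambda>w. f w + g w) = (\<Sum>p\<in>?A. Polynomial.smult (of_int (f p + g p)) (dens.uact lam (fst p) [:snd p:]))"
    using fin by (intro phi_superset) auto
  also have "\<dots> = phi lam f + phi lam g"
    using fin phi_superset[of ?A f lam] phi_superset[of ?A g lam]
    by (simp add: smult_add_left sum.distrib)
  finally show ?thesis .
qed

lemma phi_pair: "phi lam (\<lambda>q. k * pair_gen (u, z) q) = Polynomial.smult (of_int k) (dens.uact lam u [:z:])"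
  by (subst phi_superset[where A = "{(u, z)}"]) (auto simp: pair_gen_def)

lemma phi_pair': "phi lam (pair_gen (u, z)) = dens.uact lam u [:z:]"
  using phi_pair[of lam 1] by simp

lemma phi_diff_pair:
  assumes "f \<in> carrier (FP lam')" "u \<in> carrier \<U>"
  shows "phi lam (\<lambda>p. f p - pair_gen (u, z) p) = phi lam f - dens.uact lam u [:z:]"
  using phi_add[OF assms(1) pair_closed[OF assms(2), of "-1"], of lam z] phi_pair[of lam "-1" u z] by simp

lemma phi_zero: "phi lam (\<lambda>p. 0) = 0"
  by (simp add: phi_def)

lemma phi_act:
  assumes s: "s \<in> carrier \<U>" and f: "f \<in> carrier (FP lam)"
  shows "phi lam (s \<odot>\<^bsub>FP lam\<^esub> f) = dens.uact lam s (phi lam f)"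
proof -
  interpret U: ring \<U> by (rule ring_U)
  have zero: "dens.uact lam s 0 = 0" using dens.uact_linear(2)[OF s, of lam 0 0] by simp
  have diff: "dens.uact lam s (p - q) = dens.uact lam s p - dens.uact lam s q" for p q
    using dens.uact_linear(1)[OF s, of lam "p - q" q] by (simp add: algebra_simps)
  from f show ?thesis
  proof (induction rule: FP_induct)
    case zero
    show ?case by (simp add: FP_smult_zero phi_zero \<open>dens.uact lam s 0 = 0\<close>)
  next
    case (add u z f)
    with s show ?case
      by (simp add: FP_smult_add phi_add[of _ lam] FP_smult_pair' pair_closed' phi_pair' FP_smult_closed
          dens.uact_linear dens.uact_mult)
  next
    case (sub u z f)
    with s show ?case
      by (simp add: FP_smult_diff_pair phi_diff_pair[of _ lam] FP_smult_closed diff dens.uact_mult)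
  qed
qed

lemma phi_VH:
  assumes "h \<in> VH lam"
  shows "phi lam h = 0"
proof -
  interpret U: ring \<U> by (rule ring_U)
  interpret S: abelian_subgroup "VH lam" "FP lam" by (rule VH_subgroup)
  have VR: "phi lam r = 0" if "r \<in> VR lam" for r
    using that
  proof (cases rule: VR_cases)
    case (add_left s t z)
    then show ?thesis
      by (simp add: phi_diff_pair[of _ lam] FP_diff_pair_closed pair_closed' phi_pair' dens.uact_plus)
  next
    case (add_right s x y)
    then show ?thesis
      using dens.uact_linear(1)[of s lam "[:x:]" "[:y:]"]
      by (simp add: phi_diff_pair[of _ lam] FP_diff_pair_closed pair_closed' phi_pair')
  next
    case (balance s u z)
    then show ?thesis
      by (simp add: phi_diff_pair[of _ lam] pair_closed' phi_pair' UEA_incl_closed dens.uact_mult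
          borel_acts_on_one_dim)
  qed
  show ?thesis
    using assms unfolding VH_def
  proof (induction rule: generate.induct)
    case one
    show ?case by (simp add: FP_zero phi_zero)
  next
    case (incl h)
    then show ?case by (rule VR)
  next
    case (inv h)
    then have h: "h \<in> carrier (FP lam)" using VR_closed by blast
    have "(\<lambda>p. h p + (\<ominus>\<^bsub>FP lam\<^esub> h) p) = (\<lambda>p. 0)" using h by (simp add: FP_minus)
    then show ?case
      using phi_add[OF h S.a_inv_closed[OF h], of lam] VR[OF inv] by (simp add: phi_zero a_inv_def)
  next
    case (eng x y)
    then have "x \<in> carrier (FP lam)" "y \<in> carrier (FP lam)"
      using S.a_subset unfolding VH_def by blast+
    then have "phi lam (x \<oplus>\<^bsub>FP lam\<^esub> y) = 0"
      using eng.IH by (simp add: FP_add phi_add[of _ lam])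
    then show ?case by simp
  qed
qed

text \<open>
  The map \<open>p \<mapsto> p(d_{-1}) v\<close> from \<open>\<complex>[t]\<close> onto the Verma module is injective because \<open>phi\<close> is a
  left inverse, and surjective because its image is stable under the enveloping algebra and contains
  the highest weight vector \<open>v\<close>.
\<close>

theorem verma_model_verma: "\<exists>eps. verma_model (verma lam) lam eps"
proof -
  interpret U: ring \<U> by (rule ring_U)
  interpret Q: quotient_setup \<U> "VH lam" "FP lam" by (rule quotient_setup_verma)
  interpret V: umod "verma lam"
    unfolding verma_eq by (intro umod.intro Q.quot_left_module)
  let ?cls = "\<lambda>f. VH lam +>\<^bsub>FP lam\<^esub> f"
  let ?one = "\<one>\<^bsub>\<U>\<^esub>"
  define v where "v = ?cls (pair_gen (?one, 1))"
  have carr: "carrier (verma lam) = ?cls ` carrier (FP lam)"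
    unfolding verma_eq by (rule Q.quot_carrier)
  have v: "v \<in> carrier (verma lam)" unfolding v_def carr by (simp add: pair_closed')
  have cls_act: "u \<odot>\<^bsub>verma lam\<^esub> ?cls f = ?cls (u \<odot>\<^bsub>FP lam\<^esub> f)"
    if "u \<in> carrier \<U>" "f \<in> carrier (FP lam)" for u f
    unfolding verma_eq using that by (rule Q.quot_smult)
  have cls_add: "?cls f \<oplus>\<^bsub>verma lam\<^esub> ?cls g = ?cls (\<lambda>p. f p + g p)"
    if "f \<in> carrier (FP lam)" "g \<in> carrier (FP lam)" for f g
    unfolding verma_eq using Q.quot_add[OF that] by (simp add: FP_add)
  have cls_zero: "?cls (\<lambda>p. 0) = \<zero>\<^bsub>verma lam\<^esub>"
    unfolding verma_eq by (simp add: Q.quot_zero FP_zero)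
  have cls_eq: "?cls f = ?cls g"
    if "f \<in> carrier (FP lam)" "g \<in> carrier (FP lam)" "(\<lambda>p. f p - g p) \<in> VH lam" for f g
  proof (rule Q.coset_eqI)
    show "f \<in> ?cls g" unfolding a_r_coset_def' FP_add using that(3) by (rule UN_I) simp
  qed (use that in simp)
  have scalar: "?cls (pair_gen (?one, z)) = msc (verma lam) z v" for z
  proof -
    have u: "uscal borel_fields z \<in> carrier (UEA borel)" "UEA_incl witt (uscal borel_fields z) = uscal UNIV z"
      using uscal_closed[of borel_fields z] UEA_incl_ucl[of borel_fields UNIV "\<lambda>w. z * word_gen [] w"]
      by (simp_all add: borel_eq_fields witt_eq_fields uscal_def word_gen_closed)
    have "uscal borel_fields z \<odot>\<^bsub>one_dim lam\<^esub> 1 = z"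
      unfolding uscal_def by (subst one_dim_act) (simp_all add: word_gen_closed char_sum_word)
    then have "(\<lambda>q. pair_gen (uscal UNIV z, 1) q - pair_gen (?one, z) q) \<in> VH lam"
      unfolding VH_def using VR_balance[of ?one "uscal borel_fields z" 1 lam] u
      by (intro generate.incl) (simp add: U_scal_closed)
    then have "?cls (pair_gen (uscal UNIV z, 1)) = ?cls (pair_gen (?one, z))"
      by (intro cls_eq) (simp_all add: pair_closed' U_scal_closed)
    then show ?thesis
      unfolding msc_alt v_def
      by (subst cls_act) (simp_all add: U_scal_closed pair_closed' FP_smult_pair')
  qed
  have hw: "mvf (verma lam) (pCons 0 f) v = msc (verma lam) (lam * poly.coeff f 0) v" for f
  proof -
    have u: "ugen borel_fields (pCons 0 f) \<in> carrier (UEA borel)"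
      "UEA_incl witt (ugen borel_fields (pCons 0 f)) = ugen UNIV (pCons 0 f)"
      using ugen_closed[of borel_fields "pCons 0 f"]
        UEA_incl_ucl[of borel_fields UNIV "word_gen [vf (pCons 0 f)]"]
      by (simp_all add: borel_eq_fields witt_eq_fields ugen_def word_gen_closed')
    have "ugen borel_fields (pCons 0 f) \<odot>\<^bsub>one_dim lam\<^esub> 1 = lam * poly.coeff f 0"
      unfolding ugen_def using char_sum_word[of lam 1 "[vf (pCons 0 f)]"]
      by (subst one_dim_act) (simp_all add: word_gen_closed')
    then have "(\<lambda>q. pair_gen (ugen UNIV (pCons 0 f), 1) q - pair_gen (?one, lam * poly.coeff f 0) q) \<in> VH lam"
      unfolding VH_def using VR_balance[of ?one "ugen borel_fields (pCons 0 f)" 1 lam] u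
      by (intro generate.incl) (simp add: U_gen_closed)
    then have "?cls (pair_gen (ugen UNIV (pCons 0 f), 1)) = ?cls (pair_gen (?one, lam * poly.coeff f 0))"
      by (intro cls_eq) (simp_all add: pair_closed' U_gen_closed)
    then show ?thesis
      unfolding mvf_alt scalar[symmetric] unfolding v_def
      by (subst cls_act) (simp_all add: U_gen_closed pair_closed' FP_smult_pair')
  qed
  define eps where "eps p = V.ev p v" for p
  have eps_mvf: "mvf (verma lam) f (eps p) = eps (dens lam f p)" for f p
    unfolding eps_def by (rule V.ev_mvf[OF v hw])
  have eps_act: "\<exists>q. u \<odot>\<^bsub>verma lam\<^esub> eps p = eps q" if "u \<in> carrier \<U>" for u p
    using that
  proof (induction arbitrary: p rule: UEA_witt_induct)
    case (scalar c)
    show ?case using v by (auto simp: eps_def V.ev_smult[symmetric] simp flip: msc_alt)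
  next
    case (add u w)
    then show ?case using v by (simp add: eps_def V.smult_l_distr) (metis V.ev_add[OF v])
  next
    case (mult u w)
    then show ?case using v by (simp add: eps_def V.smult_assoc1) metis
  qed (use eps_mvf in \<open>auto simp flip: mvf_alt\<close>)
  have eps_const: "eps [:z:] = ?cls (pair_gen (?one, z))" for z
    using v by (simp add: eps_def V.ev_pCons scalar)
  have range: "?cls f \<in> range eps" if "f \<in> carrier (FP lam)" for f
    using that
  proof (induction rule: FP_induct)
    case zero
    show ?case unfolding cls_zero eps_def by (rule range_eqI[of _ _ 0]) simp
  next
    case (add u z f)
    have "?cls (pair_gen (u, z)) = u \<odot>\<^bsub>verma lam\<^esub> eps [:z:]"
      using add(1) by (simp add: eps_const cls_act pair_closed' FP_smult_pair')
    with eps_act[OF add(1)] obtain q where q: "?cls (pair_gen (u, z)) = eps q" by metis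
    from add(3) obtain q' where q': "?cls f = eps q'" by blast
    have "?cls (\<lambda>q. f q + pair_gen (u, z) q) = eps (q' + q)"
      using cls_add[OF add(2) pair_closed'[OF add(1), where lam = lam and z = z]]
      unfolding q q' eps_def V.ev_add[OF v] by simp
    then show ?case by simp
  next
    case (sub u z f)
    \<comment> \<open>Subtracting the pair \<open>(u, z)\<close> amounts to adding \<open>(u, -z)\<close>, by the additivity relations for \<open>z + (-z)\<close> and \<open>0 + 0\<close>.\<close>
    have "?cls (pair_gen (u, -z)) = u \<odot>\<^bsub>verma lam\<^esub> eps [:-z:]"
      using sub(1) by (simp add: eps_const cls_act pair_closed' FP_smult_pair')
    with eps_act[OF sub(1)] obtain q where q: "?cls (pair_gen (u, -z)) = eps q" by metis
    from sub(3) obtain q' where q': "?cls f = eps q'" by blast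
    have 0: "(\<lambda>q. pair_gen (u, 0 + 0) q - pair_gen (u, 0) q - pair_gen (u, 0) q) \<in> VH lam"
      unfolding VH_def using sub(1) by (intro generate.incl VR_intros)
    have 1: "(\<lambda>q. pair_gen (u, z + - z) q - pair_gen (u, z) q - pair_gen (u, - z) q) \<in> VH lam"
      unfolding VH_def using sub(1) by (intro generate.incl VR_intros)
    have "(\<lambda>q. (pair_gen (u, z + - z) q - pair_gen (u, z) q - pair_gen (u, - z) q) +
        (pair_gen (u, 0 + 0) q - pair_gen (u, 0) q - pair_gen (u, 0) q)) \<in> VH lam"
      using additive_subgroup.a_closed[OF abelian_subgroup.axioms(1)[OF VH_subgroup] 1 0] by (simp add: FP_add)
    then have "(\<lambda>q. (f q - pair_gen (u, z) q) - (f q + pair_gen (u, - z) q)) \<in> VH lam"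
      by (simp add: algebra_simps)
    then have "?cls (\<lambda>q. f q - pair_gen (u, z) q) = ?cls (\<lambda>q. f q + pair_gen (u, -z) q)"
      using sub by (intro cls_eq FP_diff_pair_closed)
    also have "\<dots> = eps (q' + q)"
      using cls_add[OF sub(2) pair_closed'[OF sub(1), where lam = lam and z = "-z"]]
      unfolding q q' eps_def V.ev_add[OF v] by simp
    finally show ?case by simp
  qed
  have range_eps: "range eps = carrier (verma lam)"
  proof
    show "range eps \<subseteq> carrier (verma lam)" using v by (auto simp: eps_def)
    show "carrier (verma lam) \<subseteq> range eps" unfolding carr using range by blast
  qed
  have phi_eps: "\<exists>f\<in>carrier (FP lam). eps p = ?cls f \<and> phi lam f = p" for p
  proof (induction p)
    case 0
    show ?case
      by (rule bexI[of _ "\<lambda>p. 0"]) (simp_all add: cls_zero eps_def phi_zero FP_carrier)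
  next
    case (pCons a p)
    then obtain f where f: "f \<in> carrier (FP lam)" "eps p = ?cls f" "phi lam f = p" by blast
    let ?g = "ugen UNIV 1 \<odot>\<^bsub>FP lam\<^esub> f"
    have g: "?g \<in> carrier (FP lam)" using f by (simp add: FP_smult_closed U_gen_closed)
    have "eps (pCons a p) = ?cls (pair_gen (?one, a)) \<oplus>\<^bsub>verma lam\<^esub> ?cls ?g"
      using f v by (simp add: eps_def V.ev_pCons scalar mvf_alt cls_act U_gen_closed)
    also have "\<dots> = ?cls (\<lambda>q. pair_gen (?one, a) q + ?g q)"
      using g by (intro cls_add) (simp_all add: pair_closed')
    finally have "eps (pCons a p) = ?cls (\<lambda>q. pair_gen (?one, a) q + ?g q)" .
    moreover have "phi lam (\<lambda>q. pair_gen (?one, a) q + ?g q) = pCons a p"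
      using f g dens.uact_scal[of lam 1]
      by (simp add: phi_add[of _ lam] pair_closed' phi_pair' phi_act U_gen_closed dens.uact_gen mulX_def U_scal_one)
    moreover have "(\<lambda>q. pair_gen (?one, a) q + ?g q) \<in> carrier (FP lam)"
      using abelian_monoid.a_closed[OF abelian_group.axioms(1)[OF abelian_group_FP]
          pair_closed'[OF U.one_closed] g] by (simp add: FP_add)
    ultimately show ?case by blast
  qed
  have "inj eps"
  proof (rule injI)
    fix p q assume eq: "eps p = eps q"
    obtain f g where f: "f \<in> carrier (FP lam)" "eps p = ?cls f" "phi lam f = p"
      and g: "g \<in> carrier (FP lam)" "eps q = ?cls g" "phi lam g = q"
      using phi_eps by meson
    from eq f g have "f \<in> ?cls g" using Q.a_rcos_self[of f] by simp
    then obtain h where h: "h \<in> VH lam" "f = (\<lambda>p. h p + g p)" by (auto simp: a_r_coset_def' FP_add)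
    then have "phi lam f = phi lam g"
      using g Q.a_subset by (simp add: phi_add[of _ lam] subset_iff phi_VH)
    with f g show "p = q" by simp
  qed
  then have "verma_model (verma lam) lam eps"
    using range_eps eps_mvf v
    by (intro verma_model.intro verma_model_axioms.intro V.umod_axioms)
       (auto simp: eps_def V.ev_add V.ev_smult)
  then show ?thesis by blast
qed

section \<open>Extensions defined by cocycles\<close>

text \<open>
  The only operators that are linear in \<open>f\<close>, have the right weight, vanish for \<open>f = 1\<close> and satisfy
  \<open>[t, theta f] = theta f'\<close> are combinations of \<open>t^(n-i) f^(i+1)(-d/dt)\<close>.  The factorials normalize them so that
  \<open>d_i\<close> maps \<open>1\<close> to \<open>x i\<close> times \<open>t^(n-i)\<close>.
\<close>

definition theta :: "nat \<Rightarrow> (nat \<Rightarrow> complex) \<Rightarrow> complex poly \<Rightarrow> complex poly \<Rightarrow> complex poly"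
  where "theta n x f q = (\<Sum>i = 1..n. Polynomial.smult (x i / fact (Suc i))
    ((mulX ^^ (n - i)) (xop ((pderiv ^^ Suc i) f) q)))"

lemma mulX_pow_linear:
  "(mulX ^^ m) (p + q) = (mulX ^^ m) p + (mulX ^^ m) q"
  "(mulX ^^ m) (p - q) = (mulX ^^ m) p - (mulX ^^ m) q"
  "(mulX ^^ m) (Polynomial.smult c p) = Polynomial.smult c ((mulX ^^ m) p)"
  by (induction m) (simp_all add: mulX_linear)

lemma theta_linear:
  "theta n x f (p + q) = theta n x f p + theta n x f q"
  "theta n x f (Polynomial.smult c p) = Polynomial.smult c (theta n x f p)"
  "theta n x (f + g) p = theta n x f p + theta n x g p"
  "theta n x (Polynomial.smult c f) p = Polynomial.smult c (theta n x f p)"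
  unfolding theta_def
  by (simp_all add: xop_add_right xop_smult_right higher_pderiv_add higher_pderiv_smult xop_plus xop_smult
      mulX_pow_linear Polynomial.smult_add_right sum.distrib dens.scale_sum_right mult.commute
      del: funpow.simps fact_Suc)

lemma theta_diff:
  "theta n x f (p - q) = theta n x f p - theta n x f q"
  "theta n x (f - g) p = theta n x f p - theta n x g p"
  using theta_linear(1)[of n x f "p - q" q] theta_linear(3)[of n x "f - g" g p]
  by (simp_all add: algebra_simps)

lemma theta_mulX: "theta n x f (mulX q) = mulX (theta n x f q) - theta n x (pderiv f) q"
proof -
  have "mulX (sum h A) = (\<Sum>a\<in>A. mulX (h a))" for h and A :: "nat set"
    by (induction A rule: infinite_finite_induct) (simp_all add: mulX_linear)
  then show ?thesis
    unfolding theta_def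
    by (simp add: xop_mulX mulX_pow_linear mulX_linear smult_linear_simps sum_subtractf funpow_swap1
        del: funpow.simps)
qed

lemma theta_one_left: "theta n x 1 q = 0"
proof -
  have "(pderiv ^^ Suc i) (1 :: complex poly) = 0" for i
    by (induction i) simp_all
  then show ?thesis
    unfolding theta_def by (simp add: mulX_pow_linear(3)[of _ 0 0, simplified] del: funpow.simps)
qed

lemma theta_X_left: "theta n x (Polynomial.monom 1 1) q = 0"
proof -
  have "(pderiv ^^ Suc i) (Polynomial.monom 1 1 :: complex poly) = 0" if "i \<ge> 1" for i
    using that
  proof (induction i rule: dec_induct)
    case base
    show ?case by (simp add: pderiv_monom monom_0)
  next
    case (step i)
    then show ?case by simp
  qed
  then show ?thesis
    unfolding theta_def by (simp add: mulX_pow_linear(3)[of _ 0 0, simplified] del: funpow.simps)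
qed

lemma mulX_pow_const: "(mulX ^^ m) [:c:] = Polynomial.monom c m"
  by (induction m) (simp_all add: mulX_def monom_0 monom_Suc)

lemma theta_unit: "theta n x f 1 = (\<Sum>i = 1..n. Polynomial.monom (x i * poly.coeff f (Suc i)) (n - i))"
  unfolding theta_def
proof (rule sum.cong[OF refl])
  fix i
  have "poly.coeff ((pderiv ^^ Suc i) f) 0 = fact (Suc i) * poly.coeff f (Suc i)"
    using coeff_higher_pderiv[of "Suc i" f 0] by (simp add: pochhammer_fact del: funpow.simps fact_Suc)
  then show "Polynomial.smult (x i / fact (Suc i)) ((mulX ^^ (n - i)) (xop ((pderiv ^^ Suc i) f) 1))
      = Polynomial.monom (x i * poly.coeff f (Suc i)) (n - i)"
    by (simp add: xop_one mulX_pow_const smult_monom del: funpow.simps fact_Suc)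
qed

text \<open>
  The relation \<open>[d_i, d_j] = (j - i) d_{i+j}\<close>, applied to a vector \<open>v\<close> with \<open>d_i v = x_i t^(n-i)\<close> for
  \<open>i > 0\<close>.
\<close>

definition cocycle :: "complex \<Rightarrow> nat \<Rightarrow> (nat \<Rightarrow> complex) \<Rightarrow> bool"
  where "cocycle lam n x \<longleftrightarrow> x 0 = 0 \<and> (\<forall>i>n. x i = 0) \<and>
    (\<forall>i j. 1 \<le> i \<longrightarrow> i < j \<longrightarrow> i + j \<le> n \<longrightarrow>
       x j * dc lam i (n - j) - x i * dc lam j (n - i) = (of_nat j - of_nat i) * x (i + j))"

lemma theta_monom_unit:
  assumes "x 0 = 0" "\<forall>i>n. x i = 0"
  shows "theta n x (Polynomial.monom 1 (Suc i)) 1 = Polynomial.monom (x i) (n - i)"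
proof -
  have "theta n x (Polynomial.monom 1 (Suc i)) 1 = (\<Sum>j = 1..n. if i = j then Polynomial.monom (x i) (n - i) else 0)"
    unfolding theta_unit by (rule sum.cong) auto
  also have "\<dots> = Polynomial.monom (x i) (n - i)"
    using assms by (cases "i = 0 \<or> i > n") auto
  finally show ?thesis .
qed

text \<open>
  The off-diagonal part of \<open>[f, g] - (f g' - g f')\<close> on \<open>\<complex>[t] \<oplus> \<complex>[t]\<close>.
\<close>

definition cocycle_defect ::
  "complex \<Rightarrow> complex \<Rightarrow> nat \<Rightarrow> (nat \<Rightarrow> complex) \<Rightarrow> complex poly \<Rightarrow> complex poly \<Rightarrow> complex poly \<Rightarrow> complex poly"
  where "cocycle_defect lam mu n x f g q =
    dens lam f (theta n x g q) + theta n x f (dens mu g q)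
    - (dens lam g (theta n x f q) + theta n x g (dens mu f q))
    - theta n x (f * pderiv g - g * pderiv f) q"

lemma dens_diff: "dens lam f (p - q) = dens lam f p - dens lam f q"
  "dens lam (f - g) p = dens lam f p - dens lam g p"
  using dens_linear(1)[of lam f "p - q" q] dens_linear(3)[of lam "f - g" g p]
  by (simp_all add: algebra_simps)

lemma cocycle_defect_linear:
  "cocycle_defect lam mu n x f g (p + q) = cocycle_defect lam mu n x f g p + cocycle_defect lam mu n x f g q"
  "cocycle_defect lam mu n x f g (Polynomial.smult c p) = Polynomial.smult c (cocycle_defect lam mu n x f g p)"
  "cocycle_defect lam mu n x (f + h) g p = cocycle_defect lam mu n x f g p + cocycle_defect lam mu n x h g p"
  "cocycle_defect lam mu n x (Polynomial.smult c f) g p = Polynomial.smult c (cocycle_defect lam mu n x f g p)"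
  by (simp_all add: cocycle_defect_def dens_linear theta_linear theta_diff smult_linear_simps pderiv_add pderiv_smult
      distrib_left distrib_right)

lemma cocycle_defect_swap: "cocycle_defect lam mu n x f g q = - cocycle_defect lam mu n x g f q"
  by (simp add: cocycle_defect_def theta_diff)

lemma cocycle_defect_mulX:
  "cocycle_defect lam mu n x f g (mulX q) = mulX (cocycle_defect lam mu n x f g q)
     - cocycle_defect lam mu n x (pderiv f) g q - cocycle_defect lam mu n x f (pderiv g) q"
  by (simp add: cocycle_defect_def theta_mulX dens_mulX theta_diff dens_diff mulX_linear
      pderiv_diff pderiv_mult theta_linear mult.commute)

lemma poly_linear_induct [case_names zero monom add]:
  assumes "P 0" "\<And>k. P (Polynomial.monom 1 k)" "\<And>c f g. P f \<Longrightarrow> P g \<Longrightarrow> P (Polynomial.smult c f + g)"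
  shows "P (f :: complex poly)"
proof -
  have "P (Polynomial.monom 1 k * f)" for k
  proof (induction f arbitrary: k)
    case (pCons a f)
    have "Polynomial.monom 1 k * pCons a f =
        Polynomial.smult a (Polynomial.monom 1 k) + Polynomial.monom 1 (Suc k) * f"
      by (simp add: monom_Suc monom_altdef mult.commute)
    then show ?case using assms(3)[OF assms(2) pCons.IH] by simp
  qed (use assms(1) in simp)
  from this[of 0] show ?thesis by simp
qed

text \<open>
  The defect \<open>J\<close> satisfies \<open>[t, J(f, g)] = J(f', g) + J(f, g')\<close>, so it vanishes everywhere if it vanishes
  on the vector \<open>1\<close> for all \<open>f\<close>, \<open>g\<close>.  By bilinearity these may be powers of \<open>x\<close>: a power zero is
  \<open>d_{-1}\<close>, which acts by \<open>t\<close>; the first power is \<open>d_0\<close> and uses the weights; the rest is \<open>cocycle\<close>.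
\<close>

lemma cocycle_defect_zero:
  assumes coc: "cocycle lam n x" and wt: "lam - mu = of_nat n \<or> x = (\<lambda>_. 0)"
  shows "cocycle_defect lam mu n x f g q = 0"
proof -
  have x0: "x 0 = 0" and xn: "\<forall>i>n. x i = 0"
    and rel: "\<And>i j. \<lbrakk>1 \<le> i; i < j; i + j \<le> n\<rbrakk> \<Longrightarrow>
       x j * dc lam i (n - j) - x i * dc lam j (n - i) = (of_nat j - of_nat i) * x (i + j)"
    using coc by (auto simp: cocycle_def)
  have zero: "cocycle_defect lam mu n x 0 g q = 0" "cocycle_defect lam mu n x f 0 q = 0" for f g q
    using cocycle_defect_linear(4)[of lam mu n x 0 0 g q] cocycle_defect_swap[of lam mu n x f 0 q]
      cocycle_defect_linear(4)[of lam mu n x 0 0 f q] by simp_all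
  have one: "cocycle_defect lam mu n x 1 g q = 0" for g q
    by (simp add: cocycle_defect_def theta_one_left theta_mulX dens.rho_zero)
  have th: "theta n x (Polynomial.monom 1 (Suc i)) 1 = Polynomial.monom (x i) (n - i)" for i
    using x0 xn by (rule theta_monom_unit)
  have th0: "theta n x f 0 = 0" for f using theta_linear(2)[of n x f 0 0] by simp
  have unit: "dens mu (Polynomial.monom 1 (Suc j)) 1 = Polynomial.smult (if j = 0 then mu else 0) 1" for j
    by (simp add: dens_unit)
  have ordered: "cocycle_defect lam mu n x (Polynomial.monom 1 (Suc i)) (Polynomial.monom 1 (Suc j)) 1 = 0"
    if "i < j" for i j
  proof -
    let ?f = "Polynomial.monom 1 (Suc i) :: complex poly" and ?g = "Polynomial.monom 1 (Suc j) :: complex poly"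
    have brk: "?f * pderiv ?g - ?g * pderiv ?f = Polynomial.smult (of_nat j - of_nat i) (Polynomial.monom 1 (Suc (i + j)))"
      by (simp add: pderiv_monom mult_monom smult_monom add.commute diff_monom)
    have A: "cocycle_defect lam mu n x ?f ?g 1 = dens lam ?f (Polynomial.monom (x j) (n - j))
       - dens lam ?g (Polynomial.monom (x i) (n - i)) - (if i = 0 then Polynomial.smult mu (Polynomial.monom (x j) (n - j)) else 0)
       - Polynomial.smult (of_nat j - of_nat i) (Polynomial.monom (x (i + j)) (n - (i + j)))"
      unfolding cocycle_defect_def brk theta_linear unit th using that by (auto simp: theta_linear th th0)
    show ?thesis
    proof (cases "i + j \<le> n")
      case True
      then have "cocycle_defect lam mu n x ?f ?g 1 = Polynomial.monom
          (x j * dc lam i (n - j) - x i * dc lam j (n - i) - (if i = 0 then mu * x j else 0)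
             - (of_nat j - of_nat i) * x (i + j)) (n - (i + j))"
        unfolding A by (simp add: dens_monom smult_monom diff_monom add.commute)
      also have "x j * dc lam i (n - j) - x i * dc lam j (n - i) - (if i = 0 then mu * x j else 0)
             - (of_nat j - of_nat i) * x (i + j) = 0"
      proof (cases "i = 0")
        case i: True
        have "dc lam 0 (n - j) = lam - of_nat n + of_nat j"
          using True by (simp add: dc_def falling_def of_nat_diff)
        then have "x j * dc lam 0 (n - j) = x j * (lam - of_nat n + of_nat j)"
          by (rule arg_cong)
        also have "\<dots> = x j * (lam - of_nat n) + of_nat j * x j"
          by (simp add: algebra_simps)
        also have "x j * (lam - of_nat n) = mu * x j" using wt by (auto simp: algebra_simps)
        finally show ?thesis using i x0 by simp
      next
        case False
        then show ?thesis using rel[of i j] that True by simp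
      qed
      finally show ?thesis by simp
    next
      case False
      have "dens lam ?f (Polynomial.monom (x j) (n - j)) = 0"
        using False xn by (cases "j > n") (simp_all add: dens.rho_zero dens_monom_zero)
      moreover have "dens lam ?g (Polynomial.monom (x i) (n - i)) = 0"
        using False xn by (cases "i > n") (simp_all add: dens.rho_zero dens_monom_zero)
      ultimately show ?thesis unfolding A using False xn by simp
    qed
  qed
  have self: "cocycle_defect lam mu n x f f q = 0" for f q
    by (simp add: cocycle_defect_def theta_linear(4)[of n x 0 0, simplified])
  have mon: "cocycle_defect lam mu n x (Polynomial.monom 1 a) (Polynomial.monom 1 b) 1 = 0" for a b
  proof (cases a; cases b)
    fix i j assume ab: "a = Suc i" "b = Suc j"
    consider "i < j" | "j < i" | "i = j" by linarith
    then show ?thesis unfolding ab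
      by cases (use ordered[of i j] ordered[of j i] cocycle_defect_swap[of lam mu n x "Polynomial.monom 1 (Suc i)"]
         self in auto)
  qed (use one cocycle_defect_swap[of lam mu n x _ 1] in simp_all)
  have "cocycle_defect lam mu n x f g 1 = 0" for f g
  proof (induction f rule: poly_linear_induct)
    case (monom k)
    show ?case
    proof (induction g rule: poly_linear_induct)
      case (add c f g)
      then show ?case
        using cocycle_defect_linear(3,4)[of lam mu n x] cocycle_defect_swap[of lam mu n x "Polynomial.monom 1 k"]
        by simp
    qed (use zero mon in simp_all)
  qed (simp_all add: zero cocycle_defect_linear)
  moreover have "cocycle_defect lam mu n x f g (pCons a q) =
      Polynomial.smult a (cocycle_defect lam mu n x f g 1) + cocycle_defect lam mu n x f g (mulX q)" for f g a q
    by (simp add: cocycle_defect_linear[symmetric] mulX_def)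
  ultimately show ?thesis
  proof (induction q arbitrary: f g)
    case 0
    show ?case by (simp add: cocycle_defect_def th0 dens.rho_zero)
  next
    case (pCons a q)
    then show ?case by (simp add: cocycle_defect_mulX mulX_linear)
  qed
qed

definition scale2 :: "complex \<Rightarrow> complex poly \<times> complex poly \<Rightarrow> complex poly \<times> complex poly"
  where "scale2 c v = (Polynomial.smult c (fst v), Polynomial.smult c (snd v))"

definition ext_op :: "complex \<Rightarrow> complex \<Rightarrow> nat \<Rightarrow> (nat \<Rightarrow> complex) \<Rightarrow> complex poly \<Rightarrow>
    complex poly \<times> complex poly \<Rightarrow> complex poly \<times> complex poly"
  where "ext_op lam mu n x f v = (dens lam f (fst v) + theta n x f (snd v), dens mu f (snd v))"

lemma vector_space_scale2: "vector_space scale2"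
  by unfold_locales (simp_all add: scale2_def smult_add_left Polynomial.smult_add_right prod_eq_iff)

lemma witt_rep_ext:
  assumes "cocycle lam n x" "lam - mu = of_nat n \<or> x = (\<lambda>_. 0)"
  shows "witt_rep scale2 (ext_op lam mu n x)"
proof (intro witt_rep.intro vector_space_scale2 witt_rep_axioms.intro)
  fix f g v
  show "ext_op lam mu n x f (ext_op lam mu n x g v) - ext_op lam mu n x g (ext_op lam mu n x f v)
      = ext_op lam mu n x (f * pderiv g - g * pderiv f) v"
    using cocycle_defect_zero[OF assms, of f g "snd v"] dens_bracket[of lam f g "fst v"] dens_bracket[of mu f g "snd v"]
    by (simp add: prod_eq_iff ext_op_def cocycle_defect_def dens_linear algebra_simps)
qed (simp_all add: ext_op_def scale2_def dens_linear theta_linear prod_eq_iff Polynomial.smult_add_right algebra_simps)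

section \<open>Membership in category O\<close>

lemma coeff_dens_X: "poly.coeff (dens lam (Polynomial.monom 1 1) p) k = (lam - of_nat k) * poly.coeff p k"
proof -
  have "dens lam (Polynomial.monom 1 1) p = Polynomial.smult lam p - mulX (pderiv p)"
    by (simp add: dens_def monom_Suc monom_0 xop_pCons pderiv_pCons mulX_linear)
  then show ?thesis
    by (cases k) (simp_all only: mulX_def coeff_pCons_0 coeff_pCons_Suc coeff_pderiv coeff_diff coeff_smult,
        simp_all add: algebra_simps)
qed

definition wt_part :: "complex \<Rightarrow> complex \<Rightarrow> complex poly \<Rightarrow> complex poly"
  where "wt_part lam c p = (\<Sum>k\<le>degree p. if lam - of_nat k = c then Polynomial.monom (poly.coeff p k) k else 0)"

lemma coeff_wt_part: "poly.coeff (wt_part lam c p) k = (if lam - of_nat k = c then poly.coeff p k else 0)"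
proof -
  have "poly.coeff (wt_part lam c p) k =
      (\<Sum>j\<le>degree p. if j = k then (if lam - of_nat k = c then poly.coeff p k else 0) else 0)"
    unfolding wt_part_def coeff_sum by (rule sum.cong) (auto simp: coeff_monom)
  also have "\<dots> = (if lam - of_nat k = c then poly.coeff p k else 0)"
    by (auto simp: coeff_eq_0)
  finally show ?thesis .
qed

lemma wt_part_nonzero: "wt_part lam c p \<noteq> 0 \<Longrightarrow> c \<in> (\<lambda>k. lam - of_nat k) ` {..degree p}"
  by (rule ccontr) (auto simp: wt_part_def image_iff intro!: sum.neutral)

lemma degree_pderiv_le: "degree (pderiv p) \<le> degree (p :: complex poly)"
  by (simp add: degree_pderiv)

lemma degree_xop: "degree (xop f p) \<le> degree p"
proof (induction f)
  case (pCons a f)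
  have "degree (Polynomial.smult a p - pderiv (xop f p)) \<le> degree p"
    by (rule degree_diff_le) (use pCons degree_pderiv_le[of "xop f p"] in \<open>auto intro: order_trans\<close>)
  then show ?case by (simp add: xop_pCons)
qed simp

lemma degree_mulX_pderiv: "degree (mulX (pderiv p)) \<le> degree p"
proof (cases "pderiv p = 0")
  case False
  then have "degree p \<noteq> 0" by (simp add: pderiv_eq_0_iff)
  then show ?thesis using False by (simp add: mulX_def degree_pderiv)
qed (simp add: mulX_linear)

text \<open>
  The reason for local finiteness over \<open>W^+\<close>: if \<open>f\<close> vanishes at the origin, then \<open>f(-d/dt)\<close> lowers
  the degree, which makes up for the factor \<open>t\<close>.
\<close>

lemma degree_dens:
  assumes "poly.coeff f 0 = 0"
  shows "degree (dens lam f p) \<le> degree p"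
proof -
  obtain g where f: "f = pCons 0 g" using assms by (cases f) auto
  have "degree (mulX (xop f p)) \<le> degree p"
    using order_trans[OF degree_mulX_pderiv degree_xop, of g p]
    by (simp add: f xop_pCons mulX_linear)
  then show ?thesis
    unfolding dens_def
    by (intro degree_add_le) (simp_all add: degree_xop)
qed

lemma degree_theta: "degree (theta n x f q) \<le> n + degree q"
proof -
  have "degree ((mulX ^^ m) p) \<le> m + degree p" for m p
  proof (induction m)
    case (Suc m)
    then show ?case
      using degree_pCons_le[of 0 "(mulX ^^ m) p"] by (simp add: mulX_def)
  qed simp
  then have "degree ((mulX ^^ (n - i)) (xop ((pderiv ^^ Suc i) f) q)) \<le> n + degree q" for i
    using degree_xop[of "(pderiv ^^ Suc i) f" q] by (meson add_mono diff_le_self le_trans)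
  then show ?thesis unfolding theta_def
    by (intro degree_sum_le) (auto intro: order_trans[OF degree_smult_le] simp del: funpow.simps fact_Suc)
qed

text \<open>
  The extension defined by a cocycle.  The zero cocycle, which gives the split extension, is admitted
  for every pair of weights.
\<close>

locale model_ext =
  fixes lam mu :: complex and n :: nat and x :: "nat \<Rightarrow> complex"
    and enc :: "complex poly \<times> complex poly \<Rightarrow> 'k"
  assumes cocycle: "cocycle lam n x"
    and weights: "lam - mu = of_nat n \<or> x = (\<lambda>_. 0)"
    and inj_enc: "inj enc"

sublocale model_ext \<subseteq> witt_rep scale2 "ext_op lam mu n x"
  using cocycle weights by (rule witt_rep_ext)

sublocale model_ext \<subseteq> K: umod "rep_module enc"
  using inj_enc by (rule umod_rep)

context model_ext
begin

abbreviation "K \<equiv> rep_module enc"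

lemma K_carrier: "carrier K = range enc"
  and K_zero: "\<zero>\<^bsub>K\<^esub> = enc 0"
  and K_add: "enc v \<oplus>\<^bsub>K\<^esub> enc w = enc (v + w)"
  and K_smult: "u \<odot>\<^bsub>K\<^esub> enc v = enc (uact u v)"
  and K_msc: "msc K c (enc v) = enc (scale2 c v)"
  and K_mvf: "mvf K f (enc v) = enc (ext_op lam mu n x f v)"
  using inj_enc by (rule rep_carrier rep_zero rep_add rep_smult rep_msc rep_mvf)+

lemma K_sum: "finite A \<Longrightarrow> (\<Oplus>\<^bsub>K\<^esub>c\<in>A. enc (g c)) = enc (sum g A)"
proof (induction A rule: finite_induct)
  case empty
  then show ?case by (simp add: K_zero)
next
  case (insert a A)
  then show ?case by (simp add: K.M.finsum_insert Pi_def K_carrier K_add)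
qed

lemma fin_generated_K: "fin_generated \<U> K"
proof -
  let ?S = "{enc (1, 0), enc (0, 1)}"
  have carr: "submodule (carrier K) \<U> K"
    by (intro submodule.intro submodule_axioms.intro K.M.add.subgroup_self) (simp_all add: K.smult_closed)
  have "enc (p, q) \<in> H" if H: "submodule H \<U> K" and S: "?S \<subseteq> H" for H p q
  proof -
    interpret H: submodule H \<U> K by (rule H)
    have add: "enc (v + w) \<in> H" if "enc v \<in> H" "enc w \<in> H" for v w
      using H.m_closed[OF that] by (simp add: K_add)
    have sc: "enc (scale2 c v) \<in> H" if "enc v \<in> H" for c v
      using H.smult_closed[OF U_scal_closed that] by (simp add: K_msc flip: msc_alt)
    have shift: "enc (ext_op lam mu n x 1 v) \<in> H" if "enc v \<in> H" for v
      using H.smult_closed[OF U_gen_closed that] by (simp add: K_mvf flip: mvf_alt)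
    have "enc (p, 0) \<in> H" for p
    proof (induction p)
      case 0
      show ?case using sc[of "(1, 0)" 0] S by (simp add: scale2_def zero_prod_def)
    next
      case (pCons a p)
      from add[OF sc[of "(1, 0)" a] shift[OF pCons.IH]] S show ?case
        by (simp add: scale2_def ext_op_def mulX_def theta_one_left)
    qed
    moreover have "enc (0, q) \<in> H" for q
    proof (induction q)
      case 0
      show ?case using sc[of "(0, 1)" 0] S by (simp add: scale2_def zero_prod_def)
    next
      case (pCons a p)
      from add[OF sc[of "(0, 1)" a] shift[OF pCons.IH]] S show ?case
        by (simp add: scale2_def ext_op_def mulX_def theta_one_left mulX_linear)
    qed
    ultimately show ?thesis using add[of "(p, 0)" "(0, q)"] by simp
  qed
  then have "gen_submodule \<U> K ?S = carrier K"
    unfolding gen_submodule_def using carr by (auto simp: K_carrier)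
  then show ?thesis unfolding fin_generated_def
    by (intro exI[of _ ?S]) (simp add: K_carrier)
qed

lemma weight_space_K:
  "enc w \<in> weight_space K c \<longleftrightarrow>
    (\<forall>k. (lam - of_nat k - c) * poly.coeff (fst w) k = 0 \<and> (mu - of_nat k - c) * poly.coeff (snd w) k = 0)"
proof -
  have "dd 0 = vf (Polynomial.monom 1 1)" by (simp add: dd_vf)
  then have "enc w \<in> weight_space K c \<longleftrightarrow> mvf K (Polynomial.monom 1 1) (enc w) = msc K c (enc w)"
    by (simp add: weight_space_def K_carrier mvf_def msc_def)
  also have "\<dots> \<longleftrightarrow> ext_op lam mu n x (Polynomial.monom 1 1) w = scale2 c w"
    using inj_enc by (simp add: K_mvf K_msc inj_eq)
  also have "\<dots> \<longleftrightarrow> (\<forall>k. (lam - of_nat k) * poly.coeff (fst w) k = c * poly.coeff (fst w) k \<and>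
      (mu - of_nat k) * poly.coeff (snd w) k = c * poly.coeff (snd w) k)"
    unfolding ext_op_def scale2_def theta_X_left prod_eq_iff poly_eq_iff
    by (simp add: coeff_dens_X all_conj_distrib del: One_nat_def)
  finally show ?thesis by (simp add: left_diff_distrib)
qed

text \<open>
  The field \<open>d_0\<close> is diagonal in the monomials of both summands, so the components of a vector
  in a weight decomposition are forced coefficient by coefficient.
\<close>

lemma weight_module_K: "weight_module K"
  unfolding weight_module_def
proof
  fix v assume "v \<in> carrier K"
  then obtain p q where v: "v = enc (p, q)" by (auto simp: K_carrier)
  define g where "g c = (wt_part lam c p, wt_part mu c q)" for c
  have gw: "enc (g c) \<in> weight_space K c" for c
    unfolding weight_space_K by (simp add: g_def coeff_wt_part)
  have "{c. enc (g c) \<noteq> \<zero>\<^bsub>K\<^esub>} \<subseteq> (\<lambda>k. lam - of_nat k) ` {..degree p} \<union> (\<lambda>k. mu - of_nat k) ` {..degree q}"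
  proof
    fix c assume "c \<in> {c. enc (g c) \<noteq> \<zero>\<^bsub>K\<^esub>}"
    then have "g c \<noteq> 0" by (auto simp: K_zero)
    then have "wt_part lam c p \<noteq> 0 \<or> wt_part mu c q \<noteq> 0" by (auto simp: g_def zero_prod_def)
    then show "c \<in> (\<lambda>k. lam - of_nat k) ` {..degree p} \<union> (\<lambda>k. mu - of_nat k) ` {..degree q}"
      using wt_part_nonzero by blast
  qed
  then have fin: "finite {c. enc (g c) \<noteq> \<zero>\<^bsub>K\<^esub>}" by (rule finite_subset) simp
  have coeffs: "poly.coeff (fst (h c)) k = (if lam - of_nat k = c then poly.coeff p k else 0)"
    "poly.coeff (snd (h c)) k = (if mu - of_nat k = c then poly.coeff q k else 0)"
    if hw: "\<forall>c. enc (h c) \<in> weight_space K c" and hf: "finite {c. enc (h c) \<noteq> \<zero>\<^bsub>K\<^esub>}"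
      and hs: "v = (\<Oplus>\<^bsub>K\<^esub>c\<in>{c. enc (h c) \<noteq> \<zero>\<^bsub>K\<^esub>}. enc (h c))" for h c k
  proof -
    let ?A = "{c. enc (h c) \<noteq> \<zero>\<^bsub>K\<^esub>}"
    have A: "h c = 0" if "c \<notin> ?A" for c
      using that inj_enc by (simp add: K_zero inj_eq)
    have off: "poly.coeff (fst (h c)) k = 0" if "lam - of_nat k \<noteq> c" for c k
      using hw that unfolding weight_space_K by force
    have off': "poly.coeff (snd (h c)) k = 0" if "mu - of_nat k \<noteq> c" for c k
      using hw that unfolding weight_space_K by force
    have "enc (p, q) = enc (sum h ?A)" using hs K_sum[OF hf, of h] v by simp
    then have eq: "(p, q) = sum h ?A" using inj_enc by (simp add: inj_eq)
    have "poly.coeff p k = (\<Sum>c\<in>?A. poly.coeff (fst (h c)) k)"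
      using arg_cong[OF eq, of fst] by (simp add: fst_sum coeff_sum)
    also have "\<dots> = (\<Sum>c\<in>?A. if c = lam - of_nat k then poly.coeff (fst (h (lam - of_nat k))) k else 0)"
      using off by (intro sum.cong) auto
    also have "\<dots> = poly.coeff (fst (h (lam - of_nat k))) k"
      using hf A[of "lam - of_nat k"] by auto
    finally show "poly.coeff (fst (h c)) k = (if lam - of_nat k = c then poly.coeff p k else 0)"
      using off by auto
    have "poly.coeff q k = (\<Sum>c\<in>?A. poly.coeff (snd (h c)) k)"
      using arg_cong[OF eq, of snd] by (simp add: snd_sum coeff_sum)
    also have "\<dots> = (\<Sum>c\<in>?A. if c = mu - of_nat k then poly.coeff (snd (h (mu - of_nat k))) k else 0)"
      using off' by (intro sum.cong) auto
    also have "\<dots> = poly.coeff (snd (h (mu - of_nat k))) k"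
      using hf A[of "mu - of_nat k"] by auto
    finally show "poly.coeff (snd (h c)) k = (if mu - of_nat k = c then poly.coeff q k else 0)"
      using off' by auto
  qed
  show "\<exists>!f. (\<forall>c. f c \<in> weight_space K c) \<and> finite {c. f c \<noteq> \<zero>\<^bsub>K\<^esub>} \<and>
       v = (\<Oplus>\<^bsub>K\<^esub>c\<in>{c. f c \<noteq> \<zero>\<^bsub>K\<^esub>}. f c)"
  proof (rule ex1I[of _ "\<lambda>c. enc (g c)"], intro conjI allI)
    let ?A = "{c. enc (g c) \<noteq> \<zero>\<^bsub>K\<^esub>}"
    have A: "g c = 0" if "c \<notin> ?A" for c
      using that inj_enc by (simp add: K_zero inj_eq)
    have "fst (sum g ?A) = p"
    proof (rule poly_eqI)
      fix k
      have "poly.coeff (fst (sum g ?A)) k = (\<Sum>c\<in>?A. if c = lam - of_nat k then poly.coeff p k else 0)"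
        unfolding fst_sum coeff_sum by (rule sum.cong) (auto simp: g_def coeff_wt_part)
      also have "\<dots> = poly.coeff p k"
        using fin A[of "lam - of_nat k"] coeff_wt_part[of lam "lam - of_nat k" p k]
        by (auto simp: g_def zero_prod_def)
      finally show "poly.coeff (fst (sum g ?A)) k = poly.coeff p k" .
    qed
    moreover have "snd (sum g ?A) = q"
    proof (rule poly_eqI)
      fix k
      have "poly.coeff (snd (sum g ?A)) k = (\<Sum>c\<in>?A. if c = mu - of_nat k then poly.coeff q k else 0)"
        unfolding snd_sum coeff_sum by (rule sum.cong) (auto simp: g_def coeff_wt_part)
      also have "\<dots> = poly.coeff q k"
        using fin A[of "mu - of_nat k"] coeff_wt_part[of mu "mu - of_nat k" q k]
        by (auto simp: g_def zero_prod_def)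
      finally show "poly.coeff (snd (sum g ?A)) k = poly.coeff q k" .
    qed
    ultimately show "v = (\<Oplus>\<^bsub>K\<^esub>c\<in>?A. enc (g c))"
      using K_sum[OF fin, of g] v by (metis prod.collapse)
  next
    fix f assume f: "(\<forall>c. f c \<in> weight_space K c) \<and> finite {c. f c \<noteq> \<zero>\<^bsub>K\<^esub>} \<and>
       v = (\<Oplus>\<^bsub>K\<^esub>c\<in>{c. f c \<noteq> \<zero>\<^bsub>K\<^esub>}. f c)"
    then have "\<forall>c. f c \<in> range enc" by (auto simp: weight_space_def K_carrier)
    then have "\<forall>c. \<exists>w. f c = enc w" by blast
    from choice[OF this] obtain h where h: "f = (\<lambda>c. enc (h c))" by auto
    have "h c = g c" for c
      using coeffs[of h c] f unfolding h by (intro prod_eqI poly_eqI) (simp_all add: g_def coeff_wt_part)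
    then show "f = (\<lambda>c. enc (g c))" by (simp add: h)
  qed (use gw fin in auto)
qed

abbreviation "pos_fields \<equiv> {f :: complex poly. poly.coeff f 0 = 0 \<and> poly.coeff f 1 = 0}"

text \<open>
  The orbit of a vector under the enveloping algebra of \<open>W^+\<close> is a subspace of vectors of bounded degree, hence spanned
  by a finite part of itself.
\<close>

lemma locally_finite_K: "locally_finite K"
  unfolding locally_finite_def
proof
  fix v assume "v \<in> carrier K"
  then obtain w where w: "v = enc w" by (auto simp: K_carrier)
  interpret F: ring "FA pos_fields" by (rule ring_free_algebra)
  let ?Y = "(\<lambda>f. act f w) ` carrier (FA pos_fields)"
  have orbit: "(\<lambda>C. UEA_incl witt C \<odot>\<^bsub>K\<^esub> v) ` carrier (UEA witt_pos) = enc ` ?Y"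
  proof -
    have "UEA_incl witt (ucl pos_fields f) \<odot>\<^bsub>K\<^esub> v = enc (act f w)" if "f \<in> carrier (FA pos_fields)" for f
    proof -
      have "f \<in> carrier (free_algebra witt)"
        using that free_carrier_mono[of pos_fields UNIV] unfolding witt_eq_fields by blast
      moreover have "UEA_incl witt (ucl pos_fields f) = ucl UNIV f"
        unfolding witt_eq_fields
        by (rule UEA_incl_ucl[OF field_algebra_pos field_algebra_UNIV subset_UNIV that])
      ultimately show ?thesis by (simp only: w K_smult uact_ucl)
    qed
    then show ?thesis
      unfolding witt_pos_eq_fields UEA_carrier image_image by (intro image_cong) simp_all
  qed
  have sub: "subspace ?Y"
  proof (rule subspaceI)
    have "(\<lambda>w. 0) \<in> carrier (FA pos_fields)" using F.zero_closed by (simp only: free_zero)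
    then show "0 \<in> ?Y" using act_zero_left[of w] by (intro image_eqI[where x = "\<lambda>w. 0"]) (simp_all only:)
  next
    fix a b assume "a \<in> ?Y" "b \<in> ?Y"
    then obtain f g where fg: "f \<in> carrier (FA pos_fields)" "a = act f w" "g \<in> carrier (FA pos_fields)" "b = act g w"
      by blast
    have "(\<lambda>w. f w + g w) \<in> carrier (FA pos_fields)"
      using F.a_closed[OF fg(1,3)] by (simp only: free_add)
    moreover have "a + b = act (\<lambda>w. f w + g w) w" using fg by (simp only: act_plus)
    ultimately show "a + b \<in> ?Y" by blast
  next
    fix c a assume "a \<in> ?Y"
    then obtain f where f: "f \<in> carrier (FA pos_fields)" "a = act f w" by auto
    have c: "(\<lambda>x. c * word_gen [] x) \<in> carrier (FA pos_fields)" by (simp add: word_gen_closed)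
    have "scale2 c a = act ((\<lambda>x. c * word_gen [] x) \<otimes>\<^bsub>FA pos_fields\<^esub> f) w"
      using f c by (simp add: act_mult act_word wact_def)
    then show "scale2 c a \<in> ?Y" using F.m_closed[OF c f(1)] by blast
  qed
  define d where "d = max (degree (fst w)) (n + degree (snd w))"
  let ?T = "(\<lambda>k. (Polynomial.monom 1 k, 0 :: complex poly)) ` {..d} \<union> (\<lambda>k. (0 :: complex poly, Polynomial.monom 1 k)) ` {..d}"
  have T: "y \<in> span ?T" if "degree (fst y) \<le> d" "degree (snd y) \<le> d" for y
  proof -
    have "(Polynomial.monom c k, 0) \<in> span ?T" "(0, Polynomial.monom c k) \<in> span ?T" if "k \<le> d" for c k
      using span_scale[OF span_base, of "(Polynomial.monom 1 k, 0)" ?T c]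
        span_scale[OF span_base, of "(0, Polynomial.monom 1 k)" ?T c] that
      by (auto simp: scale2_def smult_monom)
    then have "(\<Sum>k\<le>d. (Polynomial.monom (poly.coeff (fst y) k) k, 0)) +
        (\<Sum>k\<le>d. (0, Polynomial.monom (poly.coeff (snd y) k) k)) \<in> span ?T"
      by (intro span_add span_sum) auto
    moreover have "(\<Sum>k\<le>d. (Polynomial.monom (poly.coeff (fst y) k) k, 0)) +
        (\<Sum>k\<le>d. (0, Polynomial.monom (poly.coeff (snd y) k) k)) = y"
      using poly_as_sum_of_monoms'[OF that(1)] poly_as_sum_of_monoms'[OF that(2)]
      by (simp add: prod_eq_iff fst_sum snd_sum)
    ultimately show ?thesis by simp
  qed
  have "?Y \<subseteq> span ?T"
  proof -
    have "degree (snd (wact u w)) \<le> degree (snd w) \<and> degree (fst (wact u w)) \<le> d" if "u \<in> lists (vf ` pos_fields)" for u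
      using that
    proof (induction u)
      case Nil
      show ?case by (simp add: wact_def d_def)
    next
      case (Cons D u)
      then obtain f where f: "D = vf f" "poly.coeff f 0 = 0" by auto
      have u: "degree (snd (wact u w)) \<le> degree (snd w)" "degree (fst (wact u w)) \<le> d" using Cons by auto
      have 1: "degree (dens lam f (fst (wact u w))) \<le> d" using degree_dens[OF f(2), of lam "fst (wact u w)"] u by simp
      have 2: "degree (theta n x f (snd (wact u w))) \<le> d"
        using degree_theta[of n x f "snd (wact u w)"] u by (simp add: d_def)
      have "wact (D # u) w = ext_op lam mu n x f (wact u w)" by (simp add: wact_def f)
      also have "\<dots> = (dens lam f (fst (wact u w)) + theta n x f (snd (wact u w)), dens mu f (snd (wact u w)))"
        by (rule ext_op_def)
      finally show ?case
        using degree_dens[OF f(2), of mu "snd (wact u w)"] u degree_add_le[OF 1 2] by simp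
    qed
    note bound = this
    have w_bound: "degree (snd w) \<le> d" by (simp add: d_def)
    have "wact u w \<in> span ?T" if "u \<in> lists (vf ` pos_fields)" for u
    proof (rule T)
      show "degree (fst (wact u w)) \<le> d" "degree (snd (wact u w)) \<le> d"
        using bound[OF that] w_bound by linarith+
    qed
    then have "act f w \<in> span ?T" if "f \<in> carrier (FA pos_fields)" for f
      unfolding act_def using that
      by (intro span_sum span_scale) (auto simp: free_carrier_iff subset_iff simp del: in_lists_conv_set)
    then show ?thesis by blast
  qed
  obtain B where B: "B \<subseteq> ?Y" "independent B" "?Y \<subseteq> span B" "card B = dim ?Y" by (rule basis_exists)
  have "finite B"
    using independent_span_bound[of ?T B] B \<open>?Y \<subseteq> span ?T\<close> by auto
  let ?K = "(restrict_scalars (UEA_scalar witt) K) \<lparr>carrier := enc ` ?Y\<rparr>"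
  have K': "carrier ?K = enc ` ?Y" "\<zero>\<^bsub>?K\<^esub> = enc 0" "enc a \<oplus>\<^bsub>?K\<^esub> enc b = enc (a + b)"
    "c \<odot>\<^bsub>?K\<^esub> enc a = enc (scale2 c a)" for a b c
    using K_msc[of c a] by (simp_all add: restrict_scalars_def K_zero K_add msc_def)
  have "abelian_group ?K"
  proof (rule abelian_groupI)
    fix a assume "a \<in> carrier ?K"
    then obtain y where y: "y \<in> ?Y" "a = enc y" unfolding K' by blast
    then have "- y \<in> ?Y" using subspace_neg[OF sub] by blast
    then show "\<exists>b\<in>carrier ?K. b \<oplus>\<^bsub>?K\<^esub> a = \<zero>\<^bsub>?K\<^esub>"
      using y unfolding K'(1) by (intro bexI[of _ "enc (- y)"]) (simp_all only: y(2) K' add.left_inverse image_eqI)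
  next
    fix a b c assume "a \<in> carrier ?K" "b \<in> carrier ?K" "c \<in> carrier ?K"
    then obtain a' b' c' where "a = enc a'" "b = enc b'" "c = enc c'" unfolding K' by blast
    then show "a \<oplus>\<^bsub>?K\<^esub> b \<oplus>\<^bsub>?K\<^esub> c = a \<oplus>\<^bsub>?K\<^esub> (b \<oplus>\<^bsub>?K\<^esub> c)" by (simp only: K' add.assoc)
  next
    fix a b assume "a \<in> carrier ?K" "b \<in> carrier ?K"
    then obtain a' b' where ab: "a = enc a'" "b = enc b'" "a' \<in> ?Y" "b' \<in> ?Y" unfolding K' by blast
    show "a \<oplus>\<^bsub>?K\<^esub> b = b \<oplus>\<^bsub>?K\<^esub> a" unfolding ab K' by (simp only: add.commute)
    show "a \<oplus>\<^bsub>?K\<^esub> b \<in> carrier ?K" unfolding ab K' using subspace_add[OF sub ab(3,4)] by blast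
  next
    fix a assume "a \<in> carrier ?K"
    then obtain a' where "a = enc a'" unfolding K' by blast
    then show "\<zero>\<^bsub>?K\<^esub> \<oplus>\<^bsub>?K\<^esub> a = a" by (simp only: K' add_0)
  next
    show "\<zero>\<^bsub>?K\<^esub> \<in> carrier ?K" unfolding K' using subspace_0[OF sub] by blast
  qed
  then interpret K': abelian_group ?K .
  have "gen_submodule \<C> ?K (enc ` B) = carrier ?K"
  proof
    have "submodule (carrier ?K) \<C> ?K"
    proof (intro submodule.intro submodule_axioms.intro)
      show "subgroup (carrier ?K) (add_monoid ?K)" using K'.add.subgroup_self by simp
      fix c a assume "a \<in> carrier ?K"
      then obtain a' where "a = enc a'" "a' \<in> ?Y" unfolding K' by blast
      then show "c \<odot>\<^bsub>?K\<^esub> a \<in> carrier ?K" unfolding K'(1) using subspace_scale[OF sub] by (simp only: K') blast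
    qed
    moreover have "enc ` B \<subseteq> carrier ?K" unfolding K'(1) using B(1) by (rule image_mono)
    ultimately show "gen_submodule \<C> ?K (enc ` B) \<subseteq> carrier ?K"
      unfolding gen_submodule_def by blast
    have "carrier ?K \<subseteq> H" if H: "submodule H \<C> ?K" "enc ` B \<subseteq> H" for H
    proof -
      have "enc y \<in> H" if "y \<in> span B" for y
        using that
      proof (induction rule: span_induct_alt)
        case base
        show ?case using H(1)[THEN submodule.axioms(1), THEN subgroup.one_closed] by (simp add: K'(2)[simplified])
      next
        case (step c a y)
        have "c \<odot>\<^bsub>?K\<^esub> enc a \<in> H"
          using H step by (intro submodule.smult_closed[OF H(1)]) (auto simp: ring_of_type_algebra_def)
        then have "enc (scale2 c a) \<oplus>\<^bsub>?K\<^esub> enc y \<in> H"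
          using subgroup.m_closed[OF H(1)[THEN submodule.axioms(1)], of "enc (scale2 c a)" "enc y"] step(2)
          unfolding K'(4) by simp
        then show ?case unfolding K'(3) .
      qed
      then show ?thesis using B(3) unfolding K'(1) by blast
    qed
    then show "carrier ?K \<subseteq> gen_submodule \<C> ?K (enc ` B)" unfolding gen_submodule_def by blast
  qed
  then show "fin_generated \<C> ((restrict_scalars (UEA_scalar witt) K)
      \<lparr>carrier := (\<lambda>C. UEA_incl witt C \<odot>\<^bsub>K\<^esub> v) ` carrier (UEA witt_pos)\<rparr>)"
    unfolding orbit fin_generated_def using \<open>finite B\<close> image_mono[OF B(1), of enc]
    by (intro exI[of _ "enc ` B"]) (simp only: K'(1) finite_imageI simp_thms)
qed

theorem in_category_O_K: "in_category_O K"
  unfolding in_category_O_def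
  using fin_generated_K weight_module_K locally_finite_K K.left_module_axioms by blast

end

section \<open>Lifts of the highest weight vector\<close>

abbreviation "X1 \<equiv> Polynomial.monom (1 :: complex) (Suc 0)"
abbreviation "X2 \<equiv> Polynomial.monom (1 :: complex) 2"
abbreviation "X3 \<equiv> Polynomial.monom (1 :: complex) 3"

context verma_model
begin

lemma eps_closed [simp]: "eps p \<in> carrier N"
  using eps_range by blast

lemma eps_zero: "eps 0 = \<zero>"
  using eps_msc[of 0 0] by simp

lemma eps_inject [simp]: "eps p = eps q \<longleftrightarrow> p = q"
  using eps_inj by (simp add: inj_eq)

lemma ev_eps_one: "ev p (eps 1) = eps p"
proof (induction p)
  case (pCons a p)
  then show ?case by (simp add: ev_pCons eps_msc eps_mvf eps_add[symmetric] mulX_def)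
qed (simp add: eps_zero)

end

locale verma_pair = N: verma_model N lam epsN + M: verma_model M mu epsM
  for N :: "(uwitt, 'n) module" and lam epsN and M :: "(uwitt, 'm) module" and mu epsM

text \<open>
  Short exact sequences of arbitrary modules with the given ends: Baer sums enter as such and are then
  recognized by their lifts.
\<close>

locale exact_ext = verma_pair N lam epsN M mu epsM + K: umod K + i: umod_hom N K i + p: umod_hom K M p
  for N :: "(uwitt, 'n) module" and lam epsN and M :: "(uwitt, 'm) module" and mu epsM
    and K :: "(uwitt, 'k) module" and i p +
  assumes i_inj: "inj_on i (carrier N)"
    and exact: "\<And>y. y \<in> carrier K \<Longrightarrow> p y = \<zero>\<^bsub>M\<^esub> \<longleftrightarrow> y \<in> i ` carrier N"
    and p_surj: "p ` carrier K = carrier M"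
begin

text \<open>
  A weight vector over the highest weight vector of \<open>M\<close>, with the two invariants \<open>d_1 v\<close> and \<open>d_2 v\<close> read off
  in the model \<open>\<complex>[t]\<close> of \<open>N\<close>.
\<close>

definition is_lift :: "complex poly \<Rightarrow> complex poly \<Rightarrow> 'k \<Rightarrow> bool"
  where "is_lift y1 y2 v \<longleftrightarrow> v \<in> carrier K \<and> p v = epsM 1 \<and> mvf K X1 v = msc K mu v \<and>
    mvf K X2 v = i (epsN y1) \<and> mvf K X3 v = i (epsN y2)"

text \<open>
  For a vector \<open>v\<close> over the highest weight vector of \<open>M\<close>, these are coordinates on the middle term: it
  is the sum of the image of \<open>N\<close> and the space of the vectors \<open>q(d_{-1}) v\<close>.
\<close>

definition comb :: "'k \<Rightarrow> complex poly \<times> complex poly \<Rightarrow> 'k"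
  where "comb v w = i (epsN (fst w)) \<oplus>\<^bsub>K\<^esub> K.ev (snd w) v"

lemma p_i: "x \<in> carrier N \<Longrightarrow> p (i x) = \<zero>\<^bsub>M\<^esub>"
  using exact by auto

context
  fixes v assumes v: "v \<in> carrier K" "p v = epsM 1"
begin

lemma p_ev: "p (K.ev q v) = epsM q"
  using v by (simp add: p.ev M.ev_eps_one)

lemma comb_closed: "comb v w \<in> carrier K"
  using v by (simp add: comb_def)

lemma comb_add: "comb v (w + w') = comb v w \<oplus>\<^bsub>K\<^esub> comb v w'"
  using v by (simp add: comb_def N.eps_add i.add K.ev_add K.M.a_ac)

lemma comb_msc: "comb v (scale2 c w) = msc K c (comb v w)"
  using v by (simp add: comb_def scale2_def K.ev_smult K.msc_add N.eps_msc[symmetric] i.msc)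

lemma comb_mvf_1: "comb v (mulX (fst w), mulX (snd w)) = mvf K 1 (comb v w)"
proof -
  have "i (epsN (mulX q)) = mvf K 1 (i (epsN q))" for q
    using i.mvf[of "epsN q" 1] by (simp add: N.eps_mvf)
  then show ?thesis
    using v by (simp add: comb_def mulX_def K.ev_shift K.mvf_add)
qed

lemma comb_inj: "inj (comb v)"
proof (rule injI)
  fix w w' assume eq: "comb v w = comb v w'"
  then have "p (comb v w) = p (comb v w')" by simp
  then have 1: "snd w = snd w'"
    using v by (simp add: comb_def p.add p_ev p_i)
  then have "i (epsN (fst w)) = i (epsN (fst w'))"
    using eq v by (simp add: comb_def K.M.add.right_cancel)
  then have "epsN (fst w) = epsN (fst w')" using i_inj by (simp add: inj_on_eq_iff)
  then show "w = w'" using 1 by (simp add: prod_eq_iff)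
qed

lemma comb_surj: "carrier K \<subseteq> range (comb v)"
proof
  fix y assume y: "y \<in> carrier K"
  then have "p y \<in> range epsM" by (simp add: M.eps_range)
  then obtain q where q: "p y = epsM q" by blast
  define z where "z = y \<ominus>\<^bsub>K\<^esub> K.ev q v"
  have z: "z \<in> carrier K" using y v by (simp add: z_def)
  have "p z = \<zero>\<^bsub>M\<^esub>"
    using y v q by (simp add: z_def a_minus_def p.add p.neg p_ev M.M.r_neg)
  with exact[OF z] obtain x where x: "x \<in> carrier N" "z = i x" by auto
  then obtain q' where "x = epsN q'" using N.eps_range by blast
  moreover have "y = z \<oplus>\<^bsub>K\<^esub> K.ev q v"
    using y v by (simp add: z_def a_minus_def K.M.a_assoc K.M.l_neg)
  ultimately have "y = comb v (q', q)" using x by (simp add: comb_def)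
  then show "y \<in> range (comb v)" by blast
qed

end

text \<open>
  If \<open>v\<close> has weight \<open>mu\<close> then \<open>d_1 v\<close> and \<open>d_2 v\<close> have weights \<open>mu + 1\<close> and \<open>mu + 2\<close>, while \<open>t^k\<close> has weight
  \<open>lam - k\<close>.
\<close>

lemma lift_weights:
  assumes "is_lift y1 y2 v"
  shows "poly.coeff y1 k \<noteq> 0 \<Longrightarrow> lam - mu = of_nat (Suc k)"
    and "poly.coeff y2 k \<noteq> 0 \<Longrightarrow> lam - mu = of_nat (Suc (Suc k))"
proof -
  have v: "v \<in> carrier K" "mvf K X1 v = msc K mu v" "mvf K X2 v = i (epsN y1)" "mvf K X3 v = i (epsN y2)"
    using assms by (auto simp: is_lift_def)
  have wt: "dens lam X1 y = Polynomial.smult (mu + c) y"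
    if y: "mvf K f v = i (epsN y)" and f: "X1 * pderiv f - f * pderiv X1 = Polynomial.smult c f" for f y c
  proof -
    have "i (epsN (dens lam X1 y)) = mvf K X1 (mvf K f v)"
      by (simp add: y i.mvf[symmetric] N.eps_mvf)
    also have "\<dots> = mvf K f (mvf K X1 v) \<oplus>\<^bsub>K\<^esub> mvf K (X1 * pderiv f - f * pderiv X1) v"
      using v(1) by (rule K.mvf_comm)
    also have "\<dots> = msc K mu (mvf K f v) \<oplus>\<^bsub>K\<^esub> msc K c (mvf K f v)"
      using v by (simp add: f K.mvf_msc K.mvf_smult)
    also have "\<dots> = msc K (mu + c) (mvf K f v)" using v by (simp add: K.msc_plus)
    also have "\<dots> = i (epsN (Polynomial.smult (mu + c) y))"
      by (simp add: y i.msc[symmetric] N.eps_msc)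
    finally have "epsN (dens lam X1 y) = epsN (Polynomial.smult (mu + c) y)"
      using i_inj by (simp add: inj_on_eq_iff)
    then show ?thesis by simp
  qed
  have coeff: "lam - of_nat k = mu + c"
    if "dens lam X1 y = Polynomial.smult (mu + c) y" "poly.coeff y k \<noteq> 0" for y c
    using arg_cong[OF that(1), of "\<lambda>y. poly.coeff y k"] coeff_dens_X[of lam y k] that(2) by simp
  have "X1 * pderiv X2 - X2 * pderiv X1 = Polynomial.smult 1 X2"
    "X1 * pderiv X3 - X3 * pderiv X1 = Polynomial.smult 2 X3"
    by (simp_all add: pderiv_monom mult_monom smult_monom diff_monom numeral_eq_Suc)
  from wt[OF v(3) this(1)] wt[OF v(4) this(2)]
  have "poly.coeff y1 k \<noteq> 0 \<Longrightarrow> lam - of_nat k = mu + 1" "poly.coeff y2 k \<noteq> 0 \<Longrightarrow> lam - of_nat k = mu + 2"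
    using coeff by blast+
  then show "poly.coeff y1 k \<noteq> 0 \<Longrightarrow> lam - mu = of_nat (Suc k)"
    "poly.coeff y2 k \<noteq> 0 \<Longrightarrow> lam - mu = of_nat (Suc (Suc k))"
    by (simp_all add: algebra_simps)
qed

lemma lift_shift:
  assumes "is_lift y1 y2 v" "dens lam X1 w = Polynomial.smult mu w"
  shows "is_lift (y1 + dens lam X2 w) (y2 + dens lam X3 w) (v \<oplus>\<^bsub>K\<^esub> i (epsN w))"
  using assms
  by (auto simp: is_lift_def p.add p_i K.mvf_add K.msc_add N.eps_add i.add
      i.mvf[symmetric] i.msc[symmetric] N.eps_mvf N.eps_msc)

lemma lift_unique:
  assumes "is_lift y1 y2 v" "is_lift z1 z2 v'"
  shows "\<exists>w. dens lam X1 w = Polynomial.smult mu w \<and> z1 = y1 + dens lam X2 w \<and> z2 = y2 + dens lam X3 w"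
proof -
  have v: "v \<in> carrier K" "v' \<in> carrier K" "p v = epsM 1" "p v' = epsM 1"
    using assms by (auto simp: is_lift_def)
  obtain w' where w': "v' = comb v w'" using comb_surj[OF v(1,3)] v(2) by blast
  then have "epsM 1 = epsM (snd w')"
    using v p_ev[OF v(1,3)] by (simp add: comb_def p.add p_i)
  then have "snd w' = 1" by simp
  moreover have "K.ev 1 v = v" using v(1) K.ev_pCons[of v 1 0] by (simp add: one_pCons)
  ultimately obtain w where w: "v' = i (epsN w) \<oplus>\<^bsub>K\<^esub> v" using w' by (auto simp: comb_def)
  have diff: "dens lam f w = b - a"
    if "mvf K f v = i (epsN a)" "mvf K f v' = i (epsN b)" for f a b
  proof -
    have "i (epsN b) = i (epsN (dens lam f w + a))"
      using that v w by (simp add: K.mvf_add N.eps_add i.add i.mvf[symmetric] N.eps_mvf)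
    then have "epsN b = epsN (dens lam f w + a)" using i_inj by (simp add: inj_on_eq_iff)
    then show ?thesis by simp
  qed
  have "i (epsN (dens lam X1 w)) \<oplus>\<^bsub>K\<^esub> msc K mu v = i (epsN (Polynomial.smult mu w)) \<oplus>\<^bsub>K\<^esub> msc K mu v"
    using assms w v by (simp add: is_lift_def K.mvf_add K.msc_add i.mvf[symmetric] i.msc[symmetric]
        N.eps_mvf N.eps_msc)
  then have "i (epsN (dens lam X1 w)) = i (epsN (Polynomial.smult mu w))"
    using v by (simp add: K.M.add.right_cancel)
  then have "epsN (dens lam X1 w) = epsN (Polynomial.smult mu w)" using i_inj by (simp add: inj_on_eq_iff)
  moreover have "dens lam X2 w = z1 - y1" "dens lam X3 w = z2 - y2"
    using assms by (auto simp: is_lift_def intro!: diff)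
  ultimately show ?thesis by (intro exI[of _ w]) simp
qed

text \<open>
  The component of weight \<open>mu\<close> of any preimage of the highest weight vector is again a preimage; it
  is a lift since \<open>d_1\<close> and \<open>d_2\<close> kill the highest weight vector.
\<close>

lemma lift_exists:
  assumes wt: "weight_module K"
  shows "\<exists>y1 y2 v. is_lift y1 y2 v"
proof -
  obtain k where k: "k \<in> carrier K" "p k = epsM 1"
    using p_surj M.eps_closed by (metis imageE)
  from wt k(1) obtain f where f: "\<And>c. f c \<in> weight_space K c" "finite {c. f c \<noteq> \<zero>\<^bsub>K\<^esub>}"
      "k = (\<Oplus>\<^bsub>K\<^esub>c\<in>{c. f c \<noteq> \<zero>\<^bsub>K\<^esub>}. f c)"
    unfolding weight_module_def by blast
  let ?A = "{c. f c \<noteq> \<zero>\<^bsub>K\<^esub>}"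
  have dd0: "dd 0 = vf X1" by (simp add: dd_vf)
  have fc: "f c \<in> carrier K" "mvf K X1 (f c) = msc K c (f c)" for c
    using f(1)[of c] by (simp_all add: weight_space_def mvf_def msc_def dd0)
  have "p (f c) \<in> range epsM" for c using fc(1) by (simp add: M.eps_range)
  then have "\<forall>c. \<exists>q. p (f c) = epsM q" by blast
  from choice[OF this] obtain q where q: "\<And>c. p (f c) = epsM (q c)" by auto
  have "p (\<Oplus>\<^bsub>K\<^esub>c\<in>A. f c) = epsM (sum q A)" if "finite A" for A
    using that
  proof (induction A rule: finite_induct)
    case empty
    show ?case by (simp add: M.eps_zero)
  next
    case (insert a A)
    then show ?case using fc by (simp add: K.M.finsum_insert Pi_def p.add q M.eps_add)
  qed
  from this[OF f(2)] f(3) k(2) have one: "sum q ?A = 1" by simp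
  have coeff: "poly.coeff (q c) j = 0" if "mu - of_nat j \<noteq> c" for c j
  proof -
    have "epsM (dens mu X1 (q c)) = epsM (Polynomial.smult c (q c))"
      using fc(1)[of c] arg_cong[OF fc(2)[of c], of p] by (simp add: p.mvf p.msc q M.eps_mvf M.eps_msc)
    then have "poly.coeff (dens mu X1 (q c)) j = c * poly.coeff (q c) j" by simp
    then show ?thesis using coeff_dens_X[of mu "q c" j] that by simp
  qed
  have off: "q c = 0" if "c \<notin> ?A" for c
  proof -
    have "epsM (q c) = epsM 0" using that q[of c] by (simp add: M.eps_zero)
    then show ?thesis by simp
  qed
  have "q mu = 1"
  proof (rule poly_eqI)
    fix j
    show "poly.coeff (q mu) j = poly.coeff 1 j"
    proof (cases "j = 0")
      case True
      have "1 = poly.coeff (sum q ?A) 0" by (simp add: one)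
      also have "\<dots> = (\<Sum>c\<in>?A. if c = mu then poly.coeff (q mu) 0 else 0)"
        unfolding coeff_sum using coeff[of 0] by (intro sum.cong) auto
      also have "\<dots> = poly.coeff (q mu) 0" using f(2) off[of mu] by auto
      finally show ?thesis using True by simp
    next
      case False
      then show ?thesis using coeff[of j mu] by (simp add: coeff_eq_0)
    qed
  qed
  then have pv: "p (f mu) = epsM 1" by (simp add: q)
  have "\<exists>y. mvf K g (f mu) = i (epsN y)" if "poly.coeff g 0 = 0" "poly.coeff g 1 = 0" for g
  proof -
    have "p (mvf K g (f mu)) = \<zero>\<^bsub>M\<^esub>"
      using fc pv that by (simp add: p.mvf M.eps_mvf dens_unit M.eps_zero)
    then obtain x where "x \<in> carrier N" "mvf K g (f mu) = i x" using exact fc by auto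
    moreover from this obtain y where "x = epsN y" using N.eps_range by blast
    ultimately show ?thesis by blast
  qed
  from this[of X2] this[of X3] obtain y1 y2 where "mvf K X2 (f mu) = i (epsN y1)" "mvf K X3 (f mu) = i (epsN y2)"
    by (auto simp: coeff_monom)
  then have "is_lift y1 y2 (f mu)" using fc pv by (simp add: is_lift_def)
  then show ?thesis by blast
qed

end

text \<open>
  Matching the coordinates given by the two lifts defines the equivalence.  It commutes with \<open>d_{-1}\<close> by
  construction; for \<open>d_0\<close>, \<open>d_1\<close>, \<open>d_2\<close> this follows by induction on powers of \<open>d_{-1}\<close>, where commuting past
  \<open>d_{-1}\<close> leads from each of these fields to the preceding one.
\<close>

lemma equiv_from_lifts:
  assumes E: "exact_ext N lam epsN M mu epsM K i p" and E': "exact_ext N lam epsN M mu epsM K' i' p'"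
    and v: "exact_ext.is_lift epsN mu epsM K i p y1 y2 v"
    and v': "exact_ext.is_lift epsN mu epsM K' i' p' y1 y2 v'"
  shows "\<exists>f\<in>mod_hom \<U> K K'. bij_betw f (carrier K) (carrier K') \<and>
    (\<forall>x\<in>carrier N. f (i x) = i' x) \<and> (\<forall>y\<in>carrier K. p' (f y) = p y)"
proof -
  interpret E: exact_ext N lam epsN M mu epsM K i p by fact
  interpret E': exact_ext N lam epsN M mu epsM K' i' p' by fact
  have v1: "v \<in> carrier K" "p v = epsM 1" "mvf K X1 v = msc K mu v" "mvf K X2 v = i (epsN y1)" "mvf K X3 v = i (epsN y2)"
    using v by (auto simp: E.is_lift_def)
  have v1': "v' \<in> carrier K'" "p' v' = epsM 1" "mvf K' X1 v' = msc K' mu v'" "mvf K' X2 v' = i' (epsN y1)" "mvf K' X3 v' = i' (epsN y2)"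
    using v' by (auto simp: E'.is_lift_def)
  note cl = E.comb_closed[OF v1(1,2)] E'.comb_closed[OF v1'(1,2)]
  \<comment> \<open>Vectors of the two middle terms with the same coordinates correspond to each other.\<close>
  define common where "common y y' \<longleftrightarrow> (\<exists>w. y = E.comb v w \<and> y' = E'.comb v' w)" for y y'
  have common_add: "common (a \<oplus>\<^bsub>K\<^esub> b) (a' \<oplus>\<^bsub>K'\<^esub> b')" if "common a a'" "common b b'" for a b a' b'
    using that E.comb_add[OF v1(1,2)] E'.comb_add[OF v1'(1,2)] unfolding common_def by metis
  have common_msc: "common (msc K c a) (msc K' c a')" if "common a a'" for a a' c
    using that E.comb_msc[OF v1(1,2)] E'.comb_msc[OF v1'(1,2)] unfolding common_def by metis
  have common_mvf_1: "common (mvf K 1 a) (mvf K' 1 a')" if "common a a'" for a a'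
    using that E.comb_mvf_1[OF v1(1,2)] E'.comb_mvf_1[OF v1'(1,2)] unfolding common_def by metis
  have common_i: "common (i (epsN y)) (i' (epsN y))" for y
    using v1 v1' unfolding common_def E.comb_def E'.comb_def by (intro exI[of _ "(y, 0)"]) simp
  have common_ev: "common (E.K.ev q v) (E'.K.ev q v')" for q
    using v1 v1' unfolding common_def E.comb_def E'.comb_def
    by (intro exI[of _ "(0, q)"]) (simp add: E.N.eps_zero)
  let ?G = "{1, X1, X2, X3}"
  have der: "\<exists>c. \<exists>h\<in>?G. - pderiv g = Polynomial.smult c h" if "g \<in> ?G" for g
  proof -
    have "- pderiv X1 = Polynomial.smult (-1) 1" "- pderiv X2 = Polynomial.smult (-2) X1"
      "- pderiv X3 = Polynomial.smult (-3) X2" "- pderiv (1 :: complex poly) = Polynomial.smult 0 1"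
      by (simp_all add: pderiv_monom smult_monom monom_0 minus_monom)
    with that show ?thesis by blast
  qed
  have common_gen: "common (mvf K g v) (mvf K' g v')" if "g \<in> ?G" for g
  proof -
    have one: "common v v'" using common_ev[of 1] v1 v1' E.K.ev_pCons[of v 1 0] E'.K.ev_pCons[of v' 1 0]
      by (simp add: one_pCons)
    from that show ?thesis
      using common_mvf_1[OF one] common_msc[OF one] common_i v1 v1' by auto
  qed
  have common_ev_gen: "\<forall>g\<in>?G. common (mvf K g (E.K.ev q v)) (mvf K' g (E'.K.ev q v'))" for q
  proof (induction q)
    case 0
    have "common \<zero>\<^bsub>K\<^esub> \<zero>\<^bsub>K'\<^esub>" using common_ev[of 0] by simp
    then show ?case by simp
  next
    case (pCons a q)
    show ?case
    proof
      fix g assume g: "g \<in> ?G"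
      from der[OF g] obtain c h where h: "h \<in> ?G" "- pderiv g = Polynomial.smult c h" by blast
      have ev: "mvf K g (E.K.ev (pCons a q) v) = msc K a (mvf K g v) \<oplus>\<^bsub>K\<^esub>
          (mvf K 1 (mvf K g (E.K.ev q v)) \<oplus>\<^bsub>K\<^esub> msc K c (mvf K h (E.K.ev q v)))"
        using v1 E.K.mvf_comm[of "E.K.ev q v" g 1] h(2)
        by (simp add: E.K.ev_pCons E.K.mvf_add E.K.mvf_msc E.K.mvf_smult)
      have ev': "mvf K' g (E'.K.ev (pCons a q) v') = msc K' a (mvf K' g v') \<oplus>\<^bsub>K'\<^esub>
          (mvf K' 1 (mvf K' g (E'.K.ev q v')) \<oplus>\<^bsub>K'\<^esub> msc K' c (mvf K' h (E'.K.ev q v')))"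
        using v1' E'.K.mvf_comm[of "E'.K.ev q v'" g 1] h(2)
        by (simp add: E'.K.ev_pCons E'.K.mvf_add E'.K.mvf_msc E'.K.mvf_smult)
      show "common (mvf K g (E.K.ev (pCons a q) v)) (mvf K' g (E'.K.ev (pCons a q) v'))"
        unfolding ev ev' using pCons.IH g h(1)
        by (intro common_add common_msc common_mvf_1 common_gen) auto
    qed
  qed
  have common_mvf: "common (mvf K g a) (mvf K' g a')" if "common a a'" "g \<in> ?G" for g a a'
  proof -
    from that(1) obtain w where w: "a = E.comb v w" "a' = E'.comb v' w" by (auto simp: common_def)
    have "mvf K g (i (epsN (fst w))) = i (epsN (dens lam g (fst w)))"
      "mvf K' g (i' (epsN (fst w))) = i' (epsN (dens lam g (fst w)))"
      by (simp_all add: E.i.mvf[symmetric] E'.i.mvf[symmetric] E.N.eps_mvf)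
    moreover have "common (mvf K g (E.K.ev (snd w) v)) (mvf K' g (E'.K.ev (snd w) v'))"
      using common_ev_gen that(2) by blast
    ultimately show ?thesis
      using common_add[OF common_i[of "dens lam g (fst w)"]] v1 v1'
      unfolding w E.comb_def E'.comb_def by (simp add: E.K.mvf_add E'.K.mvf_add)
  qed
  define f where "f y = E'.comb v' (the_inv (E.comb v) y)" for y
  have f: "f (E.comb v w) = E'.comb v' w" for w
    by (simp add: f_def the_inv_f_f[OF E.comb_inj[OF v1(1,2)]])
  have common_f: "common y (f y)" if "y \<in> carrier K" for y
  proof -
    obtain w where "y = E.comb v w" using E.comb_surj[OF v1(1,2)] \<open>y \<in> carrier K\<close> by blast
    then show ?thesis unfolding common_def by (intro exI[of _ w]) (simp add: f)
  qed
  have f_common: "f y = y'" if "common y y'" for y y'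
    using that by (auto simp: common_def f)
  have closed: "f y \<in> carrier K'" for y unfolding f_def by (rule cl)
  have "f \<in> mod_hom \<U> K K'"
  proof (rule mod_hom_criterion[OF E.K.umod_axioms E'.K.umod_axioms])
    show "f (mvf K g y) = mvf K' g (f y)" if "g \<in> {1, X2, X3}" "y \<in> carrier K" for g y
      using that by (intro f_common common_mvf common_f) auto
  qed (auto intro!: f_common common_add common_msc common_f closed)
  moreover have "bij_betw f (carrier K) (carrier K')"
  proof (rule bij_betwI')
    show "f a = f b \<longleftrightarrow> a = b" if ab: "a \<in> carrier K" "b \<in> carrier K" for a b
    proof -
      obtain w w' where w: "a = E.comb v w" "b = E.comb v w'"
        using E.comb_surj[OF v1(1,2)] ab by blast
      show ?thesis unfolding w f
        using E.comb_inj[OF v1(1,2)] E'.comb_inj[OF v1'(1,2)] by (simp add: inj_eq)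
    qed
    show "\<exists>a\<in>carrier K. b = f a" if b: "b \<in> carrier K'" for b
    proof -
      obtain w where w: "b = E'.comb v' w"
        using E'.comb_surj[OF v1'(1,2)] b by blast
      then show ?thesis using f cl by metis
    qed
  qed (rule closed)
  moreover have "f (i x) = i' x" if "x \<in> carrier N" for x
  proof -
    have "x \<in> range epsN" using that by (simp add: E.N.eps_range)
    then obtain y where "x = epsN y" by blast
    then show ?thesis using f_common[OF common_i] by simp
  qed
  moreover have "p' (f y) = p y" if "y \<in> carrier K" for y
  proof -
    have "y \<in> range (E.comb v)" using E.comb_surj[OF v1(1,2)] that by (rule subsetD)
    then obtain w where w: "y = E.comb v w" by (rule rangeE)
    have "p (E.comb v w) = epsM (snd w)"
      using v1 by (simp add: E.comb_def E.p.add E.p_i E.p_ev)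
    moreover have "p' (E'.comb v' w) = epsM (snd w)"
      using v1' by (simp add: E'.comb_def E'.p.add E'.p_i E'.p_ev)
    ultimately show ?thesis by (simp add: w f)
  qed
  ultimately show ?thesis by blast
qed

section \<open>Baer sums\<close>

text \<open>
  Both Baer sums and scalar multiples are quotients of a submodule \<open>C\<close> of a direct sum by an antidiagonal
  copy of \<open>N\<close>.
\<close>

locale glue = A: umod A + B: umod B + j: umod_hom N A j + k: umod_hom N B k
  for A :: "(uwitt, 'a) module" and B :: "(uwitt, 'b) module" and N :: "(uwitt, 'n) module" and j k +
  fixes C :: "('a \<times> 'b) set"
  assumes C_sub: "C \<subseteq> carrier A \<times> carrier B"
    and C_add: "\<lbrakk>(a, b) \<in> C; (a', b') \<in> C\<rbrakk> \<Longrightarrow> (a \<oplus>\<^bsub>A\<^esub> a', b \<oplus>\<^bsub>B\<^esub> b') \<in> C"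
    and C_act: "\<lbrakk>u \<in> carrier \<U>; (a, b) \<in> C\<rbrakk> \<Longrightarrow> (u \<odot>\<^bsub>A\<^esub> a, u \<odot>\<^bsub>B\<^esub> b) \<in> C"
    and C_glue: "x \<in> carrier N \<Longrightarrow> (j x, \<ominus>\<^bsub>B\<^esub> k x) \<in> C"
begin

definition P :: "(uwitt, 'a \<times> 'b) module"
  where "P = (prod_module A B) \<lparr>carrier := C\<rparr>"

definition H :: "('a \<times> 'b) set"
  where "H = (\<lambda>x. (j x, \<ominus>\<^bsub>B\<^esub> k x)) ` carrier N"

lemma P_simps: "carrier P = C" "\<zero>\<^bsub>P\<^esub> = (\<zero>\<^bsub>A\<^esub>, \<zero>\<^bsub>B\<^esub>)"
  "(a, b) \<oplus>\<^bsub>P\<^esub> (a', b') = (a \<oplus>\<^bsub>A\<^esub> a', b \<oplus>\<^bsub>B\<^esub> b')"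
  "u \<odot>\<^bsub>P\<^esub> (a, b) = (u \<odot>\<^bsub>A\<^esub> a, u \<odot>\<^bsub>B\<^esub> b)"
  by (simp_all add: P_def prod_module_def)

lemma C_carrier: "(a, b) \<in> C \<Longrightarrow> a \<in> carrier A" "(a, b) \<in> C \<Longrightarrow> b \<in> carrier B"
  using C_sub by blast+

lemma C_zero: "(\<zero>\<^bsub>A\<^esub>, \<zero>\<^bsub>B\<^esub>) \<in> C"
  using C_glue[of "\<zero>\<^bsub>N\<^esub>"] by simp

lemma C_neg: "(a, b) \<in> C \<Longrightarrow> (\<ominus>\<^bsub>A\<^esub> a, \<ominus>\<^bsub>B\<^esub> b) \<in> C"
  using C_act[OF U_scal_closed, of a b "-1"] C_carrier[of a b]
  by (simp add: msc_alt[symmetric] A.msc_minus B.msc_minus)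

lemma abelian_group_P: "abelian_group P"
proof (rule abelian_groupI)
  fix x assume "x \<in> carrier P"
  then obtain a b where x: "x = (a, b)" "(a, b) \<in> C" by (metis P_simps(1) surj_pair)
  then show "\<exists>y\<in>carrier P. y \<oplus>\<^bsub>P\<^esub> x = \<zero>\<^bsub>P\<^esub>"
    using C_neg[of a b] C_carrier[of a b]
    by (intro bexI[of _ "(\<ominus>\<^bsub>A\<^esub> a, \<ominus>\<^bsub>B\<^esub> b)"]) (simp_all add: P_simps A.M.l_neg B.M.l_neg)
qed (auto simp: P_simps C_add C_zero C_carrier A.M.a_ac B.M.a_ac)

lemma P_neg: "(a, b) \<in> C \<Longrightarrow> \<ominus>\<^bsub>P\<^esub> (a, b) = (\<ominus>\<^bsub>A\<^esub> a, \<ominus>\<^bsub>B\<^esub> b)"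
proof -
  interpret P: abelian_group P by (rule abelian_group_P)
  show "(a, b) \<in> C \<Longrightarrow> \<ominus>\<^bsub>P\<^esub> (a, b) = (\<ominus>\<^bsub>A\<^esub> a, \<ominus>\<^bsub>B\<^esub> b)"
    using C_neg[of a b] C_carrier[of a b]
    by (intro P.minus_equality) (simp_all add: P_simps A.M.l_neg B.M.l_neg)
qed

lemma H_subgroup: "abelian_subgroup H P"
proof -
  interpret P: abelian_group P by (rule abelian_group_P)
  have "subgroup H (add_monoid P)"
  proof (rule P.add.subgroupI)
    show "H \<subseteq> carrier P" by (auto simp: H_def P_simps C_glue)
    show "H \<noteq> {}" using j.M.M.zero_closed by (auto simp: H_def)
  next
    fix h assume "h \<in> H"
    then obtain x where x: "x \<in> carrier N" "h = (j x, \<ominus>\<^bsub>B\<^esub> k x)" by (auto simp: H_def)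
    then have "\<ominus>\<^bsub>P\<^esub> h = (j (\<ominus>\<^bsub>N\<^esub> x), \<ominus>\<^bsub>B\<^esub> k (\<ominus>\<^bsub>N\<^esub> x))"
      by (simp add: P_neg C_glue j.neg k.neg)
    then show "\<ominus>\<^bsub>P\<^esub> h \<in> H" using x unfolding H_def by blast
  next
    fix h h' assume "h \<in> H" "h' \<in> H"
    then obtain x x' where x: "x \<in> carrier N" "h = (j x, \<ominus>\<^bsub>B\<^esub> k x)"
      "x' \<in> carrier N" "h' = (j x', \<ominus>\<^bsub>B\<^esub> k x')" by (auto simp: H_def)
    then have "h \<oplus>\<^bsub>P\<^esub> h' = (j (x \<oplus>\<^bsub>N\<^esub> x'), \<ominus>\<^bsub>B\<^esub> k (x \<oplus>\<^bsub>N\<^esub> x'))"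
      by (simp add: P_simps j.add k.add B.M.minus_add)
    then show "h \<oplus>\<^bsub>P\<^esub> h' \<in> H" using x unfolding H_def by blast
  qed
  then show ?thesis
    by (intro abelian_subgroupI3 additive_subgroup.intro abelian_group_P)
qed

lemma quotient_setup_glue: "quotient_setup \<U> H P"
proof -
  interpret U: ring \<U> by (rule ring_U)
  interpret S: abelian_subgroup H P by (rule H_subgroup)
  show ?thesis
  proof (intro quotient_setup.intro quotient_setup_axioms.intro)
    show "ring \<U>" ..
    show "abelian_subgroup H P" ..
    fix a x assume a: "a \<in> carrier \<U>"
    show "a \<odot>\<^bsub>P\<^esub> x \<in> H" if "x \<in> H"
    proof -
      from that obtain z where z: "z \<in> carrier N" "x = (j z, \<ominus>\<^bsub>B\<^esub> k z)" by (auto simp: H_def)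
      then have "a \<odot>\<^bsub>P\<^esub> x = (j (a \<odot>\<^bsub>N\<^esub> z), \<ominus>\<^bsub>B\<^esub> k (a \<odot>\<^bsub>N\<^esub> z))"
        using a B.act_msc[of a "k z" "-1"]
        by (simp add: P_simps j.act k.act B.msc_minus B.smult_closed)
      then show ?thesis using z a j.M.smult_closed unfolding H_def by blast
    qed
    fix b assume b: "b \<in> carrier \<U>" and x: "x \<in> carrier P"
    obtain y z where yz: "x = (y, z)" "(y, z) \<in> C" using x by (metis P_simps(1) surj_pair)
    have "(a \<oplus>\<^bsub>\<U>\<^esub> b) \<odot>\<^bsub>P\<^esub> x = a \<odot>\<^bsub>P\<^esub> x \<oplus>\<^bsub>P\<^esub> b \<odot>\<^bsub>P\<^esub> x"
      using a b yz C_carrier[of y z] by (simp add: P_simps A.smult_l_distr B.smult_l_distr)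
    moreover have "(a \<oplus>\<^bsub>\<U>\<^esub> b) \<odot>\<^bsub>P\<^esub> x \<in> carrier P" using a b yz by (simp add: P_simps C_act)
    ultimately show "(a \<oplus>\<^bsub>\<U>\<^esub> b) \<odot>\<^bsub>P\<^esub> x \<in> H +>\<^bsub>P\<^esub> (a \<odot>\<^bsub>P\<^esub> x \<oplus>\<^bsub>P\<^esub> b \<odot>\<^bsub>P\<^esub> x)"
      using S.a_rcos_self by metis
  qed (auto simp: P_simps C_act C_carrier A.smult_r_distr B.smult_r_distr A.smult_assoc1 B.smult_assoc1
      A.smult_one B.smult_one)
qed

definition Q :: "(uwitt, ('a \<times> 'b) set) module"
  where "Q = quot_module P H"

definition cls :: "'a \<times> 'b \<Rightarrow> ('a \<times> 'b) set"
  where "cls w = H +>\<^bsub>P\<^esub> w"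

lemma umod_Q: "umod Q"
  unfolding Q_def by (intro umod.intro quotient_setup.quot_left_module[OF quotient_setup_glue])

lemma Q_carrier: "carrier Q = cls ` C"
  unfolding Q_def cls_def quotient_setup.quot_carrier[OF quotient_setup_glue] P_simps(1) ..

lemma Q_add: "\<lbrakk>(a, b) \<in> C; (a', b') \<in> C\<rbrakk> \<Longrightarrow> cls (a, b) \<oplus>\<^bsub>Q\<^esub> cls (a', b') = cls (a \<oplus>\<^bsub>A\<^esub> a', b \<oplus>\<^bsub>B\<^esub> b')"
  unfolding Q_def cls_def by (simp add: quotient_setup.quot_add[OF quotient_setup_glue] P_simps)

lemma Q_act: "\<lbrakk>u \<in> carrier \<U>; (a, b) \<in> C\<rbrakk> \<Longrightarrow> u \<odot>\<^bsub>Q\<^esub> cls (a, b) = cls (u \<odot>\<^bsub>A\<^esub> a, u \<odot>\<^bsub>B\<^esub> b)"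
  unfolding Q_def cls_def by (simp add: quotient_setup.quot_smult[OF quotient_setup_glue] P_simps)

lemma Q_msc: "(a, b) \<in> C \<Longrightarrow> msc Q c (cls (a, b)) = cls (msc A c a, msc B c b)"
  and Q_mvf: "(a, b) \<in> C \<Longrightarrow> mvf Q f (cls (a, b)) = cls (mvf A f a, mvf B f b)"
  by (simp_all add: msc_alt mvf_alt Q_act U_scal_closed U_gen_closed)

lemma C_mvf: "(a, b) \<in> C \<Longrightarrow> (mvf A f a, mvf B f b) \<in> C"
  by (simp add: mvf_alt C_act U_gen_closed)

lemma C_msc: "(a, b) \<in> C \<Longrightarrow> (msc A c a, msc B c b) \<in> C"
  by (simp add: msc_alt C_act U_scal_closed)

lemma cls_elems: "w \<in> cls (a, b) \<longleftrightarrow> (\<exists>x\<in>carrier N. w = (j x \<oplus>\<^bsub>A\<^esub> a, (\<ominus>\<^bsub>B\<^esub> k x) \<oplus>\<^bsub>B\<^esub> b))"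
  by (auto simp: cls_def a_r_coset_def' H_def P_simps)

lemma cls_eq_iff:
  assumes "(a, b) \<in> C" "(a', b') \<in> C"
  shows "cls (a, b) = cls (a', b') \<longleftrightarrow>
    (\<exists>x\<in>carrier N. a = j x \<oplus>\<^bsub>A\<^esub> a' \<and> b = (\<ominus>\<^bsub>B\<^esub> k x) \<oplus>\<^bsub>B\<^esub> b')"
proof -
  interpret S: abelian_subgroup H P by (rule H_subgroup)
  have "(a, b) \<in> cls (a, b)" unfolding cls_def using assms by (intro S.a_rcos_self) (simp add: P_simps)
  moreover have "cls (a, b) = cls (a', b')" if "(a, b) \<in> cls (a', b')"
    using that assms unfolding cls_def by (intro S.a_repr_independence'[symmetric]) (simp_all add: P_simps)
  ultimately have "cls (a, b) = cls (a', b') \<longleftrightarrow> (a, b) \<in> cls (a', b')" by blast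
  then show ?thesis by (simp add: cls_elems)
qed

lemma the_elem_cls:
  assumes "\<And>x. x \<in> carrier N \<Longrightarrow> g (j x \<oplus>\<^bsub>A\<^esub> a) ((\<ominus>\<^bsub>B\<^esub> k x) \<oplus>\<^bsub>B\<^esub> b) = g a b"
  shows "the_elem ((\<lambda>(y, y'). g y y') ` cls (a, b)) = g a b"
proof -
  have "(\<lambda>(y, y'). g y y') w = g a b" if "w \<in> cls (a, b)" for w
    using that assms by (auto simp: cls_elems)
  then have "(\<lambda>(y, y'). g y y') ` cls (a, b) = (\<lambda>_. g a b) ` cls (a, b)" by (rule image_cong[OF refl])
  moreover have "cls (a, b) \<noteq> {}" using cls_elems j.M.M.zero_closed by blast
  ultimately show ?thesis by (simp add: image_constant_conv)
qed

end

locale ext_pair = E: exact_ext N lam epsN M mu epsM K i p + E': exact_ext N lam epsN M mu epsM K' i' p'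
  for N :: "(uwitt, 'n) module" and lam epsN and M :: "(uwitt, 'm) module" and mu epsM
    and K :: "(uwitt, 'k) module" and i p and K' :: "(uwitt, 'l) module" and i' p'

definition fibre :: "(uwitt, 'k) module \<Rightarrow> ('k \<Rightarrow> 'm) \<Rightarrow> (uwitt, 'l) module \<Rightarrow> ('l \<Rightarrow> 'm) \<Rightarrow> ('k \<times> 'l) set"
  where "fibre K p K' p' = {(y, y'). y \<in> carrier K \<and> y' \<in> carrier K' \<and> p y = p' y'}"

sublocale ext_pair \<subseteq> G: glue K K' N i i' "fibre K p K' p'"
  by unfold_locales (auto simp: fibre_def E.p.add E'.p.add E.p.act E'.p.act E.K.smult_closed E'.K.smult_closed
      E.p_i E'.p_i E'.p.neg)

context ext_pair
begin

definition baer_incl :: "'n \<Rightarrow> ('k \<times> 'l) set"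
  where "baer_incl x = G.cls (i x, \<zero>\<^bsub>K'\<^esub>)"

definition baer_proj :: "('k \<times> 'l) set \<Rightarrow> 'm"
  where "baer_proj c = the_elem ((\<lambda>(y, y'). p y) ` c)"

lemma baer_sum_eq: "baer_sum M N (K, i, p) (K', i', p') = (G.Q, baer_incl, baer_proj)"
  unfolding G.Q_def G.P_def G.H_def baer_incl_def[abs_def] baer_proj_def[abs_def] G.cls_def
  by (simp add: baer_sum_def Let_def fibre_def)

lemma baer_incl_closed: "x \<in> carrier N \<Longrightarrow> (i x, \<zero>\<^bsub>K'\<^esub>) \<in> fibre K p K' p'"
  by (simp add: fibre_def E.p_i)

lemma baer_proj_cls: "(a, b) \<in> fibre K p K' p' \<Longrightarrow> baer_proj (G.cls (a, b)) = p a"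
  unfolding baer_proj_def by (intro G.the_elem_cls) (auto simp: fibre_def E.p.add E.p_i)

text \<open>
  Modulo the antidiagonal, the part in the second copy of \<open>N\<close> can be moved to the first one.
\<close>

lemma cls_i_i':
  assumes x: "x \<in> carrier N" and y: "y \<in> carrier N"
  shows "G.cls (i x, i' y) = baer_incl (x \<oplus>\<^bsub>N\<^esub> y)"
proof -
  have "(\<ominus>\<^bsub>N\<^esub> y) \<oplus>\<^bsub>N\<^esub> (x \<oplus>\<^bsub>N\<^esub> y) = x \<oplus>\<^bsub>N\<^esub> ((\<ominus>\<^bsub>N\<^esub> y) \<oplus>\<^bsub>N\<^esub> y)"
    using x y by (intro E.N.M.a_lcomm) simp_all
  also have "\<dots> = x" using x y by (simp add: E.N.M.l_neg)
  finally have "i x = i (\<ominus>\<^bsub>N\<^esub> y) \<oplus>\<^bsub>K\<^esub> i (x \<oplus>\<^bsub>N\<^esub> y)"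
    using x y by (simp flip: E.i.add)
  moreover have "i' y = (\<ominus>\<^bsub>K'\<^esub> i' (\<ominus>\<^bsub>N\<^esub> y)) \<oplus>\<^bsub>K'\<^esub> \<zero>\<^bsub>K'\<^esub>"
    using y by (simp add: E'.i.neg E'.K.M.minus_minus)
  moreover have "(i x, i' y) \<in> fibre K p K' p'"
    using x y by (simp add: fibre_def E.p_i E'.p_i)
  ultimately show ?thesis
    unfolding baer_incl_def using x y G.cls_eq_iff[OF _ baer_incl_closed] by (meson E.N.M.a_inv_closed E.N.M.a_closed)
qed

lemma exact_ext_baer: "exact_ext N lam epsN M mu epsM G.Q baer_incl baer_proj"
proof -
  interpret Q: umod G.Q by (rule G.umod_Q)
  have "baer_incl \<in> mod_hom \<U> N G.Q"
  proof (rule mod_hom_criterion[OF E.N.umod_axioms Q.umod_axioms])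
    show "baer_incl x \<in> carrier G.Q" if "x \<in> carrier N" for x
      unfolding baer_incl_def G.Q_carrier using baer_incl_closed[OF that] by blast
  qed (simp_all add: baer_incl_def baer_incl_closed G.Q_add G.Q_msc G.Q_mvf E.i.add E.i.msc E.i.mvf)
  moreover have "baer_proj \<in> mod_hom \<U> G.Q M"
    using G.C_add
    by (intro mod_hom_criterion[OF Q.umod_axioms E.M.umod_axioms])
       (auto simp: G.Q_carrier baer_proj_cls G.Q_add G.Q_msc G.Q_mvf E.p.add E.p.msc E.p.mvf G.C_carrier
          G.C_mvf G.C_msc)
  moreover have "inj_on baer_incl (carrier N)"
  proof (rule inj_onI)
    fix x y assume xy: "x \<in> carrier N" "y \<in> carrier N" "baer_incl x = baer_incl y"
    then obtain z where z: "z \<in> carrier N" "i x = i z \<oplus>\<^bsub>K\<^esub> i y" "\<zero>\<^bsub>K'\<^esub> = (\<ominus>\<^bsub>K'\<^esub> i' z) \<oplus>\<^bsub>K'\<^esub> \<zero>\<^bsub>K'\<^esub>"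
      by (auto simp: baer_incl_def G.cls_eq_iff baer_incl_closed)
    then have "\<ominus>\<^bsub>K'\<^esub> i' z = \<zero>\<^bsub>K'\<^esub>" by simp
    then have "i' z = i' \<zero>\<^bsub>N\<^esub>" using E'.K.M.minus_minus[of "i' z"] z(1) by simp
    from inj_onD[OF E'.i_inj this z(1)] have "z = \<zero>\<^bsub>N\<^esub>" by simp
    then have "i x = i y" using z xy by simp
    then show "x = y" using E.i_inj xy by (simp add: inj_on_eq_iff)
  qed
  moreover have "baer_proj c = \<zero>\<^bsub>M\<^esub> \<longleftrightarrow> c \<in> baer_incl ` carrier N" if "c \<in> carrier G.Q" for c
  proof
    obtain a b where c: "c = G.cls (a, b)" "(a, b) \<in> fibre K p K' p'"
      using \<open>c \<in> carrier G.Q\<close> by (auto simp: G.Q_carrier)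
    assume "baer_proj c = \<zero>\<^bsub>M\<^esub>"
    then have "p a = \<zero>\<^bsub>M\<^esub>" "p' b = \<zero>\<^bsub>M\<^esub>" using c baer_proj_cls[OF c(2)] by (auto simp: fibre_def)
    then obtain x y where x: "x \<in> carrier N" "a = i x" and y: "y \<in> carrier N" "b = i' y"
      using E.exact[of a] E'.exact[of b] c(2) by (auto simp: fibre_def)
    then show "c \<in> baer_incl ` carrier N" using c cls_i_i'[of x y] by simp
  next
    assume "c \<in> baer_incl ` carrier N"
    then show "baer_proj c = \<zero>\<^bsub>M\<^esub>" by (auto simp: baer_incl_def baer_proj_cls baer_incl_closed E.p_i)
  qed
  moreover have "baer_proj ` carrier G.Q = carrier M"
  proof
    show "baer_proj ` carrier G.Q \<subseteq> carrier M"
      by (auto simp: G.Q_carrier baer_proj_cls G.C_carrier)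
    show "carrier M \<subseteq> baer_proj ` carrier G.Q"
    proof
      fix m assume "m \<in> carrier M"
      then have m: "m \<in> p ` carrier K" "m \<in> p' ` carrier K'" using E.p_surj E'.p_surj by simp_all
      from m(1) obtain a where "m = p a" "a \<in> carrier K" by (rule imageE)
      moreover from m(2) obtain b where "m = p' b" "b \<in> carrier K'" by (rule imageE)
      ultimately have ab: "a \<in> carrier K" "p a = m" "b \<in> carrier K'" "p' b = m" by simp_all
      then have "(a, b) \<in> fibre K p K' p'" by (simp add: fibre_def)
      moreover from this have "baer_proj (G.cls (a, b)) = m" using ab by (simp add: baer_proj_cls)
      ultimately show "m \<in> baer_proj ` carrier G.Q"
        unfolding G.Q_carrier image_image by (intro image_eqI[of _ _ "(a, b)"]) simp_all
    qed
  qed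
  ultimately show ?thesis
    by (intro exact_ext.intro exact_ext_axioms.intro E.verma_pair_axioms umod_hom.intro umod_hom_axioms.intro
        Q.umod_axioms E.N.umod_axioms E.M.umod_axioms) auto
qed

text \<open>
  A pair of lifts is a lift, and the relation \<open>(i a, i' b) \<sim> (i (a + b), 0)\<close> adds the invariants.
\<close>

lemma lift_baer:
  assumes "E.is_lift y1 y2 v" "E'.is_lift z1 z2 w"
  shows "exact_ext.is_lift epsN mu epsM G.Q baer_incl baer_proj (y1 + z1) (y2 + z2) (G.cls (v, w))"
proof -
  have v: "v \<in> carrier K" "p v = epsM 1" "mvf K X1 v = msc K mu v" "mvf K X2 v = i (epsN y1)" "mvf K X3 v = i (epsN y2)"
    using assms by (auto simp: E.is_lift_def)
  have w: "w \<in> carrier K'" "p' w = epsM 1" "mvf K' X1 w = msc K' mu w" "mvf K' X2 w = i' (epsN z1)" "mvf K' X3 w = i' (epsN z2)"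
    using assms by (auto simp: E'.is_lift_def)
  have vw: "(v, w) \<in> fibre K p K' p'" using v w by (simp add: fibre_def)
  have "G.cls (i (epsN y), i' (epsN z)) = baer_incl (epsN (y + z))" for y z
    by (simp add: cls_i_i' E.N.eps_add)
  then show ?thesis
    unfolding exact_ext.is_lift_def[OF exact_ext_baer]
    using vw v w by (auto simp: G.Q_mvf G.Q_msc baer_proj_cls G.Q_carrier)
qed

end

section \<open>Scalar multiples\<close>

locale scaled_ext = exact_ext N lam epsN M mu epsM K i p
  for N :: "(uwitt, 'n) module" and lam epsN and M :: "(uwitt, 'm) module" and mu epsM
    and K :: "(uwitt, 'k) module" and i p +
  fixes c :: complex

sublocale scaled_ext \<subseteq> G: glue N K N "msc N c" i "carrier N \<times> carrier K"
proof -
  have "msc N c \<in> mod_hom \<U> N N"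
    unfolding mod_hom_def hom_def by (auto simp: N.msc_add N.act_msc)
  then interpret j: umod_hom N N "msc N c"
    by (intro umod_hom.intro umod_hom_axioms.intro N.umod_axioms)
  show "glue N K N (msc N c) i (carrier N \<times> carrier K)"
    by unfold_locales (auto simp: N.smult_closed K.smult_closed)
qed

context scaled_ext
begin

definition scale_incl :: "'n \<Rightarrow> ('n \<times> 'k) set"
  where "scale_incl x = G.cls (x, \<zero>\<^bsub>K\<^esub>)"

definition scale_proj :: "('n \<times> 'k) set \<Rightarrow> 'm"
  where "scale_proj C = the_elem ((\<lambda>(x, y). p y) ` C)"

lemma scale_extension_eq: "scale_extension N c (K, i, p) = (G.Q, scale_incl, scale_proj)"
proof -
  have "G.P = prod_module N K" by (simp add: G.P_def prod_module_def)
  then show ?thesis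
    unfolding G.Q_def G.H_def scale_incl_def[abs_def] scale_proj_def[abs_def] G.cls_def
    by (simp add: scale_extension_def Let_def msc_def)
qed

lemma scale_proj_cls: "\<lbrakk>a \<in> carrier N; b \<in> carrier K\<rbrakk> \<Longrightarrow> scale_proj (G.cls (a, b)) = p b"
  unfolding scale_proj_def by (rule G.the_elem_cls) (auto simp: p.add p.neg p_i)

lemma cls_i:
  assumes x: "x \<in> carrier N" and y: "y \<in> carrier N"
  shows "G.cls (x, i y) = scale_incl (x \<oplus>\<^bsub>N\<^esub> msc N c y)"
proof -
  have "msc N c (\<ominus>\<^bsub>N\<^esub> y) \<oplus>\<^bsub>N\<^esub> (x \<oplus>\<^bsub>N\<^esub> msc N c y) = x \<oplus>\<^bsub>N\<^esub> (msc N c (\<ominus>\<^bsub>N\<^esub> y) \<oplus>\<^bsub>N\<^esub> msc N c y)"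
    using x y by (intro N.M.a_lcomm) simp_all
  also have "\<dots> = x" using x y by (simp add: N.M.l_neg flip: N.msc_add)
  finally have "x = msc N c (\<ominus>\<^bsub>N\<^esub> y) \<oplus>\<^bsub>N\<^esub> (x \<oplus>\<^bsub>N\<^esub> msc N c y)" by simp
  moreover have "i y = (\<ominus>\<^bsub>K\<^esub> i (\<ominus>\<^bsub>N\<^esub> y)) \<oplus>\<^bsub>K\<^esub> \<zero>\<^bsub>K\<^esub>"
    using y by (simp add: i.neg K.M.minus_minus)
  ultimately show ?thesis
    unfolding scale_incl_def using x y by (subst G.cls_eq_iff) (auto intro!: bexI[of _ "\<ominus>\<^bsub>N\<^esub> y"])
qed

lemma exact_ext_scale: "exact_ext N lam epsN M mu epsM G.Q scale_incl scale_proj"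
proof -
  interpret Q: umod G.Q by (rule G.umod_Q)
  have "scale_incl \<in> mod_hom \<U> N G.Q"
  proof (rule mod_hom_criterion[OF N.umod_axioms Q.umod_axioms])
    show "scale_incl x \<in> carrier G.Q" if "x \<in> carrier N" for x
      unfolding scale_incl_def G.Q_carrier using that by (intro imageI) simp
  qed (simp_all add: scale_incl_def G.Q_add G.Q_msc G.Q_mvf)
  moreover have "scale_proj \<in> mod_hom \<U> G.Q M"
    by (intro mod_hom_criterion[OF Q.umod_axioms M.umod_axioms])
       (auto simp: G.Q_carrier scale_proj_cls G.Q_add G.Q_msc G.Q_mvf p.add p.msc p.mvf)
  moreover have "inj_on scale_incl (carrier N)"
  proof (rule inj_onI)
    fix x y assume xy: "x \<in> carrier N" "y \<in> carrier N" "scale_incl x = scale_incl y"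
    then obtain z where z: "z \<in> carrier N" "x = msc N c z \<oplus>\<^bsub>N\<^esub> y" "\<zero>\<^bsub>K\<^esub> = (\<ominus>\<^bsub>K\<^esub> i z) \<oplus>\<^bsub>K\<^esub> \<zero>\<^bsub>K\<^esub>"
      by (auto simp: scale_incl_def G.cls_eq_iff)
    then have "\<ominus>\<^bsub>K\<^esub> i z = \<zero>\<^bsub>K\<^esub>" by simp
    then have "i z = i \<zero>\<^bsub>N\<^esub>" using K.M.minus_minus[of "i z"] z(1) by simp
    from inj_onD[OF i_inj this z(1)] have "z = \<zero>\<^bsub>N\<^esub>" by simp
    then show "x = y" using z xy by simp
  qed
  moreover have "scale_proj C = \<zero>\<^bsub>M\<^esub> \<longleftrightarrow> C \<in> scale_incl ` carrier N" if "C \<in> carrier G.Q" for C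
  proof
    obtain a b where C: "C = G.cls (a, b)" "a \<in> carrier N" "b \<in> carrier K"
      using \<open>C \<in> carrier G.Q\<close> by (auto simp: G.Q_carrier)
    assume "scale_proj C = \<zero>\<^bsub>M\<^esub>"
    then have "p b = \<zero>\<^bsub>M\<^esub>" using C by (simp add: scale_proj_cls)
    then obtain y where y: "y \<in> carrier N" "b = i y" using exact[of b] C(3) by auto
    then show "C \<in> scale_incl ` carrier N" using C cls_i[of a y] by simp
  next
    assume "C \<in> scale_incl ` carrier N"
    then show "scale_proj C = \<zero>\<^bsub>M\<^esub>" by (auto simp: scale_incl_def scale_proj_cls)
  qed
  moreover have "scale_proj ` carrier G.Q = carrier M"
  proof
    show "scale_proj ` carrier G.Q \<subseteq> carrier M"
      by (auto simp: G.Q_carrier scale_proj_cls)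
    show "carrier M \<subseteq> scale_proj ` carrier G.Q"
    proof
      fix m assume "m \<in> carrier M"
      then have "m \<in> p ` carrier K" using p_surj by simp
      then obtain b where b: "m = p b" "b \<in> carrier K" by (rule imageE)
      then have "scale_proj (G.cls (\<zero>\<^bsub>N\<^esub>, b)) = m" by (simp add: scale_proj_cls)
      then show "m \<in> scale_proj ` carrier G.Q"
        unfolding G.Q_carrier image_image using b by (intro image_eqI[of _ _ "(\<zero>\<^bsub>N\<^esub>, b)"]) simp_all
    qed
  qed
  ultimately show ?thesis
    by (intro exact_ext.intro exact_ext_axioms.intro verma_pair_axioms umod_hom.intro umod_hom_axioms.intro
        Q.umod_axioms N.umod_axioms M.umod_axioms) auto
qed

text \<open>
  The relation \<open>(0, i a) \<sim> (c a, 0)\<close> scales the invariants.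
\<close>

lemma lift_scale:
  assumes "is_lift y1 y2 v"
  shows "exact_ext.is_lift epsN mu epsM G.Q scale_incl scale_proj (Polynomial.smult c y1) (Polynomial.smult c y2) (G.cls (\<zero>\<^bsub>N\<^esub>, v))"
proof -
  have v: "v \<in> carrier K" "p v = epsM 1" "mvf K X1 v = msc K mu v" "mvf K X2 v = i (epsN y1)" "mvf K X3 v = i (epsN y2)"
    using assms by (auto simp: is_lift_def)
  have "G.cls (\<zero>\<^bsub>N\<^esub>, i (epsN y)) = scale_incl (epsN (Polynomial.smult c y))" for y
    by (simp add: cls_i N.eps_msc)
  then show ?thesis
    unfolding exact_ext.is_lift_def[OF exact_ext_scale]
    using v by (auto simp: G.Q_mvf G.Q_msc scale_proj_cls G.Q_carrier)
qed

end

section \<open>Extensions with prescribed invariants\<close>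

context verma_pair
begin

abbreviation "has_lift K i p y1 y2 \<equiv> \<exists>v. exact_ext.is_lift epsN mu epsM K i p y1 y2 v"

lemma is_extension_exact:
  assumes "is_extension M N (K, i, p)"
  shows "exact_ext N lam epsN M mu epsM K i p" "weight_module K"
  using assms
  by (auto simp: is_extension_def in_category_O_def a_kernel_def' kernel_def a_kernel_def
      intro!: exact_ext.intro exact_ext_axioms.intro verma_pair_axioms umod_hom.intro umod_hom_axioms.intro
        umod.intro N.umod_axioms M.umod_axioms)

lemma extension_has_lift:
  assumes "is_extension M N (K, i, p)"
  shows "\<exists>y1 y2. has_lift K i p y1 y2"
  using exact_ext.lift_exists[OF is_extension_exact[OF assms]] by blast

lemma equiv_if_lift:
  assumes "exact_ext N lam epsN M mu epsM K i p" "exact_ext N lam epsN M mu epsM K' i' p'"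
    and "has_lift K i p y1 y2" "has_lift K' i' p' y1 y2"
  shows "equiv_extension N (K, i, p) (K', i', p')"
  using equiv_from_lifts[OF assms(1,2)] assms(3,4) unfolding equiv_extension_def by blast

lemma lift_equiv:
  assumes E: "exact_ext N lam epsN M mu epsM K i p" and E': "exact_ext N lam epsN M mu epsM K' i' p'"
    and eq: "equiv_extension N (K, i, p) (K', i', p')" and lift: "has_lift K i p y1 y2"
  shows "has_lift K' i' p' y1 y2"
proof -
  interpret E: exact_ext N lam epsN M mu epsM K i p by fact
  interpret E': exact_ext N lam epsN M mu epsM K' i' p' by fact
  obtain f where f: "f \<in> mod_hom \<U> K K'" "\<forall>x\<in>carrier N. f (i x) = i' x" "\<forall>y\<in>carrier K. p' (f y) = p y"
    using eq unfolding equiv_extension_def by blast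
  interpret f: umod_hom K K' f
    by (intro umod_hom.intro umod_hom_axioms.intro E.K.umod_axioms E'.K.umod_axioms f(1))
  obtain v where v: "v \<in> carrier K" "p v = epsM 1" "mvf K X1 v = msc K mu v"
      "mvf K X2 v = i (epsN y1)" "mvf K X3 v = i (epsN y2)"
    using lift by (auto simp: E.is_lift_def)
  have "E'.is_lift y1 y2 (f v)"
    unfolding E'.is_lift_def using v f(2,3) by (simp flip: f.mvf f.msc)
  then show ?thesis by blast
qed

lemma explicit_extension:
  assumes coc: "cocycle lam n x" and wt: "lam - mu = of_nat n \<or> x = (\<lambda>_. 0)"
  shows "\<exists>K :: (uwitt, 'n \<times> 'm) module. \<exists>i p. is_extension M N (K, i, p) \<and>
    has_lift K i p (Polynomial.monom (x 1) (n - 1)) (Polynomial.monom (x 2) (n - 2))"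
proof -
  define enc where "enc w = (epsN (fst w), epsM (snd w))" for w
  have enc: "inj enc" by (rule injI) (simp add: enc_def prod_eq_iff)
  interpret W: model_ext lam mu n x enc
    using coc wt enc by unfold_locales
  let ?i = "\<lambda>y. (y, \<zero>\<^bsub>M\<^esub>)"
  have carrN: "\<exists>a. y = epsN a" if "y \<in> carrier N" for y using that N.eps_range by blast
  have carrM: "\<exists>b. y = epsM b" if "y \<in> carrier M" for y using that M.eps_range by blast
  have ie: "?i (epsN a) = enc (a, 0)" for a by (simp add: enc_def M.eps_zero)
  have pe: "snd (enc w) = epsM (snd w)" for w by (simp add: enc_def)
  have th0: "theta n x f 0 = 0" for f using theta_linear(2)[of n x f 0 0] by simp
  have "?i \<in> mod_hom \<U> N W.K"
  proof (rule mod_hom_criterion[OF N.umod_axioms W.K.umod_axioms])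
    fix y assume "y \<in> carrier N"
    then obtain a where a: "y = epsN a" using carrN by blast
    show "?i y \<in> carrier W.K" unfolding a ie by (simp add: W.K_carrier)
    show "?i (msc N c y) = msc W.K c (?i y)" for c
      unfolding a N.eps_msc ie W.K_msc by (simp add: scale2_def)
    show "?i (mvf N g y) = mvf W.K g (?i y)" for g
      unfolding a N.eps_mvf ie W.K_mvf by (simp add: ext_op_def[of _ _ _ _ g "(a, 0)"] th0 dens.rho_zero)
    fix z assume "z \<in> carrier N"
    then obtain b where b: "z = epsN b" using carrN by blast
    show "?i (y \<oplus>\<^bsub>N\<^esub> z) = ?i y \<oplus>\<^bsub>W.K\<^esub> ?i z"
      unfolding a b N.eps_add[symmetric] ie W.K_add by simp
  qed
  moreover have "snd \<in> mod_hom \<U> W.K M"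
  proof (rule mod_hom_criterion[OF W.K.umod_axioms M.umod_axioms])
    fix y assume "y \<in> carrier W.K"
    then obtain w where w: "y = enc w" unfolding W.K_carrier by (rule rangeE)
    show "snd y \<in> carrier M" unfolding w pe by simp
    show "snd (msc W.K c y) = msc M c (snd y)" for c
      unfolding w W.K_msc pe M.eps_msc by (simp add: scale2_def)
    show "snd (mvf W.K g y) = mvf M g (snd y)" for g
      unfolding w W.K_mvf pe M.eps_mvf by (simp add: ext_op_def[of _ _ _ _ g w])
    fix z assume "z \<in> carrier W.K"
    then obtain w' where w': "z = enc w'" unfolding W.K_carrier by (rule rangeE)
    show "snd (y \<oplus>\<^bsub>W.K\<^esub> z) = snd y \<oplus>\<^bsub>M\<^esub> snd z"
      unfolding w w' W.K_add pe M.eps_add[symmetric] by simp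
  qed
  moreover have "?i ` carrier N = a_kernel W.K M snd"
  proof -
    have "a_kernel W.K M snd = {enc w | w. snd w = 0}"
      unfolding a_kernel_def' W.K_carrier M.eps_zero[symmetric] by (auto simp: pe)
    also have "\<dots> = ?i ` range epsN"
      using ie by (auto simp: image_iff)
    finally show ?thesis by (simp add: N.eps_range)
  qed
  moreover have "snd ` carrier W.K = carrier M"
  proof -
    have "snd ` carrier W.K = range (\<lambda>w :: complex poly \<times> complex poly. epsM (snd w))"
      unfolding W.K_carrier image_image pe ..
    also have "\<dots> = range epsM"
    proof (intro antisym subsetI)
      fix y assume "y \<in> range epsM"
      then obtain q where "y = epsM (snd (0 :: complex poly, q))" by auto
      then show "y \<in> range (\<lambda>w :: complex poly \<times> complex poly. epsM (snd w))" by (rule range_eqI)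
    qed auto
    finally show ?thesis by (simp add: M.eps_range)
  qed
  ultimately have ext: "is_extension M N (W.K, ?i, snd)"
    unfolding is_extension_def using W.in_category_O_K by (simp add: inj_on_def)
  interpret E: exact_ext N lam epsN M mu epsM W.K ?i snd
    using ext by (rule is_extension_exact)
  have x: "x 0 = 0" "\<forall>i>n. x i = 0" using coc by (auto simp: cocycle_def)
  have op: "ext_op lam mu n x f (0, 1) = (theta n x f 1, dens mu f 1)" for f
    by (simp add: ext_op_def dens.rho_zero)
  have X: "X2 = Polynomial.monom 1 (Suc 1)" "X3 = Polynomial.monom 1 (Suc 2)"
    by (simp_all add: numeral_eq_Suc)
  have "E.is_lift (Polynomial.monom (x 1) (n - 1)) (Polynomial.monom (x 2) (n - 2)) (enc (0, 1))"
    unfolding E.is_lift_def ie W.K_mvf W.K_msc op pe X theta_monom_unit[OF x]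
    by (simp add: W.K_carrier scale2_def dens_unit x coeff_monom)
  then show ?thesis using ext by blast
qed

end

section \<open>The relations in degrees five and seven\<close>

lemma dc_numeral:
  "dc lam 1 k = of_nat k * (of_nat k - 1 - 2 * lam)"
  "dc lam 2 k = - (of_nat k * (of_nat k - 1) * (of_nat k - 2 - 3 * lam))"
  "dc lam 3 k = of_nat k * (of_nat k - 1) * (of_nat k - 2) * (of_nat k - 3 - 4 * lam)"
  "dc lam 4 k = - (of_nat k * (of_nat k - 1) * (of_nat k - 2) * (of_nat k - 3) * (of_nat k - 4 - 5 * lam))"
  "dc lam 5 k = of_nat k * (of_nat k - 1) * (of_nat k - 2) * (of_nat k - 3) * (of_nat k - 4) * (of_nat k - 5 - 6 * lam)"
  by (simp_all add: dc_def falling_def eval_nat_numeral)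

text \<open>
  Up to the factor \<open>-N\<close>, this is the determinant of the pair \<open>(a, b)\<close> and the pair \<open>(dc lam 1 n, dc lam 2 n)\<close> for
  \<open>N = n\<close>, so it vanishes on the change of \<open>(a, b)\<close> caused by another choice of the lift.
\<close>

definition chi :: "complex \<Rightarrow> complex \<Rightarrow> complex \<Rightarrow> complex \<Rightarrow> complex"
  where "chi lam N a b = (N - 1) * (N - 2 - 3 * lam) * a + (N - 1 - 2 * lam) * b"

text \<open>
  The essential factors of the relations in degree 5 and 7.
\<close>

definition kappa5 :: "complex \<Rightarrow> complex \<Rightarrow> complex"
  where "kappa5 lam N = 4 * lam ^ 2 - 4 * lam * (N - 1) + N * (N - 5)"

definition kappa7 :: "complex \<Rightarrow> complex \<Rightarrow> complex"
  where "kappa7 lam N = - 6 * lam ^ 2 + 6 * lam * (N - 1) - N * (N - 7)"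

text \<open>
  The numbers \<open>u\<close>, \<open>w\<close>, \<open>z\<close> are the coefficients of \<open>d_3 v\<close>, \<open>2 d_4 v\<close> and \<open>-d_5 v\<close>, freed from the common
  factors \<open>N - 2\<close>, \<open>N - 3\<close>, \<open>N - 4\<close> that occur in them.  The left-hand sides come from the two expressions for
  \<open>d_5\<close> and for \<open>d_7\<close> as brackets.
\<close>

lemma relation_identities:
  fixes lam N a b u w z :: complex
  assumes u: "u = b * (N - 3 - 2 * lam) + a * (N - 1) * (N - 3 - 3 * lam)"
    and w: "w = u * (N - 4 - 2 * lam) - a * (N - 1) * (N - 4 - 4 * lam)"
    and z: "z = u * (N - 5 - 3 * lam) + b * (N - 5 - 4 * lam)"
  shows "w * (N - 5 - 2 * lam) + 2 * a * (N - 1) * (N - 5 - 5 * lam) + 6 * z = kappa5 lam N * chi lam N a b"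
    and "2 * (z * (N - 7 - 3 * lam) - b * (N - 7 - 6 * lam)) - 3 * (w * (N - 7 - 4 * lam) + 2 * u * (N - 7 - 5 * lam))
      = kappa7 lam N * chi lam N a b"
  unfolding kappa5_def kappa7_def chi_def w z unfolding u by (simp_all add: algebra_simps power2_eq_square)

context exact_ext
begin

text \<open>
  The field \<open>f d/dx\<close> maps \<open>v\<close> to the vector \<open>y\<close> of \<open>N\<close>.
\<close>

definition shadow :: "'k \<Rightarrow> complex poly \<Rightarrow> complex poly \<Rightarrow> bool"
  where "shadow v f y \<longleftrightarrow> mvf K f v = i (epsN y)"

lemma shadow_unique: "shadow v f y \<Longrightarrow> shadow v f z \<Longrightarrow> y = z"
  using inj_onD[OF i_inj, of "epsN y" "epsN z"] by (simp add: shadow_def)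

lemma shadow_smult: "v \<in> carrier K \<Longrightarrow> shadow v f y \<Longrightarrow> shadow v (Polynomial.smult c f) (Polynomial.smult c y)"
  by (simp add: shadow_def K.mvf_smult i.msc[symmetric] N.eps_msc)

lemma shadow_bracket:
  assumes v: "v \<in> carrier K" and f: "shadow v f y" and g: "shadow v g z"
  shows "shadow v (f * pderiv g - g * pderiv f) (dens lam f z - dens lam g y)"
proof -
  have "i (epsN (dens lam f z)) = i (epsN (dens lam g y)) \<oplus>\<^bsub>K\<^esub> mvf K (f * pderiv g - g * pderiv f) v"
    using K.mvf_comm[OF v, of f g] f g by (simp add: shadow_def i.mvf[symmetric] N.eps_mvf)
  moreover have "i (epsN (dens lam f z)) = i (epsN (dens lam g y)) \<oplus>\<^bsub>K\<^esub> i (epsN (dens lam f z - dens lam g y))"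
    by (simp flip: i.add N.eps_add)
  ultimately show ?thesis
    using v by (simp add: shadow_def)
qed

lemma shadow_monom:
  assumes v: "v \<in> carrier K" and f: "shadow v (Polynomial.monom s (Suc a)) (Polynomial.monom y (n - a))"
    and g: "shadow v (Polynomial.monom t (Suc b)) (Polynomial.monom z (n - b))"
    and c: "c = a + b" "c \<le> n" and r: "r = s * t * (of_nat b - of_nat a)"
    and h: "h = s * z * dc lam a (n - b) - t * y * dc lam b (n - a)"
  shows "shadow v (Polynomial.monom r (Suc c)) (Polynomial.monom h (n - c))"
proof -
  have ab: "a + b \<le> n" using c by simp
  have "Polynomial.monom s (Suc a) * pderiv (Polynomial.monom t (Suc b)) - Polynomial.monom t (Suc b) * pderiv (Polynomial.monom s (Suc a))
      = Polynomial.monom (s * t * (of_nat b - of_nat a)) (Suc (a + b))"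
    by (simp add: pderiv_monom mult_monom diff_monom algebra_simps)
  moreover have "dens lam (Polynomial.monom s (Suc a)) (Polynomial.monom z (n - b)) = Polynomial.monom (s * z * dc lam a (n - b)) (n - (a + b))"
    using ab dens_linear(4)[of lam s "Polynomial.monom 1 (Suc a)" "Polynomial.monom z (n - b)"]
    by (simp add: dens_monom smult_monom add.commute mult.assoc)
  moreover have "dens lam (Polynomial.monom t (Suc b)) (Polynomial.monom y (n - a)) = Polynomial.monom (t * y * dc lam b (n - a)) (n - (a + b))"
    using ab dens_linear(4)[of lam t "Polynomial.monom 1 (Suc b)" "Polynomial.monom y (n - a)"]
    by (simp add: dens_monom smult_monom mult.assoc)
  ultimately show ?thesis using shadow_bracket[OF v f g] by (simp add: diff_monom c r h)
qed

text \<open>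
  The relations \<open>[d_1, d_4] = 3 [d_2, d_3]\<close> in degree 5 and \<open>[d_2, d_5] = 3 [d_3, d_4]\<close> in degree 7, applied
  to a lift.  To avoid fractions \<open>2 d_4\<close> is used in place of \<open>d_4\<close>.  The bounds on \<open>n\<close> make sure that the target
  weight spaces of the relations are not zero.
\<close>

lemma lift_relation:
  assumes lift: "is_lift (Polynomial.monom a (n - 1)) (Polynomial.monom b (n - 2)) v" and n: "n \<ge> 5"
  shows "kappa5 lam (of_nat n) * chi lam (of_nat n) a b = 0"
    and "n \<ge> 7 \<Longrightarrow> kappa7 lam (of_nat n) * chi lam (of_nat n) a b = 0"
proof -
  let ?N = "of_nat n :: complex"
  have v: "v \<in> carrier K" using lift by (simp add: is_lift_def)
  define x3 where "x3 = b * dc lam 1 (n - 2) - a * dc lam 2 (n - 1)"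
  define x4 where "x4 = x3 * dc lam 1 (n - 3) - a * dc lam 3 (n - 1)"
  define x5 where "x5 = x3 * dc lam 2 (n - 3) - b * dc lam 3 (n - 2)"
  have 1: "shadow v (Polynomial.monom 1 (Suc 1)) (Polynomial.monom a (n - 1))"
    and 2: "shadow v (Polynomial.monom 1 (Suc 2)) (Polynomial.monom b (n - 2))"
    using lift by (simp_all add: is_lift_def shadow_def eval_nat_numeral)
  have 3: "shadow v (Polynomial.monom 1 (Suc 3)) (Polynomial.monom x3 (n - 3))"
    by (rule shadow_monom[OF v 1 2]) (use n in \<open>simp_all add: x3_def\<close>)
  have 4: "shadow v (Polynomial.monom 2 (Suc 4)) (Polynomial.monom x4 (n - 4))"
    by (rule shadow_monom[OF v 1 3]) (use n in \<open>simp_all add: x4_def\<close>)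
  have 5: "shadow v (Polynomial.monom 1 (Suc 5)) (Polynomial.monom x5 (n - 5))"
    by (rule shadow_monom[OF v 2 3]) (use n in \<open>simp_all add: x5_def\<close>)
  have rel5: "shadow v (Polynomial.monom 6 (Suc 5)) (Polynomial.monom (x4 * dc lam 1 (n - 4) - 2 * a * dc lam 4 (n - 1)) (n - 5))"
    by (rule shadow_monom[OF v 1 4]) (use n in \<open>simp_all\<close>)
  have r5: "x4 * dc lam 1 (n - 4) - 2 * a * dc lam 4 (n - 1) = 6 * x5"
  proof -
    have "shadow v (Polynomial.monom 6 (Suc 5)) (Polynomial.monom (6 * x5) (n - 5))"
      using shadow_smult[OF v 5, of 6] by (simp add: smult_monom)
    from shadow_unique[OF rel5 this] show ?thesis by simp
  qed
  have of_nat: "of_nat (n - k) = ?N - of_nat k" if "k \<le> n" for k using that by (simp add: of_nat_diff)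
  have nz: "?N - of_nat k \<noteq> 0" if "k < n" for k
    using that by simp
  define u where "u = b * (?N - 3 - 2 * lam) + a * (?N - 1) * (?N - 3 - 3 * lam)"
  define w where "w = u * (?N - 4 - 2 * lam) - a * (?N - 1) * (?N - 4 - 4 * lam)"
  define z where "z = u * (?N - 5 - 3 * lam) + b * (?N - 5 - 4 * lam)"
  note ids = relation_identities[OF u_def w_def z_def]
  note dc = dc_numeral[unfolded One_nat_def]
  have x3': "x3 = (?N - 2) * u"
    using n by (simp add: x3_def u_def dc of_nat) (simp add: algebra_simps)
  have x4': "x4 = (?N - 2) * (?N - 3) * w"
    using n by (simp add: x4_def x3' w_def dc of_nat) (simp add: algebra_simps)
  have x5': "x5 = - ((?N - 2) * (?N - 3) * (?N - 4) * z)"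
    using n by (simp add: x5_def x3' z_def dc of_nat) (simp add: algebra_simps)
  have "x4 * dc lam 1 (n - 4) - 2 * a * dc lam 4 (n - 1) - 6 * x5 =
     (?N - 2) * (?N - 3) * (?N - 4) * (w * (?N - 5 - 2 * lam) + 2 * a * (?N - 1) * (?N - 5 - 5 * lam) + 6 * z)"
    using n by (simp add: x4' x5' dc of_nat) (simp add: algebra_simps)
  then have "(?N - 2) * (?N - 3) * (?N - 4) * (kappa5 lam ?N * chi lam ?N a b) = 0"
    unfolding ids r5 by simp
  then show "kappa5 lam ?N * chi lam ?N a b = 0"
    using nz[of 2] nz[of 3] nz[of 4] n by simp
  assume n7: "n \<ge> 7"
  have 7: "shadow v (Polynomial.monom 2 (Suc 7)) (Polynomial.monom (x4 * dc lam 3 (n - 4) - 2 * x3 * dc lam 4 (n - 3)) (n - 7))"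
    by (rule shadow_monom[OF v 3 4]) (use n7 in \<open>simp_all\<close>)
  have rel7: "shadow v (Polynomial.monom 3 (Suc 7)) (Polynomial.monom (x5 * dc lam 2 (n - 5) - b * dc lam 5 (n - 2)) (n - 7))"
    by (rule shadow_monom[OF v 2 5]) (use n7 in \<open>simp_all\<close>)
  have r7: "3 * (x4 * dc lam 3 (n - 4) - 2 * x3 * dc lam 4 (n - 3)) = 2 * (x5 * dc lam 2 (n - 5) - b * dc lam 5 (n - 2))"
  proof -
    have "shadow v (Polynomial.monom 6 (Suc 7)) (Polynomial.monom (3 * (x4 * dc lam 3 (n - 4) - 2 * x3 * dc lam 4 (n - 3))) (n - 7))"
      using shadow_smult[OF v 7, of 3] by (simp add: smult_monom)
    moreover have "shadow v (Polynomial.monom 6 (Suc 7)) (Polynomial.monom (2 * (x5 * dc lam 2 (n - 5) - b * dc lam 5 (n - 2))) (n - 7))"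
      using shadow_smult[OF v rel7, of 2] by (simp add: smult_monom)
    ultimately show ?thesis using shadow_unique by fastforce
  qed
  let ?P = "(?N - 2) * (?N - 3) * (?N - 4) * (?N - 5) * (?N - 6)"
  let ?A = "2 * (z * (?N - 7 - 3 * lam) - b * (?N - 7 - 6 * lam))"
  let ?B = "3 * (w * (?N - 7 - 4 * lam) + 2 * u * (?N - 7 - 5 * lam))"
  have "2 * (x5 * dc lam 2 (n - 5) - b * dc lam 5 (n - 2)) = ?P * ?A"
    using n7 by (simp add: x5' dc of_nat) (simp add: algebra_simps)
  moreover have "3 * (x4 * dc lam 3 (n - 4) - 2 * x3 * dc lam 4 (n - 3)) = ?P * ?B"
    using n7 by (simp add: x4' x3' dc of_nat) (simp add: algebra_simps)
  ultimately have "?P * (?A - ?B) = 0"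
    using r7 by (simp only: right_diff_distrib diff_self)
  then have "?P * (kappa7 lam ?N * chi lam ?N a b) = 0"
    by (simp only: ids(2))
  then show "kappa7 lam ?N * chi lam ?N a b = 0"
    using nz[of 2] nz[of 3] nz[of 4] nz[of 5] nz[of 6] n7 by simp
qed

end

section \<open>The space of extension classes\<close>

lemma poly_eq_monomI: "(\<And>j. poly.coeff y j \<noteq> 0 \<Longrightarrow> j = k) \<Longrightarrow> y = Polynomial.monom (poly.coeff y k) k"
  by (rule poly_eqI) (auto simp: coeff_monom)

lemma dens_X2_monom: "n \<ge> 1 \<Longrightarrow> dens lam X2 (Polynomial.monom c n) = Polynomial.monom (c * dc lam 1 n) (n - 1)"
  using dens_monom[of 1 n lam c] by (simp add: numeral_2_eq_2)

lemma dens_X3_monom: "n \<ge> 1 \<Longrightarrow> dens lam X3 (Polynomial.monom c n) = Polynomial.monom (c * dc lam 2 n) (n - 2)"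
proof (cases "n = 1")
  case True
  then show ?thesis using dens_monom_zero[of 1 2 lam c] dc_numeral(2)[of lam 1]
    by (simp add: numeral_3_eq_3 numeral_2_eq_2)
next
  case False
  moreover assume "n \<ge> 1"
  ultimately show ?thesis using dens_monom[of 2 n lam c] by (simp add: numeral_3_eq_3 numeral_2_eq_2)
qed

lemma dens_X1_monom: "lam - mu = of_nat n \<Longrightarrow> dens lam X1 (Polynomial.monom c n) = Polynomial.smult mu (Polynomial.monom c n)"
  by (rule poly_eqI) (auto simp: coeff_dens_X[unfolded One_nat_def] coeff_monom algebra_simps)

lemma dens_X1_eigen:
  assumes "dens lam X1 w = Polynomial.smult mu w" "lam - mu = of_nat n"
  shows "w = Polynomial.monom (poly.coeff w n) n"
proof (rule poly_eq_monomI)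
  fix j assume "poly.coeff w j \<noteq> 0"
  then have "lam - of_nat j = mu"
    using arg_cong[OF assms(1), of "\<lambda>y. poly.coeff y j"] coeff_dens_X[of lam w j] by simp
  then have "of_nat j = (of_nat n :: complex)" using assms(2) by (simp add: algebra_simps)
  then show "j = n" by simp
qed

lemma (in exact_ext) lift_monoms:
  assumes lift: "is_lift y1 y2 v" and n: "lam - mu = of_nat n"
  shows "y1 = Polynomial.monom (poly.coeff y1 (n - 1)) (n - 1)"
    and "y2 = Polynomial.monom (poly.coeff y2 (n - 2)) (n - 2)"
    and "n = 0 \<Longrightarrow> y1 = 0" and "n < 2 \<Longrightarrow> y2 = 0"
proof -
  have 1: "n = Suc j" if "poly.coeff y1 j \<noteq> 0" for j
    using lift_weights(1)[OF lift that] n by (metis of_nat_eq_iff)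
  have 2: "n = Suc (Suc j)" if "poly.coeff y2 j \<noteq> 0" for j
    using lift_weights(2)[OF lift that] n by (metis of_nat_eq_iff)
  show "y1 = Polynomial.monom (poly.coeff y1 (n - 1)) (n - 1)" using 1 by (intro poly_eq_monomI) simp
  show "y2 = Polynomial.monom (poly.coeff y2 (n - 2)) (n - 2)" using 2 by (intro poly_eq_monomI) simp
  show "y1 = 0" if "n = 0" using 1 that by (intro poly_eqI) fastforce
  show "y2 = 0" if "n < 2" using 2 that by (intro poly_eqI) fastforce
qed

lemma cocycle_zero: "cocycle lam n (\<lambda>_. 0)"
  by (simp add: cocycle_def)

context verma_pair
begin

text \<open>
  If the invariants of every extension are those of a change of lift, then every extension has a lift
  with invariants zero, so that all of them are equivalent.  The space of classes is a single point, and there the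
  vector space operations impose no condition on the map to the zero space.
\<close>

theorem Ext1_trivial:
  assumes triv: "\<And>(K :: (uwitt, 'n \<times> 'm) module) i p y1 y2.
      exact_ext N lam epsN M mu epsM K i p \<Longrightarrow> has_lift K i p y1 y2 \<Longrightarrow>
      \<exists>w. dens lam X1 w = Polynomial.smult mu w \<and> y1 = dens lam X2 w \<and> y2 = dens lam X3 w"
  shows "mod_isomorphic \<C> (Ext1_O M N) zero_space"
proof -
  have zero: "has_lift K i p 0 0" if "exact_ext N lam epsN M mu epsM K i p" "has_lift K i p y1 y2"
    for K :: "(uwitt, 'n \<times> 'm) module" and i p y1 y2
  proof -
    interpret E: exact_ext N lam epsN M mu epsM K i p by fact
    from triv[OF that] obtain w where
      w: "dens lam X1 w = Polynomial.smult mu w" "y1 = dens lam X2 w" "y2 = dens lam X3 w" by blast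
    from that(2) obtain v where v: "E.is_lift y1 y2 v" by blast
    have neg: "dens lam f (- w) = - dens lam f w" for f
      using dens_linear(2)[of lam f "-1" w] by simp
    have "E.is_lift (y1 + dens lam X2 (- w)) (y2 + dens lam X3 (- w)) (v \<oplus>\<^bsub>K\<^esub> i (epsN (- w)))"
      using v by (rule E.lift_shift) (simp add: neg w(1))
    then have "E.is_lift 0 0 (v \<oplus>\<^bsub>K\<^esub> i (epsN (- w)))" unfolding neg w(2,3) by simp
    then show ?thesis by (rule exI)
  qed
  obtain E0 :: "('n, 'm, 'n \<times> 'm) extension" where E0: "is_extension M N E0"
    using explicit_extension[OF cocycle_zero] by blast
  have equiv: "equiv_extension N E E'"
    if ext: "is_extension M N E" "is_extension M N E'" for E E' :: "('n, 'm, 'n \<times> 'm) extension"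
  proof -
    obtain K i p K' i' p' where E: "E = (K, i, p)" "E' = (K', i', p')" by (metis prod_cases3)
    note ex = is_extension_exact(1)[OF ext(1)[unfolded E]] is_extension_exact(1)[OF ext(2)[unfolded E]]
    obtain y1 y2 z1 z2 where "has_lift K i p y1 y2" "has_lift K' i' p' z1 z2"
      using extension_has_lift ext unfolding E by blast
    then show ?thesis unfolding E using equiv_if_lift[OF ex] zero ex by blast
  qed
  have carr: "carrier (Ext1_O M N) = {{E. is_extension M N E}}"
  proof -
    have "extension_class M N E = {E. is_extension M N E}" if "is_extension M N E"
      for E :: "('n, 'm, 'n \<times> 'm) extension"
      unfolding extension_class_def using equiv[OF that] by blast
    then have "extension_class M N ` {E :: ('n, 'm, 'n \<times> 'm) extension. is_extension M N E}
        = (\<lambda>_. {E. is_extension M N E}) ` {E :: ('n, 'm, 'n \<times> 'm) extension. is_extension M N E}"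
      by (intro image_cong) simp_all
    also have "\<dots> = {{E. is_extension M N E}}"
      by (rule image_constant[of E0]) (simp add: E0)
    finally show ?thesis unfolding Ext1_O_def partial_object.simps .
  qed
  show ?thesis
    unfolding mod_isomorphic_def
    by (intro bexI[of _ "\<lambda>_. 0"])
       (auto simp: mod_hom_def hom_def carr zero_space_def complex_line_def bij_betw_def)
qed

end

text \<open>
  Conditions on the linear form \<open>l1 a + l2 b\<close> under which it identifies the space of extension classes
  with \<open>\<complex>\<close>: its kernel is the set of changes of the lift, and it maps the cocycles onto \<open>\<complex>\<close>.  In the
  case \<open>n = 1\<close> there is no coefficient \<open>b\<close>.
\<close>

locale ext_invariant = verma_pair N lam epsN M mu epsM
  for N :: "(uwitt, 'n) module" and lam epsN and M :: "(uwitt, 'm) module" and mu epsM +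
  fixes n :: nat and l1 l2 :: complex
  assumes weight_gap: "lam - mu = of_nat n" and n_pos: "n \<ge> 1"
    and coboundary: "l1 * dc lam 1 n + l2 * dc lam 2 n = 0"
    and kernel: "\<And>a b. (n = 1 \<Longrightarrow> b = 0) \<Longrightarrow> l1 * a + l2 * b = 0 \<Longrightarrow> \<exists>c. c * dc lam 1 n = a \<and> c * dc lam 2 n = b"
    and onto: "\<And>z. \<exists>x. cocycle lam n x \<and> l1 * x 1 + l2 * x 2 = z"
begin

definition ell :: "complex poly \<Rightarrow> complex poly \<Rightarrow> complex"
  where "ell y1 y2 = l1 * poly.coeff y1 (n - 1) + l2 * poly.coeff y2 (n - 2)"

lemma ell_linear: "ell (y1 + z1) (y2 + z2) = ell y1 y2 + ell z1 z2"
  "ell (Polynomial.smult c y1) (Polynomial.smult c y2) = c * ell y1 y2"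
  by (simp_all add: ell_def algebra_simps)

text \<open>
  The value of the linear form on an extension, as a relation: in this form it makes sense for
  middle terms on all types and for exact sequences of arbitrary modules.
\<close>

definition has_inv :: "('n, 'm, 'k) extension \<Rightarrow> complex \<Rightarrow> bool"
  where "has_inv = (\<lambda>(K, i, p) z. exact_ext N lam epsN M mu epsM K i p \<and>
    (\<exists>y1 y2. has_lift K i p y1 y2 \<and> ell y1 y2 = z))"

lemma extension_has_inv: "is_extension M N E \<Longrightarrow> \<exists>z. has_inv E z"
  by (cases E) (auto simp: has_inv_def dest: is_extension_exact extension_has_lift)

lemma inv_unique:
  assumes "has_inv E z" "has_inv E z'"
  shows "z = z'"
proof -
  obtain K i p where E: "E = (K, i, p)" by (metis prod_cases3)
  then interpret E: exact_ext N lam epsN M mu epsM K i p using assms by (simp add: has_inv_def)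
  obtain y1 y2 v z1 z2 v' where l: "E.is_lift y1 y2 v" "ell y1 y2 = z" "E.is_lift z1 z2 v'" "ell z1 z2 = z'"
    using assms by (auto simp: has_inv_def E)
  obtain w where w: "dens lam X1 w = Polynomial.smult mu w" "z1 = y1 + dens lam X2 w" "z2 = y2 + dens lam X3 w"
    using E.lift_unique[OF l(1,3)] by blast
  obtain c where c: "w = Polynomial.monom c n" using dens_X1_eigen[OF w(1) weight_gap] by blast
  have "ell (dens lam X2 w) (dens lam X3 w) = c * (l1 * dc lam 1 n + l2 * dc lam 2 n)"
    unfolding c dens_X2_monom[OF n_pos] dens_X3_monom[OF n_pos] ell_def by (simp add: algebra_simps)
  then show ?thesis using l(2,4) unfolding w(2,3) ell_linear coboundary by simp
qed

lemma equiv_if_inv: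
  assumes "has_inv E z" "has_inv E' z"
  shows "equiv_extension N E E'"
proof -
  obtain K i p K' i' p' where E: "E = (K, i, p)" "E' = (K', i', p')" by (metis prod_cases3)
  then interpret E: exact_ext N lam epsN M mu epsM K i p using assms by (simp add: has_inv_def)
  interpret E': exact_ext N lam epsN M mu epsM K' i' p' using assms E by (simp add: has_inv_def)
  obtain y1 y2 v z1 z2 v' where l: "E.is_lift y1 y2 v" "ell y1 y2 = z" "E'.is_lift z1 z2 v'" "ell z1 z2 = z"
    using assms by (auto simp: has_inv_def E)
  note y = E.lift_monoms[OF l(1) weight_gap] and z = E'.lift_monoms[OF l(3) weight_gap]
  let ?a = "poly.coeff z1 (n - 1) - poly.coeff y1 (n - 1)" and ?b = "poly.coeff z2 (n - 2) - poly.coeff y2 (n - 2)"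
  have "l1 * ?a + l2 * ?b = 0" using l(2,4) by (simp add: ell_def algebra_simps)
  moreover have "?b = 0" if "n = 1" using y(4) z(4) that by simp
  ultimately obtain c where c: "c * dc lam 1 n = ?a" "c * dc lam 2 n = ?b" using kernel by blast
  let ?w = "Polynomial.monom c n"
  have "E.is_lift (y1 + dens lam X2 ?w) (y2 + dens lam X3 ?w) (v \<oplus>\<^bsub>K\<^esub> i (epsN ?w))"
    using l(1) dens_X1_monom[OF weight_gap] by (rule E.lift_shift)
  moreover have "y1 + dens lam X2 ?w = z1"
    unfolding dens_X2_monom[OF n_pos] c by (subst y(1), subst z(1)) (simp add: add_monom)
  moreover have "y2 + dens lam X3 ?w = z2"
    unfolding dens_X3_monom[OF n_pos] c by (subst y(2), subst z(2)) (simp add: add_monom)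
  ultimately show ?thesis
    unfolding E using equiv_if_lift[OF E.exact_ext_axioms E'.exact_ext_axioms] l(3) by auto
qed

lemma inv_if_equiv:
  assumes "has_inv E z" "is_extension M N E'" "equiv_extension N E E'"
  shows "has_inv E' z"
proof -
  obtain K i p K' i' p' where E: "E = (K, i, p)" "E' = (K', i', p')" by (metis prod_cases3)
  have ex: "exact_ext N lam epsN M mu epsM K i p" "exact_ext N lam epsN M mu epsM K' i' p'"
    using assms is_extension_exact by (auto simp: has_inv_def E)
  then show ?thesis using assms lift_equiv[OF ex] unfolding has_inv_def E by blast
qed

text \<open>
  Extension classes are the fibres of the invariant.  For a Baer sum or a scalar multiple this
  describes the class without reference to its middle term.
\<close>

lemma extension_class_inv:
  "has_inv E z \<Longrightarrow> extension_class M N E = {E'. is_extension M N E' \<and> has_inv E' z}"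
  unfolding extension_class_def using equiv_if_inv inv_if_equiv by blast

lemma inv_onto: "\<exists>E :: ('n, 'm, 'n \<times> 'm) extension. is_extension M N E \<and> has_inv E z"
proof -
  obtain x where x: "cocycle lam n x" "l1 * x 1 + l2 * x 2 = z" using onto by blast
  obtain K :: "(uwitt, 'n \<times> 'm) module" and i p where K: "is_extension M N (K, i, p)"
      "has_lift K i p (Polynomial.monom (x 1) (n - 1)) (Polynomial.monom (x 2) (n - 2))"
    using explicit_extension[OF x(1)] weight_gap by blast
  have "ell (Polynomial.monom (x 1) (n - 1)) (Polynomial.monom (x 2) (n - 2)) = z"
    using x(2) by (simp add: ell_def)
  then have "has_inv (K, i, p) z" unfolding has_inv_def using K is_extension_exact by blast
  then show ?thesis using K by blast
qed

lemma inv_baer: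
  assumes "has_inv E z" "has_inv E' z'"
  shows "has_inv (baer_sum M N E E') (z + z')"
proof -
  obtain K i p K' i' p' where E: "E = (K, i, p)" "E' = (K', i', p')" by (metis prod_cases3)
  then interpret B: ext_pair N lam epsN M mu epsM K i p K' i' p'
    using assms by (intro ext_pair.intro) (simp_all add: has_inv_def)
  obtain y1 y2 v z1 z2 v' where l: "B.E.is_lift y1 y2 v" "ell y1 y2 = z" "B.E'.is_lift z1 z2 v'" "ell z1 z2 = z'"
    using assms by (auto simp: has_inv_def E)
  show ?thesis
    unfolding E B.baer_sum_eq has_inv_def
    using B.exact_ext_baer B.lift_baer[OF l(1,3)] ell_linear(1)[of y1 z1 y2 z2] l(2,4) by auto
qed

lemma inv_scale:
  assumes "has_inv E z"
  shows "has_inv (scale_extension N c E) (c * z)"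
proof -
  obtain K i p where E: "E = (K, i, p)" by (metis prod_cases3)
  then interpret B: scaled_ext N lam epsN M mu epsM K i p c
    using assms by (intro scaled_ext.intro) (simp_all add: has_inv_def)
  obtain y1 y2 v where l: "B.is_lift y1 y2 v" "ell y1 y2 = z"
    using assms by (auto simp: has_inv_def E)
  show ?thesis
    unfolding E B.scale_extension_eq has_inv_def
    using B.exact_ext_scale B.lift_scale[OF l(1)] ell_linear(2)[of c y1 y2] l(2) by auto
qed

definition ext_class :: "complex \<Rightarrow> ('n, 'm, 'n \<times> 'm) extension set"
  where "ext_class z = {E. is_extension M N E \<and> has_inv E z}"

definition the_inv_of :: "('n, 'm, 'n \<times> 'm) extension set \<Rightarrow> complex"
  where "the_inv_of C = (THE z. \<exists>E\<in>C. has_inv E z)"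

lemma ext_class_nonempty: "ext_class z \<noteq> {}"
  using inv_onto by (auto simp: ext_class_def)

lemma the_inv_of_class: "the_inv_of (ext_class z) = z"
  unfolding the_inv_of_def using ext_class_nonempty[of z] inv_unique
  by (intro the_equality) (auto simp: ext_class_def)

lemma Ext1_carrier: "carrier (Ext1_O M N) = range ext_class"
proof -
  have "extension_class M N E \<in> range ext_class" if ext: "is_extension M N E" for E :: "('n, 'm, 'n \<times> 'm) extension"
  proof -
    obtain z where "has_inv E z" using extension_has_inv[OF ext] by blast
    then have "extension_class M N E = ext_class z"
      unfolding ext_class_def by (rule extension_class_inv)
    then show ?thesis by simp
  qed
  moreover have "ext_class z \<in> extension_class M N ` {E :: ('n, 'm, 'n \<times> 'm) extension. is_extension M N E}" for z
  proof -
    obtain E :: "('n, 'm, 'n \<times> 'm) extension" where E: "is_extension M N E" "has_inv E z" using inv_onto by blast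
    then have "ext_class z = extension_class M N E"
      unfolding ext_class_def by (simp add: extension_class_inv)
    then show ?thesis using E(1) by simp
  qed
  ultimately show ?thesis by (auto simp: Ext1_O_def)
qed

lemma Ext1_add: "ext_class z \<oplus>\<^bsub>Ext1_O M N\<^esub> ext_class z' = ext_class (z + z')"
proof -
  have "extension_class M N (baer_sum M N E E') = ext_class (z + z')" if "E \<in> ext_class z" "E' \<in> ext_class z'" for E E'
    using that extension_class_inv[OF inv_baer] unfolding ext_class_def by blast
  then have "(\<Union>E\<in>ext_class z. \<Union>E'\<in>ext_class z'. extension_class M N (baer_sum M N E E'))
      = (\<Union>E\<in>ext_class z. \<Union>E'\<in>ext_class z'. ext_class (z + z'))" by simp
  then show ?thesis using ext_class_nonempty by (simp add: Ext1_O_def)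
qed

lemma Ext1_smult: "c \<odot>\<^bsub>Ext1_O M N\<^esub> ext_class z = ext_class (c * z)"
proof -
  have "extension_class M N (scale_extension N c E) = ext_class (c * z)" if "E \<in> ext_class z" for E
    using that extension_class_inv[OF inv_scale] unfolding ext_class_def by blast
  then have "(\<Union>E\<in>ext_class z. extension_class M N (scale_extension N c E)) = (\<Union>E\<in>ext_class z. ext_class (c * z))" by simp
  then show ?thesis using ext_class_nonempty by (simp add: Ext1_O_def)
qed

theorem Ext1_line: "mod_isomorphic \<C> (Ext1_O M N) complex_line"
proof -
  have "the_inv_of \<in> mod_hom \<C> (Ext1_O M N) complex_line"
    unfolding mod_hom_def hom_def
    by (auto simp: Ext1_carrier Ext1_add Ext1_smult the_inv_of_class complex_line_def)
  moreover have "bij_betw the_inv_of (carrier (Ext1_O M N)) (carrier complex_line)"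
    unfolding Ext1_carrier
    by (intro bij_betwI[of _ _ _ ext_class]) (auto simp: the_inv_of_class complex_line_def)
  ultimately show ?thesis unfolding mod_isomorphic_def by blast
qed

end

section \<open>Cocycles in low degree and the case distinction\<close>

text \<open>
  The values of a cocycle on \<open>d_3\<close>, ..., \<open>d_6\<close> are forced by those on \<open>d_1\<close> and \<open>d_2\<close>, through
  \<open>[d_1, d_2] = d_3\<close>, \<open>[d_1, d_3] = 2 d_4\<close>, \<open>[d_2, d_3] = d_5\<close> and \<open>[d_1, d_5] = 4 d_6\<close>.
\<close>

definition small_cocycle :: "complex \<Rightarrow> nat \<Rightarrow> complex \<Rightarrow> complex \<Rightarrow> nat \<Rightarrow> complex"
  where "small_cocycle lam n a b = (
    let x3 = b * dc lam 1 (n - 2) - a * dc lam 2 (n - 1);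
        x4 = (x3 * dc lam 1 (n - 3) - a * dc lam 3 (n - 1)) / 2;
        x5 = x3 * dc lam 2 (n - 3) - b * dc lam 3 (n - 2);
        x6 = (x5 * dc lam 1 (n - 5) - a * dc lam 5 (n - 1)) / 4
    in (\<lambda>j. if j = 0 \<or> j > n then 0 else [0, a, b, x3, x4, x5, x6] ! j))"

text \<open>
  Of the brackets of total degree at most 6, four define the values.  The bracket \<open>[d_1, d_4]\<close> is the
  relation in degree 5 and needs \<open>kappa5\<close> to vanish; \<open>[d_2, d_4]\<close> matters for \<open>n = 6\<close> only, where it holds for all
  \<open>lam\<close>.
\<close>

lemma small_cocycle_cocycle:
  assumes n: "n \<le> 6" and vanish: "n \<ge> 5 \<Longrightarrow> kappa5 lam (of_nat n) = 0"
  shows "cocycle lam n (small_cocycle lam n a b)"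
proof -
  let ?N = "of_nat n :: complex"
  let ?x = "small_cocycle lam n a b"
  define x3 where "x3 = b * dc lam 1 (n - 2) - a * dc lam 2 (n - 1)"
  define x4 where "x4 = (x3 * dc lam 1 (n - 3) - a * dc lam 3 (n - 1)) / 2"
  define x5 where "x5 = x3 * dc lam 2 (n - 3) - b * dc lam 3 (n - 2)"
  define x6 where "x6 = (x5 * dc lam 1 (n - 5) - a * dc lam 5 (n - 1)) / 4"
  have x: "?x j = (if j = 0 \<or> j > n then 0 else [0, a, b, x3, x4, x5, x6] ! j)" for j
    unfolding small_cocycle_def Let_def x3_def x4_def x5_def x6_def by simp
  note dc = dc_numeral[unfolded One_nat_def]
  have rel: "?x j * dc lam i (n - j) - ?x i * dc lam j (n - i) = (of_nat j - of_nat i) * ?x (i + j)"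
    if ij: "1 \<le> i" "i < j" "i + j \<le> n" for i j
  proof -
    have "(i = 1 \<and> j \<in> {2, 3, 4, 5}) \<or> (i = 2 \<and> j \<in> {3, 4})" using ij n by auto
    then consider "i = 1" "j = 2" | "i = 1" "j = 3" | "i = 1" "j = 4" | "i = 1" "j = 5" | "i = 2" "j = 3" | "i = 2" "j = 4"
      by auto
    then show ?thesis
    proof cases
      case 1
      show ?thesis using ij(3) unfolding 1 by (simp add: x x3_def)
    next
      case 2
      show ?thesis using ij(3) unfolding 2 by (simp add: x x4_def)
    next
      case 3
      then consider "n = 5" | "n = 6" using ij n by linarith
      then have "x4 * dc lam 1 (n - 4) - a * dc lam 4 (n - 1) = 3 * x5"
      proof cases
        case 1
        then have k: "lam * lam = 4 * lam" using vanish by (simp add: kappa5_def power2_eq_square)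
        have k': "lam * (lam * y) = 4 * lam * y" for y using k by (metis mult.assoc)
        show ?thesis using 1 by (simp add: x4_def x5_def x3_def dc field_simps k k')
      next
        case 2
        then have "4 * (lam * lam) = 4 * (5 * lam - 3 / 2)"
          using vanish by (simp add: kappa5_def power2_eq_square algebra_simps)
        then have k: "lam * lam = 5 * lam - 3 / 2" unfolding mult_cancel_left by simp
        have k': "lam * (lam * y) = 5 * (lam * y) - 3 / 2 * y" for y
          using arg_cong[OF k, of "\<lambda>z. z * y"] by (simp add: algebra_simps)
        show ?thesis using 2 by (simp add: x4_def x5_def x3_def dc field_simps k k')
      qed
      then show ?thesis using ij(3) unfolding 3 by (simp add: x)
    next
      case 4
      then have n6: "n = 6" using ij n by simp
      then show ?thesis unfolding 4 x by (simp add: x6_def)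
    next
      case 5
      show ?thesis using ij(3) unfolding 5 by (simp add: x x5_def)
    next
      case 6
      then have n6: "n = 6" using ij n by simp
      have "x4 * dc lam 2 2 - b * dc lam 4 4 = 2 * x6"
        by (simp add: x4_def x5_def x3_def x6_def n6 dc field_simps)
      then show ?thesis using n6 unfolding 6 x by simp
    qed
  qed
  then show ?thesis unfolding cocycle_def by (simp add: x)
qed

text \<open>
  For \<open>n \<ge> 2\<close> the numbers \<open>dc lam 1 n\<close> and \<open>dc lam 2 n\<close> do not vanish together, so a pair with zero
  determinant is a multiple of them.
\<close>

lemma coboundary_solve:
  assumes n: "n \<ge> 2" and chi: "chi lam (of_nat n) a b = 0"
  shows "\<exists>c. c * dc lam 1 n = a \<and> c * dc lam 2 n = b"
proof -
  let ?N = "of_nat n :: complex"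
  have N: "?N \<noteq> 0" "?N - 1 \<noteq> 0" using n by auto
  have al: "dc lam 1 n = ?N * (?N - 1 - 2 * lam)" and be: "dc lam 2 n = - (?N * (?N - 1) * (?N - 2 - 3 * lam))"
    by (rule dc_numeral)+
  have rel: "dc lam 2 n * a = dc lam 1 n * b"
  proof -
    have "dc lam 1 n * b - dc lam 2 n * a = ?N * chi lam ?N a b"
      unfolding chi_def al be by (simp add: algebra_simps)
    then show ?thesis using chi by simp
  qed
  show ?thesis
  proof (cases "dc lam 1 n = 0")
    case False
    then show ?thesis using rel by (intro exI[of _ "a / dc lam 1 n"]) (simp add: field_simps)
  next
    case True
    then have "?N - 1 = 2 * lam" using N unfolding al by simp
    then have "2 * (?N - 2 - 3 * lam) = 2 * (?N - 2) - 3 * (?N - 1)" by simp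
    also have "\<dots> = - (?N + 1)" by (simp add: algebra_simps)
    finally have "2 * (?N - 2 - 3 * lam) = - (?N + 1)" .
    moreover have "?N + 1 \<noteq> 0" by (metis of_nat_Suc of_nat_neq_0 add.commute)
    ultimately have "?N - 2 - 3 * lam \<noteq> 0" by (metis mult_zero_right neg_equal_0_iff_equal)
    then have "dc lam 2 n \<noteq> 0" using N unfolding be by simp
    then show ?thesis using rel True by (intro exI[of _ "b / dc lam 2 n"]) (simp add: field_simps)
  qed
qed

text \<open>
  The gaps \<open>n = lam - mu\<close> between the highest weights with nontrivial extensions.
\<close>

definition nontrivial_gap :: "complex \<Rightarrow> nat \<Rightarrow> bool"
  where "nontrivial_gap lam n \<longleftrightarrow> n = 1 \<and> lam = 0 \<or> n \<in> {2, 3, 4} \<or> n \<in> {5, 6} \<and> kappa5 lam (of_nat n) = 0"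

context verma_pair
begin

text \<open>
  For \<open>n = 1\<close> and \<open>lam = 0\<close> the vector \<open>d_{-1} v\<close> of the Verma module is singular, so the change of lift is
  void and \<open>a\<close> itself is the invariant.  Otherwise the invariant is \<open>chi\<close>.
\<close>

lemma Ext1_nontrivial:
  assumes gap: "lam - mu = of_nat n" and nt: "nontrivial_gap lam n"
  shows "mod_isomorphic \<C> (Ext1_O M N) complex_line"
proof (cases "n = 1")
  case True
  then have lam: "lam = 0" using nt by (simp add: nontrivial_gap_def)
  have "ext_invariant N lam epsN M mu epsM n 1 0"
  proof (intro ext_invariant.intro ext_invariant_axioms.intro verma_pair_axioms)
    show "\<exists>x. cocycle lam n x \<and> 1 * x 1 + 0 * x 2 = z" for z
      using small_cocycle_cocycle[of n lam z 0] True
      by (intro exI[of _ "small_cocycle lam n z 0"]) (simp add: small_cocycle_def Let_def)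
  qed (use True lam gap in \<open>simp_all add: dc_numeral[unfolded One_nat_def]\<close>)
  then show ?thesis by (rule ext_invariant.Ext1_line)
next
  case False
  then have n: "2 \<le> n" "n \<le> 6" and vanish: "n \<ge> 5 \<Longrightarrow> kappa5 lam (of_nat n) = 0"
    using nt by (auto simp: nontrivial_gap_def)
  let ?N = "of_nat n :: complex"
  let ?l1 = "(?N - 1) * (?N - 2 - 3 * lam)" and ?l2 = "?N - 1 - 2 * lam"
  have N: "?N - 1 \<noteq> 0" using n by auto
  have "ext_invariant N lam epsN M mu epsM n ?l1 ?l2"
  proof (intro ext_invariant.intro ext_invariant_axioms.intro verma_pair_axioms gap)
    show "?l1 * dc lam 1 n + ?l2 * dc lam 2 n = 0"
      unfolding dc_numeral by (simp add: algebra_simps)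
    show "\<exists>c. c * dc lam 1 n = a \<and> c * dc lam 2 n = b" if "?l1 * a + ?l2 * b = 0" for a b
      using coboundary_solve[OF n(1)] that unfolding chi_def by blast
    show "\<exists>x. cocycle lam n x \<and> ?l1 * x 1 + ?l2 * x 2 = z" for z
    proof -
      have "?l1 \<noteq> 0 \<or> ?l2 \<noteq> 0"
      proof (rule ccontr)
        assume "\<not> (?l1 \<noteq> 0 \<or> ?l2 \<noteq> 0)"
        then have "?N - 2 - 3 * lam = 0" "?N - 1 - 2 * lam = 0" using N by auto
        moreover have "?N + 1 = 3 * (?N - 1 - 2 * lam) - 2 * (?N - 2 - 3 * lam)"
          by (simp add: algebra_simps)
        ultimately have "?N + 1 = 0" by simp
        then show False by (metis of_nat_Suc of_nat_neq_0 add.commute)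
      qed
      then have "\<exists>a b. ?l1 * a + ?l2 * b = z"
      proof
        assume "?l1 \<noteq> 0"
        then show ?thesis by (intro exI[of _ "z / ?l1"] exI[of _ 0]) simp
      next
        assume "?l2 \<noteq> 0"
        then show ?thesis by (intro exI[of _ 0] exI[of _ "z / ?l2"]) simp
      qed
      then obtain a b where ab: "?l1 * a + ?l2 * b = z" by blast
      have "small_cocycle lam n a b 1 = a" "small_cocycle lam n a b 2 = b"
        using n by (simp_all add: small_cocycle_def Let_def)
      then show ?thesis
        using small_cocycle_cocycle[of n lam a b] n(2) vanish ab
        by (intro exI[of _ "small_cocycle lam n a b"]) simp
    qed
  qed (use n in simp_all)
  then show ?thesis by (rule ext_invariant.Ext1_line)
qed

text \<open>
  Every pair of invariants that occurs comes from a change of lift: for \<open>n = 1\<close> because \<open>d_1\<close> does not kill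
  \<open>d_{-1} v\<close>, and for \<open>n \<ge> 5\<close> because the relations force \<open>chi\<close> to vanish.
\<close>

lemma Ext1_zero:
  assumes nt: "\<And>n. lam - mu = of_nat n \<Longrightarrow> \<not> nontrivial_gap lam n"
  shows "mod_isomorphic \<C> (Ext1_O M N) zero_space"
proof (rule Ext1_trivial)
  fix K :: "(uwitt, 'n \<times> 'm) module" and i p y1 y2
  assume E: "exact_ext N lam epsN M mu epsM K i p" and lift: "has_lift K i p y1 y2"
  interpret E: exact_ext N lam epsN M mu epsM K i p by fact
  from lift obtain v where v: "E.is_lift y1 y2 v" by blast
  show "\<exists>w. dens lam X1 w = Polynomial.smult mu w \<and> y1 = dens lam X2 w \<and> y2 = dens lam X3 w"
  proof (cases "\<exists>n. lam - mu = of_nat n")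
    case False
    then have "y1 = 0" "y2 = 0" using E.lift_weights[OF v] by (metis poly_eqI coeff_0)+
    then show ?thesis by (intro exI[of _ 0]) (simp add: dens.rho_zero)
  next
    case True
    then obtain n where gap: "lam - mu = of_nat n" by blast
    let ?a = "poly.coeff y1 (n - 1)" and ?b = "poly.coeff y2 (n - 2)"
    note y = E.lift_monoms[OF v gap]
    have triv: "\<not> nontrivial_gap lam n" using nt[OF gap] .
    show ?thesis
    proof (cases "n = 0")
      case True
      then show ?thesis using y(3,4) by (intro exI[of _ 0]) (simp add: dens.rho_zero)
    next
      case n0: False
      have "\<exists>c. c * dc lam 1 n = ?a \<and> c * dc lam 2 n = ?b"
      proof (cases "n = 1")
        case True
        then have "lam \<noteq> 0" using triv by (simp add: nontrivial_gap_def)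
        then show ?thesis using True y(4)
          by (intro exI[of _ "- ?a / (2 * lam)"]) (simp add: dc_numeral[unfolded One_nat_def])
      next
        case False
        then have n5: "n \<ge> 5" and k6: "n \<le> 6 \<Longrightarrow> kappa5 lam (of_nat n) \<noteq> 0"
          using triv n0 by (auto simp: nontrivial_gap_def)
        have lift': "E.is_lift (Polynomial.monom ?a (n - 1)) (Polynomial.monom ?b (n - 2)) v"
          using v y(1,2) by simp
        have "chi lam (of_nat n) ?a ?b = 0"
        proof (cases "n \<le> 6")
          case True
          then show ?thesis using E.lift_relation(1)[OF lift' n5] k6 by simp
        next
          case False
          let ?N = "of_nat n :: complex"
          \<comment> \<open>In this combination \<open>lam\<close> cancels, so the two factors have no common zero.\<close>
          have "3 * kappa5 lam ?N + 2 * kappa7 lam ?N = ?N * (?N - 1)"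
            by (simp add: kappa5_def kappa7_def algebra_simps power2_eq_square)
          moreover have "?N * (?N - 1) \<noteq> 0" using n5 by auto
          ultimately have "kappa5 lam ?N \<noteq> 0 \<or> kappa7 lam ?N \<noteq> 0" by auto
          then show ?thesis
            using E.lift_relation[OF lift' n5] False by auto
        qed
        then show ?thesis using n5 by (intro coboundary_solve) simp_all
      qed
      then obtain c where c: "c * dc lam 1 n = ?a" "c * dc lam 2 n = ?b" by blast
      have n1: "n \<ge> 1" using n0 by simp
      show ?thesis
        using y(1,2) dens_X1_monom[OF gap, of c] dens_X2_monom[OF n1, of lam c] dens_X3_monom[OF n1, of lam c] c
        by (intro exI[of _ "Polynomial.monom c n"]) simp
    qed
  qed
qed

end

lemma sqrt19_sq: "(complex_of_real (sqrt 19)) * complex_of_real (sqrt 19) = 19"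
proof -
  have "sqrt 19 * sqrt 19 = (19 :: real)" by simp
  then show ?thesis by (metis of_real_mult of_real_numeral)
qed

lemma kappa5_at_5: "kappa5 lam 5 = 0 \<longleftrightarrow> lam = 0 \<or> lam = 4"
proof -
  have "kappa5 lam 5 = 4 * (lam * (lam - 4))" by (simp add: kappa5_def algebra_simps power2_eq_square)
  then show ?thesis by simp
qed

lemma kappa5_at_6: "kappa5 lam 6 = 0 \<longleftrightarrow>
    lam = (5 + complex_of_real (sqrt 19)) / 2 \<or> lam = (5 - complex_of_real (sqrt 19)) / 2"
proof -
  let ?s = "complex_of_real (sqrt 19)"
  have "kappa5 lam 6 = 4 * ((lam - (5 + ?s) / 2) * (lam - (5 - ?s) / 2))"
    using sqrt19_sq by (simp add: kappa5_def field_simps power2_eq_square)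
  then show ?thesis by simp
qed

theorem proposition3p7:
  fixes lam mu :: complex
  shows "mod_isomorphic \<C> (Ext1_O (verma mu) (verma lam))
    (if lam - mu \<in> {2, 3, 4} then complex_line
     else if (lam, mu) \<in> {(0, -1), (0, -5), (4, -1)} then complex_line
     else if (lam, mu) \<in> {((5 + of_real (sqrt 19)) / 2, (-7 + of_real (sqrt 19)) / 2),
                          ((5 - of_real (sqrt 19)) / 2, (-7 - of_real (sqrt 19)) / 2)}
          then complex_line
     else zero_space)"
proof -
  obtain epsN epsM where "verma_model (verma lam) lam epsN" "verma_model (verma mu) mu epsM"
    using verma_model_verma by blast
  then interpret P: verma_pair "verma lam" lam epsN "verma mu" mu epsM
    by (rule verma_pair.intro)
  let ?s = "complex_of_real (sqrt 19)"
  have solve: "lam - mu = c \<longleftrightarrow> mu = lam - c" for c by (auto simp: algebra_simps)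
  have A: "(\<exists>n. lam - mu = of_nat n \<and> nontrivial_gap lam n) \<longleftrightarrow>
      lam - mu \<in> {2, 3, 4} \<or> (lam - mu = 1 \<and> lam = 0) \<or> (lam - mu = 5 \<and> kappa5 lam 5 = 0) \<or> (lam - mu = 6 \<and> kappa5 lam 6 = 0)"
    (is "?L \<longleftrightarrow> ?R")
  proof
    show "?L \<Longrightarrow> ?R" by (auto simp: nontrivial_gap_def)
    assume ?R
    then consider "lam - mu = of_nat 2" | "lam - mu = of_nat 3" | "lam - mu = of_nat 4"
      | "lam - mu = of_nat 1" "lam = 0" | "lam - mu = of_nat 5" "kappa5 lam (of_nat 5) = 0"
      | "lam - mu = of_nat 6" "kappa5 lam (of_nat 6) = 0" by auto
    then show ?L
    proof cases
      case 1 then show ?thesis by (intro exI[of _ 2]) (simp add: nontrivial_gap_def)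
    next
      case 2 then show ?thesis by (intro exI[of _ 3]) (simp add: nontrivial_gap_def)
    next
      case 3 then show ?thesis by (intro exI[of _ 4]) (simp add: nontrivial_gap_def)
    next
      case 4 then show ?thesis by (intro exI[of _ 1]) (simp add: nontrivial_gap_def)
    next
      case 5 then show ?thesis by (intro exI[of _ 5]) (simp add: nontrivial_gap_def)
    next
      case 6 then show ?thesis by (intro exI[of _ 6]) (simp add: nontrivial_gap_def)
    qed
  qed
  have B: "lam - mu = 1 \<and> lam = 0 \<longleftrightarrow> (lam, mu) = (0, -1)"
    unfolding solve by auto
  have C: "lam - mu = 5 \<and> kappa5 lam 5 = 0 \<longleftrightarrow> (lam, mu) = (0, -5) \<or> (lam, mu) = (4, -1)"
    unfolding kappa5_at_5 solve by auto
  have D: "lam - mu = 6 \<and> kappa5 lam 6 = 0 \<longleftrightarrow>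
      (lam, mu) = ((5 + ?s) / 2, (-7 + ?s) / 2) \<or> (lam, mu) = ((5 - ?s) / 2, (-7 - ?s) / 2)"
  proof -
    have e: "(5 + ?s) / 2 - 6 = (-7 + ?s) / 2" "(5 - ?s) / 2 - 6 = (-7 - ?s) / 2"
      by (simp_all add: field_simps)
    show ?thesis unfolding kappa5_at_6 solve e[symmetric] prod.inject by blast
  qed
  have iff: "(\<exists>n. lam - mu = of_nat n \<and> nontrivial_gap lam n) \<longleftrightarrow>
      lam - mu \<in> {2, 3, 4} \<or> (lam, mu) \<in> {(0, -1), (0, -5), (4, -1)} \<or>
      (lam, mu) \<in> {((5 + ?s) / 2, (-7 + ?s) / 2), ((5 - ?s) / 2, (-7 - ?s) / 2)}"
    unfolding A B C D by (simp only: insert_iff empty_iff simp_thms disj_assoc)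
  show ?thesis
  proof (cases "\<exists>n. lam - mu = of_nat n \<and> nontrivial_gap lam n")
    case True
    then have "mod_isomorphic \<C> (Ext1_O (verma mu) (verma lam)) complex_line"
      using P.Ext1_nontrivial by blast
    then show ?thesis using True unfolding iff by (simp only: if_True if_False split: if_split) blast
  next
    case False
    then have "mod_isomorphic \<C> (Ext1_O (verma mu) (verma lam)) zero_space"
      using P.Ext1_zero by blast
    then show ?thesis using False unfolding iff by (simp only: if_False split: if_split) blast
  qed
qed

end
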